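(* Let $A$ be a (not necessarily unital) dg algebra over $\boldsymbol{k}$. Then $$\nabla:=\frac{d}{du}+\frac{\mathscr{U}(\delta)}{u^2}+\frac{\mathscr{V}(\delta)+\Gamma}{u}$$ is a $u$-connection on the mixed complex $(\mathsf{C}^e(A),b^e,B^e)$; its dual is given by $$\nabla^\circ:=\frac{d}{du}+\frac{\mathscr{U}^\circ(\delta)}{u^2}+\frac{\mathscr{V}^\circ(\delta)+\Gamma}{u}.$$ Here $\Gamma_{n+1}=-\frac n2\,\mathrm{id}_{n+1}$ and $$\mathscr{U}(\delta)_{n+1}=\tfrac12\begin{pmatrix}-\mu^{(0)}_{n+1}\delta^{(1)}_{n+1}&-\mu^{(0)}_{n+1}\delta^{(1)}_{n+1}\\ 0&0\end{pmatrix},\quad \mathscr{V}(\delta)_{n+1}=\tfrac12\begin{pmatrix}0&0\\ -h^e_{n+1}\sum_{i=1}^n\sum_{j=i+1}^{n+1}\tau^j_{n+1}\delta^{(i)}_{n+1}&0\end{pmatrix},$$ $$\mathscr{U}^\circ(\delta)_{n+1}=\tfrac12\begin{pmatrix}\mu^{(n)}_{n+1}\delta^{(n)}_{n+1}&\mu^{(n)}_{n+1}\delta^{(n)}_{n+1}\\ 0&0\end{pmatrix},\quad \mathscr{V}^\circ(\delta)_{n+1}=\tfrac12\begin{pmatrix}0&0\\ h^e_{n+1}\sum_{i=1}^n\sum_{j=1}^{i}\tau^j_{n+1}\delta^{(i)}_{n+1}&0\end{pmatrix}$$ (all of $\mathscr{U}(\delta),\mathscr{U}^\circ(\delta),\mathscr{V}(\delta),\mathscr{V}^\circ(\delta)$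 are zero for $n=0$).
   Context: $\boldsymbol{k}$ is a field of characteristic $\ne2$; dg algebras are $\mathbb{Z}/2$-graded with odd differential $d$. A mixed complex $(\mathsf{C},b,B)$ is a $\mathbb{Z}/2$-graded space with odd operators satisfying $b^2=B^2=bB+Bb=0$. A $u$-connection on it is an (even) operator $\nabla=\frac{d}{du}+\mathscr{A}(u)$ on $\mathsf{C}((u))$ (formal Laurent series in an even variable $u$), with $\mathscr{A}(u)$ $\boldsymbol{k}((u))$-linear, such that $[\nabla,b+uB]=\frac1{2u}(b+uB)$. $|a|$ is the parity, $sA$ is $A$ with reversed grading, $|sa|=|a|-1$. $\mathsf{C}(A)=\bigoplus_{n\ge0}A\otimes sA^{\otimes n}$ with elements $a_0[a_1|\dots|a_n]$; $A^e=A\oplus\boldsymbol{k}e$ with $|e|=0$, $de=0$, $ae=ea=a$, $e^2=e$; $\mathsf{C}^+(A)=\bigoplus_{n\ge1}\boldsymbol{k}e\otimes sA^{\otimes n}$; $\mathsf{C}^e(A)=\mathsf{C}(A)\oplus\mathsf{C}^+(A)$. Operators on $\mathsf{C}^e(A)$ are written as $2\times2$ matrices with respect to this decomposition (columns: domain $\mathsf{C}(A)$, $\mathsf{C}^+(A)$). $T_{n+1}$ denotes the restriction of $T$ to $(A\otimes sA^{\otimes n})\oplus(\boldsymbol{k}e\otimes sA^{\otimes n})$ (for $n=0$: to $A$). On $\mathsf{C}^e(A)$ (with $a_0=e$ allowed): $\delta^{(i)}_{n+1}(a_0[a_1|\dots|a_n])=(-1)^{\sum_{k=0}^{i-1}|sa_k|}a_0[\dots|da_i|\dots|a_n]$,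 $0\le i\le n$; for $n\ge1$, $\mu^{(i)}_{n+1}(a_0[a_1|\dots|a_n])=(-1)^{\sum_{k=0}^{i}|sa_k|+1}a_0[\dots|a_ia_{i+1}|\dots|a_n]$ for $0\le i<n$ (for $i=0$: $(-1)^{|a_0|}a_0a_1[a_2|\dots|a_n]$), $\mu^{(n)}_{n+1}(a_0[a_1|\dots|a_n])=-(-1)^{|sa_n|(|a_0|+\sum_{k=1}^{n-1}|sa_k|)}a_na_0[a_1|\dots|a_{n-1}]$; $\mu^{(0)}_1=0$; $b^e_{n+1}=\sum_{i=0}^n\delta^{(i)}_{n+1}+\sum_{i=0}^n\mu^{(i)}_{n+1}$. On $\mathsf{C}(A)$: $\tau_{n+1}(a_0[a_1|\dots|a_n])=(-1)^{|sa_0|\sum_{i=1}^n|sa_i|}a_1[a_2|\dots|a_n|a_0]$, $N_{n+1}=\sum_{i=0}^n\tau_{n+1}^i$; $h^e:\mathsf{C}(A)\to\mathsf{C}^+(A)$, $h^e(a_0[a_1|\dots|a_n])=e[a_0|a_1|\dots|a_n]$; $B^e=\begin{pmatrix}0&0\\ h^e N&0\end{pmatrix}$. Dual: $A^\circ$ is the opposite dg algebra ($A$ with product $a'\otimes a''\mapsto(-1)^{|a'||a''|}a''a'$), and $\Phi_A:\mathsf{C}^e(A)\to\mathsf{C}^e(A^\circ)$ is $a_0[a_1|\dots|a_n]\mapsto(-1)^{n+\sum_{1\le i<j\le n}|sa_i||sa_j|}a_0[a_n|\dots|a_1]$. For a $u$-connection $\nabla^A=\frac{d}{du}+\mathscr{A}_A(u)$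 given by a formula valid for every dg algebra $A$, its dual is the operator $\frac{d}{du}-\Phi_A^{-1}\,\mathscr{A}_{A^\circ}(-u)\,\Phi_A$ on $\mathsf{C}^e(A)((u))$ (again a $u$-connection). *)

theory Defs
  imports
    "HOL-Library.Poly_Mapping"
    "HOL-Library.Z2"
    "HOL-Computational_Algebra.Formal_Laurent_Series"
begin

section \<open>Mixed complexes and u-connections\<close>

text \<open>Parities are elements of the two-element field \<^typ>\<open>bit\<close>; a graded subspace is a
  family \<open>C :: bit \<Rightarrow> 'v set\<close>, with underlying space \<open>C 0 \<oplus> C 1\<close>. Operators on it are functions
  on the ambient type of which only the values on \<open>C 0 \<oplus> C 1\<close> matter.\<close>

definition total_space :: "(bit \<Rightarrow> 'v set) \<Rightarrow> 'v::ab_group_add set" where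
  "total_space C = {x + y | x y. x \<in> C 0 \<and> y \<in> C 1}"

definition linear_op_on ::
    "('k::field \<Rightarrow> 'v::ab_group_add \<Rightarrow> 'v) \<Rightarrow> 'v set \<Rightarrow> ('v \<Rightarrow> 'v) \<Rightarrow> bool" where
  "linear_op_on scale S T \<longleftrightarrow>
     (\<forall>x\<in>S. T x \<in> S) \<and>
     (\<forall>x\<in>S. \<forall>y\<in>S. T (x + y) = T x + T y) \<and>
     (\<forall>c. \<forall>x\<in>S. T (scale c x) = scale c (T x))"

locale mixed_complex = vector_space scale
  for scale :: "'k::field \<Rightarrow> 'v::ab_group_add \<Rightarrow> 'v" +
  fixes C :: "bit \<Rightarrow> 'v set" and b B :: "'v \<Rightarrow> 'v"
  assumes subspace_C: "subspace (C p)"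
    and direct_C: "C 0 \<inter> C 1 = {0}"
    and linear_b: "linear_op_on scale (total_space C) b"
    and linear_B: "linear_op_on scale (total_space C) B"
    and odd_b: "x \<in> C p \<Longrightarrow> b x \<in> C (p + 1)"
    and odd_B: "x \<in> C p \<Longrightarrow> B x \<in> C (p + 1)"
    and bb: "x \<in> total_space C \<Longrightarrow> b (b x) = 0"
    and BB: "x \<in> total_space C \<Longrightarrow> B (B x) = 0"
    and bB_Bb: "x \<in> total_space C \<Longrightarrow> b (B x) + B (b x) = 0"

text \<open>The series \<open>\<Sum>\<^sub>m f\<^sub>m u\<^sup>m\<close> is represented by the function \<open>m \<mapsto> f\<^sub>m\<close>.\<close>

definition laurent :: "'v set \<Rightarrow> (int \<Rightarrow> 'v::zero) set" where
  "laurent S = {f. (\<forall>m. f m \<in> S) \<and> (\<exists>M. \<forall>m<M. f m = 0)}"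

definition upow :: "int \<Rightarrow> (int \<Rightarrow> 'v) \<Rightarrow> int \<Rightarrow> 'v" where
  "upow k f = (\<lambda>m. f (m - k))"

definition ddu :: "('k::ring_1 \<Rightarrow> 'v \<Rightarrow> 'v) \<Rightarrow> (int \<Rightarrow> 'v) \<Rightarrow> int \<Rightarrow> 'v" where
  "ddu scale f = (\<lambda>m. scale (of_int (m + 1)) (f (m + 1)))"

text \<open>Both factors are bounded below, so the convolution sum is over a finite set.\<close>

definition fls_scale ::
    "('k::zero \<Rightarrow> 'v::comm_monoid_add \<Rightarrow> 'v) \<Rightarrow> 'k fls \<Rightarrow> (int \<Rightarrow> 'v) \<Rightarrow> int \<Rightarrow> 'v" where
  "fls_scale scale s f =
     (\<lambda>m. \<Sum>i\<in>{i. fls_nth s i \<noteq> 0 \<and> f (m - i) \<noteq> 0}. scale (fls_nth s i) (f (m - i)))"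

definition laurent_linear ::
    "('k::field \<Rightarrow> 'v::ab_group_add \<Rightarrow> 'v) \<Rightarrow> 'v set \<Rightarrow> ((int \<Rightarrow> 'v) \<Rightarrow> int \<Rightarrow> 'v) \<Rightarrow> bool" where
  "laurent_linear scale S T \<longleftrightarrow>
     (\<forall>f\<in>laurent S. T f \<in> laurent S) \<and>
     (\<forall>f\<in>laurent S. \<forall>g\<in>laurent S. T (\<lambda>m. f m + g m) = (\<lambda>m. T f m + T g m)) \<and>
     (\<forall>s. \<forall>f\<in>laurent S. T (fls_scale scale s f) = fls_scale scale s (T f))"

definition b_plus_uB ::
    "('v \<Rightarrow> 'v) \<Rightarrow> ('v \<Rightarrow> 'v) \<Rightarrow> (int \<Rightarrow> 'v::ab_group_add) \<Rightarrow> int \<Rightarrow> 'v" where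
  "b_plus_uB b B f = (\<lambda>m. b (f m) + upow 1 (\<lambda>j. B (f j)) m)"

definition u_connection ::
    "('k::field \<Rightarrow> 'v::ab_group_add \<Rightarrow> 'v) \<Rightarrow> (bit \<Rightarrow> 'v set) \<Rightarrow> ('v \<Rightarrow> 'v) \<Rightarrow> ('v \<Rightarrow> 'v) \<Rightarrow>
     ((int \<Rightarrow> 'v) \<Rightarrow> int \<Rightarrow> 'v) \<Rightarrow> bool" where
  "u_connection scale C b B nabla \<longleftrightarrow>
     mixed_complex scale C b B \<and>
     (\<forall>p. \<forall>f\<in>laurent (C p). nabla f \<in> laurent (C p)) \<and>
     (\<exists>\<A>. laurent_linear scale (total_space C) \<A> \<and>
        (\<forall>f\<in>laurent (total_space C). nabla f = (\<lambda>m. ddu scale f m + \<A> f m))) \<and>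
     (\<forall>f\<in>laurent (total_space C).
        (\<lambda>m. nabla (b_plus_uB b B f) m - b_plus_uB b B (nabla f) m)
          = (\<lambda>m. scale (1 / 2) (upow (- 1) (b_plus_uB b B f) m)))"

section \<open>Dg algebras\<close>

definition sgn_par :: "bit \<Rightarrow> 'k::ring_1" where
  "sgn_par p = (if p = 0 then 1 else - 1)"

record ('k, 'a) dga =
  scl :: "'k \<Rightarrow> 'a \<Rightarrow> 'a"
  hom :: "bit \<Rightarrow> 'a set"
  mul :: "'a \<Rightarrow> 'a \<Rightarrow> 'a"
  dif :: "'a \<Rightarrow> 'a"

locale dg_algebra = vector_space "scl A"
  for A :: "('k::field, 'a::ab_group_add) dga" +
  assumes subspace_hom: "subspace (hom A p)"
    and direct_hom: "hom A 0 \<inter> hom A 1 = {0}"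
    and total_hom: "total_space (hom A) = UNIV"
    and mul_add_left: "mul A (x + y) z = mul A x z + mul A y z"
    and mul_add_right: "mul A x (y + z) = mul A x y + mul A x z"
    and mul_scl_left: "mul A (scl A c x) y = scl A c (mul A x y)"
    and mul_scl_right: "mul A x (scl A c y) = scl A c (mul A x y)"
    and mul_assoc: "mul A (mul A x y) z = mul A x (mul A y z)"
    and mul_hom: "x \<in> hom A p \<Longrightarrow> y \<in> hom A q \<Longrightarrow> mul A x y \<in> hom A (p + q)"
    and dif_add: "dif A (x + y) = dif A x + dif A y"
    and dif_scl: "dif A (scl A c x) = scl A c (dif A x)"
    and dif_hom: "x \<in> hom A p \<Longrightarrow> dif A x \<in> hom A (p + 1)"
    and dif_dif: "dif A (dif A x) = 0"
    and leibniz: "x \<in> hom A p \<Longrightarrow>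
      dif A (mul A x y) = mul A (dif A x) y + scl A (sgn_par p) (mul A x (dif A y))"

definition hom_part :: "('k, 'a::ab_group_add) dga \<Rightarrow> bit \<Rightarrow> 'a \<Rightarrow> 'a" where
  "hom_part A p a = (THE x. x \<in> hom A p \<and> (\<exists>y\<in>hom A (p + 1). a = x + y))"

definition opp :: "('k::field, 'a::ab_group_add) dga \<Rightarrow> ('k, 'a) dga" where
  "opp A = A\<lparr>mul := \<lambda>x y. \<Sum>p\<in>{0, 1}. \<Sum>q\<in>{0, 1}.
     scl A (sgn_par (p * q)) (mul A (hom_part A q y) (hom_part A p x))\<rparr>"

section \<open>The space of extended Hochschild chains\<close>

text \<open>A letter \<open>(p, a)\<close> is a homogeneous element \<open>a \<in> A\<close> together with its parity \<open>p\<close> (so that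
  the parity of \<open>0\<close> is unambiguous). The word \<open>(Some a\<^sub>0, [a\<^sub>1, \<dots>, a\<^sub>n])\<close> stands for
  \<open>a\<^sub>0[a\<^sub>1|\<dots>|a\<^sub>n]\<close>, and \<open>(None, [a\<^sub>1, \<dots>, a\<^sub>n])\<close> for \<open>e[a\<^sub>1|\<dots>|a\<^sub>n]\<close>, where \<open>n \<ge> 1\<close>.\<close>

type_synonym 'a letter = "bit \<times> 'a"
type_synonym 'a word = "'a letter option \<times> 'a letter list"
type_synonym ('k, 'a) chain = "'a word \<Rightarrow>\<^sub>0 'k"

definition words :: "('k, 'a) dga \<Rightarrow> 'a word set" where
  "words A = {(x0, xs). (\<forall>(p, a)\<in>set_option x0 \<union> set xs. a \<in> hom A p) \<and> (x0 = None \<longrightarrow> xs \<noteq> [])}"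

text \<open>The degree \<open>n\<close>, the parity \<open>|a\<^sub>0|\<close> (with \<open>|e| = 0\<close>), the parities \<open>|sa\<^sub>k|\<close> for
  \<open>0 \<le> k \<le> n\<close>, and the parity of the whole word.\<close>

definition deg :: "'a word \<Rightarrow> nat" where
  "deg w = length (snd w)"

definition par0 :: "'a word \<Rightarrow> bit" where
  "par0 w = (case fst w of None \<Rightarrow> 0 | Some x \<Rightarrow> fst x)"

definition spar :: "'a word \<Rightarrow> nat \<Rightarrow> bit" where
  "spar w k = (if k = 0 then par0 w - 1 else fst (snd w ! (k - 1)) - 1)"

definition wpar :: "'a word \<Rightarrow> bit" where
  "wpar w = par0 w + (\<Sum>k=1..deg w. spar w k)"

definition csmult :: "'k::field \<Rightarrow> ('w \<Rightarrow>\<^sub>0 'k) \<Rightarrow> ('w \<Rightarrow>\<^sub>0 'k)" where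
  "csmult c = Poly_Mapping.map ((*) c)"

lemma lookup_csmult [simp]:
  "Poly_Mapping.lookup (csmult c x) w = c * Poly_Mapping.lookup x w"
  by (simp add: csmult_def Poly_Mapping.map.rep_eq when_def)

interpretation chain: vector_space csmult
  by unfold_locales (auto intro!: poly_mapping_eqI simp: lookup_add algebra_simps)

text \<open>The space of chains is the quotient of the free vector space on words by multilinearity in
  each letter, i.e. the direct sum of the tensor products of the homogeneous components of \<open>A\<close>.
  A slot is a word with one letter missing.\<close>

definition slots :: "('a letter \<Rightarrow> 'a word) set" where
  "slots = {\<lambda>x. (Some x, xs) | xs. True} \<union> {\<lambda>x. (x0, ys @ x # zs) | x0 ys zs. True}"

definition tensor_rel :: "('k::field, 'a::ab_group_add) dga \<Rightarrow> ('k, 'a) chain set" where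
  "tensor_rel A = chain.span
     ({Poly_Mapping.single (\<sigma> (p, a + a')) 1 - Poly_Mapping.single (\<sigma> (p, a)) 1
         - Poly_Mapping.single (\<sigma> (p, a')) 1
       | \<sigma> p a a'. \<sigma> \<in> slots \<and> \<sigma> (p, a) \<in> words A \<and> \<sigma> (p, a') \<in> words A} \<union>
      {Poly_Mapping.single (\<sigma> (p, scl A c a)) 1 - csmult c (Poly_Mapping.single (\<sigma> (p, a)) 1)
       | \<sigma> p a c. \<sigma> \<in> slots \<and> \<sigma> (p, a) \<in> words A})"

text \<open>In order to have genuine vectors, rather than cosets, as elements, the quotient by
  \<open>tensor_rel A\<close> is realized as the image of a linear projection with this kernel: \<open>nf A x\<close>
  is the class of \<open>x\<close>. Such projections exist since every subspace has a complement.\<close>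

definition is_nf :: "('k::field, 'a::ab_group_add) dga \<Rightarrow>
    (('k, 'a) chain \<Rightarrow> ('k, 'a) chain) \<Rightarrow> bool" where
  "is_nf A P \<longleftrightarrow> Vector_Spaces.linear csmult csmult P \<and> (\<forall>x. P (P x) = P x) \<and>
     (\<forall>x. P x = 0 \<longleftrightarrow> x \<in> tensor_rel A)"

definition nf :: "('k::field, 'a::ab_group_add) dga \<Rightarrow> ('k, 'a) chain \<Rightarrow> ('k, 'a) chain" where
  "nf A = (SOME P. is_nf A P)"

lemma is_nf_nf: "is_nf A (nf A)"
proof -
  interpret vp: vector_space_pair csmult csmult by unfold_locales
  let ?R = "tensor_rel A"
  have sub: "chain.subspace ?R"
    unfolding tensor_rel_def by (rule chain.subspace_span)
  obtain X where X0: "X \<subseteq> ?R" "chain.independent X" "?R \<subseteq> chain.span X"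
    by (rule chain.basis_exists[of ?R]) (rule that)
  have X: "X \<subseteq> ?R" "chain.independent X" "chain.span X = ?R"
    using X0(1,2) subset_antisym[OF chain.span_minimal[OF X0(1) sub] X0(3)] by simp_all
  define Y where "Y = chain.extend_basis X"
  have Y: "X \<subseteq> Y" "chain.independent Y" "chain.span Y = UNIV"
    unfolding Y_def by (rule chain.extend_basis_superset[OF X(2)]
      chain.independent_extend_basis[OF X(2)] chain.span_extend_basis[OF X(2)])+
  define P where "P = vp.construct Y (\<lambda>y. if y \<in> X then 0 else y)"
  have lin: "Vector_Spaces.linear csmult csmult P"
    unfolding P_def using Y(2) by (rule vp.linear_construct)
  interpret P: Vector_Spaces.linear csmult csmult P by (rule lin)
  have PY: "P y = (if y \<in> X then 0 else y)" if "y \<in> Y" for y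
    unfolding P_def using vp.construct_basis[OF Y(2) that] .
  have idem: "P (P x) = P x" for x
  proof -
    have "x \<in> chain.span Y" using Y(3) by simp
    then show ?thesis
      by (induction rule: chain.span_induct_alt) (simp_all add: P.zero P.add P.scale PY)
  qed
  have diff: "x - P x \<in> ?R" for x
  proof -
    have "x \<in> chain.span Y" using Y(3) by simp
    then show ?thesis
    proof (induction rule: chain.span_induct_alt)
      case base
      show ?case using chain.subspace_0[OF sub] by (simp add: P.zero)
    next
      case (step c y z)
      have "y - P y \<in> chain.span X"
        using PY[OF step(1)] by (cases "y \<in> X") (simp_all add: chain.span_base chain.span_zero)
      then have "csmult c (y - P y) + (z - P z) \<in> chain.span X"
        using step(2) unfolding X(3)[symmetric] by (intro chain.span_add chain.span_scale)
      moreover have "csmult c y + z - P (csmult c y + z) = csmult c (y - P y) + (z - P z)"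
        by (simp add: P.add P.scale chain.scale_right_diff_distrib)
      ultimately show ?case unfolding X(3) by (simp only:)
    qed
  qed
  have ker: "P x = 0 \<longleftrightarrow> x \<in> ?R" for x
  proof
    show "x \<in> ?R" if "P x = 0" using diff[of x] that by simp
  next
    assume "x \<in> ?R"
    then have "x \<in> chain.span X" using X(3) by simp
    then show "P x = 0"
      by (induction rule: chain.span_induct_alt)
        (simp_all add: P.zero P.add P.scale PY[OF subsetD[OF Y(1)]])
  qed
  have "is_nf A P" using lin idem ker by (simp add: is_nf_def)
  then show ?thesis unfolding nf_def by (rule someI[of "is_nf A"])
qed

definition Ce :: "('k::field, 'a::ab_group_add) dga \<Rightarrow> bit \<Rightarrow> ('k, 'a) chain set" where
  "Ce A p = nf A ` chain.span {Poly_Mapping.single w 1 | w. w \<in> words A \<and> wpar w = p}"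

section \<open>Operators on words\<close>

text \<open>An operator is given by its values on words, i.e. on homogeneous \<open>a\<^sub>0, \<dots>, a\<^sub>n\<close>; \<open>lin_ext\<close>
  extends it to the free vector space on words, and \<open>op_on\<close> is the induced operator on chains.\<close>

definition lin_ext :: "('w \<Rightarrow> ('v \<Rightarrow>\<^sub>0 'k)) \<Rightarrow> ('w \<Rightarrow>\<^sub>0 'k::field) \<Rightarrow> ('v \<Rightarrow>\<^sub>0 'k)" where
  "lin_ext t x = (\<Sum>w\<in>Poly_Mapping.keys x. csmult (Poly_Mapping.lookup x w) (t w))"

definition op_on :: "('k::field, 'a::ab_group_add) dga \<Rightarrow> ('a word \<Rightarrow> ('k, 'a) chain) \<Rightarrow>
    ('k, 'a) chain \<Rightarrow> ('k, 'a) chain" where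
  "op_on A t x = nf A (lin_ext t x)"

definition ldif :: "('k, 'a) dga \<Rightarrow> 'a letter \<Rightarrow> 'a letter" where
  "ldif A x = (fst x + 1, dif A (snd x))"

definition lmul :: "('k, 'a) dga \<Rightarrow> 'a letter \<Rightarrow> 'a letter \<Rightarrow> 'a letter" where
  "lmul A x y = (fst x + fst y, mul A (snd x) (snd y))"

text \<open>\<open>\<delta>\<^sup>(\<^sup>i\<^sup>)\<close>, where \<open>de = 0\<close>\<close>

definition delta :: "('k::field, 'a) dga \<Rightarrow> nat \<Rightarrow> 'a word \<Rightarrow> ('k, 'a) chain" where
  "delta A i w = (case w of (x0, xs) \<Rightarrow>
     if i = 0 then
       (case x0 of None \<Rightarrow> 0 | Some a \<Rightarrow> Poly_Mapping.single (Some (ldif A a), xs) 1)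
     else if i \<le> deg w then
       Poly_Mapping.single (x0, xs[i - 1 := ldif A (xs ! (i - 1))]) (sgn_par (\<Sum>k<i. spar w k))
     else 0)"

text \<open>\<open>\<mu>\<^sup>(\<^sup>i\<^sup>)\<close>, where \<open>ea = ae = a\<close>; the letter \<open>a\<^sub>i\<close> with \<open>i \<ge> 1\<close> is \<open>xs ! (i - 1)\<close>\<close>

definition mu :: "('k::field, 'a) dga \<Rightarrow> nat \<Rightarrow> 'a word \<Rightarrow> ('k, 'a) chain" where
  "mu A i w = (case w of (x0, xs) \<Rightarrow> let n = deg w in
     if n = 0 \<or> n < i then 0
     else if i = 0 then
       Poly_Mapping.single
         (Some (case x0 of None \<Rightarrow> hd xs | Some a \<Rightarrow> lmul A a (hd xs)), tl xs)
         (sgn_par (par0 w))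
     else if i < n then
       Poly_Mapping.single
         (x0, take (i - 1) xs @ lmul A (xs ! (i - 1)) (xs ! i) # drop (i + 1) xs)
         (sgn_par ((\<Sum>k\<le>i. spar w k) + 1))
     else
       Poly_Mapping.single
         (Some (case x0 of None \<Rightarrow> last xs | Some a \<Rightarrow> lmul A (last xs) a), butlast xs)
         (- sgn_par (spar w n * (par0 w + (\<Sum>k=1..n-1. spar w k)))))"

text \<open>\<open>\<tau>\<close> and \<open>h\<^sup>e\<close> are defined on the summand \<open>\<C>(A)\<close> and are extended by \<open>0\<close> to
  \<open>\<C>\<^sup>+(A)\<close>; hence an operator \<open>h\<^sup>e \<circ> \<dots>\<close> below is a matrix whose only nonzero entry is the lower
  left one. The image of \<open>\<mu>\<^sup>(\<^sup>0\<^sup>)\<close> and \<open>\<mu>\<^sup>(\<^sup>n\<^sup>)\<close> lies in \<open>\<C>(A)\<close>, so that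
  \<open>\<mu>\<^sup>(\<^sup>0\<^sup>) \<circ> \<delta>\<^sup>(\<^sup>1\<^sup>)\<close> and \<open>\<mu>\<^sup>(\<^sup>n\<^sup>) \<circ> \<delta>\<^sup>(\<^sup>n\<^sup>)\<close> are matrices with zero lower row.\<close>

definition tau :: "'a word \<Rightarrow> ('k::field, 'a) chain" where
  "tau w = (case w of (x0, xs) \<Rightarrow> (case x0 of None \<Rightarrow> 0 | Some a \<Rightarrow>
     (case xs @ [a] of x # ys \<Rightarrow>
       Poly_Mapping.single (Some x, ys) (sgn_par (spar w 0 * (\<Sum>k=1..deg w. spar w k))))))"

definition tau_pow :: "nat \<Rightarrow> ('k::field, 'a) chain \<Rightarrow> ('k, 'a) chain" where
  "tau_pow j = lin_ext tau ^^ j"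

definition he :: "'a word \<Rightarrow> ('k::field, 'a) chain" where
  "he w = (case w of (x0, xs) \<Rightarrow>
     (case x0 of None \<Rightarrow> 0 | Some a \<Rightarrow> Poly_Mapping.single (None, a # xs) 1))"

definition be :: "('k::field, 'a::ab_group_add) dga \<Rightarrow> ('k, 'a) chain \<Rightarrow> ('k, 'a) chain" where
  "be A = op_on A (\<lambda>w. (\<Sum>i\<le>deg w. delta A i w) + (\<Sum>i\<le>deg w. mu A i w))"

definition Be :: "('k::field, 'a::ab_group_add) dga \<Rightarrow> ('k, 'a) chain \<Rightarrow> ('k, 'a) chain" where
  "Be A = op_on A (\<lambda>w. lin_ext he (\<Sum>i\<le>deg w. tau_pow i (Poly_Mapping.single w 1)))"

definition Gamma :: "('k::field, 'a::ab_group_add) dga \<Rightarrow> ('k, 'a) chain \<Rightarrow> ('k, 'a) chain" where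
  "Gamma A = op_on A (\<lambda>w. Poly_Mapping.single w (- (of_nat (deg w) / 2)))"

definition U_op :: "('k::field, 'a::ab_group_add) dga \<Rightarrow> ('k, 'a) chain \<Rightarrow> ('k, 'a) chain" where
  "U_op A = op_on A (\<lambda>w. if deg w = 0 then 0
     else csmult (1 / 2) (- lin_ext (mu A 0) (delta A 1 w)))"

definition V_op :: "('k::field, 'a::ab_group_add) dga \<Rightarrow> ('k, 'a) chain \<Rightarrow> ('k, 'a) chain" where
  "V_op A = op_on A (\<lambda>w. csmult (1 / 2)
     (- lin_ext he (\<Sum>i=1..deg w. \<Sum>j=i+1..deg w+1. tau_pow j (delta A i w))))"

definition U_op_dual ::
    "('k::field, 'a::ab_group_add) dga \<Rightarrow> ('k, 'a) chain \<Rightarrow> ('k, 'a) chain" where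
  "U_op_dual A = op_on A (\<lambda>w. if deg w = 0 then 0
     else csmult (1 / 2) (lin_ext (mu A (deg w)) (delta A (deg w) w)))"

definition V_op_dual ::
    "('k::field, 'a::ab_group_add) dga \<Rightarrow> ('k, 'a) chain \<Rightarrow> ('k, 'a) chain" where
  "V_op_dual A = op_on A (\<lambda>w. csmult (1 / 2)
     (lin_ext he (\<Sum>i=1..deg w. \<Sum>j=1..i. tau_pow j (delta A i w))))"

section \<open>The connections\<close>

definition nabla :: "('k::field, 'a::ab_group_add) dga \<Rightarrow>
    (int \<Rightarrow> ('k, 'a) chain) \<Rightarrow> int \<Rightarrow> ('k, 'a) chain" where
  "nabla A f = (\<lambda>m. ddu csmult f m + upow (- 2) (\<lambda>j. U_op A (f j)) m
     + upow (- 1) (\<lambda>j. V_op A (f j) + Gamma A (f j)) m)"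

definition nabla_circ :: "('k::field, 'a::ab_group_add) dga \<Rightarrow>
    (int \<Rightarrow> ('k, 'a) chain) \<Rightarrow> int \<Rightarrow> ('k, 'a) chain" where
  "nabla_circ A f = (\<lambda>m. ddu csmult f m + upow (- 2) (\<lambda>j. U_op_dual A (f j)) m
     + upow (- 1) (\<lambda>j. V_op_dual A (f j) + Gamma A (f j)) m)"

text \<open>The word \<open>a\<^sub>0[a\<^sub>n|\<dots>|a\<^sub>1]\<close> over \<open>A\<close> is regarded as a word over \<open>opp A\<close>, which has the same
  underlying graded space.\<close>

definition Phi :: "('k::field, 'a::ab_group_add) dga \<Rightarrow> ('k, 'a) chain \<Rightarrow> ('k, 'a) chain" where
  "Phi A = op_on (opp A) (\<lambda>w. Poly_Mapping.single (fst w, rev (snd w))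
     (sgn_par (of_nat (deg w) + (\<Sum>j=1..deg w. \<Sum>i\<in>{1..<j}. spar w i * spar w j))))"

definition u_flip :: "(int \<Rightarrow> 'v::ab_group_add) \<Rightarrow> int \<Rightarrow> 'v" where
  "u_flip f = (\<lambda>m. if even m then f m else - f m)"

text \<open>For a family \<open>D\<close> of connections, \<open>\<A>(u)\<close> is \<open>D - d/du\<close>, and \<open>\<A>(-u)\<close> is its conjugate by
  the substitution \<open>u \<mapsto> -u\<close> on series.\<close>

definition dual_connection ::
    "(('k::field, 'a::ab_group_add) dga \<Rightarrow> (int \<Rightarrow> ('k, 'a) chain) \<Rightarrow> int \<Rightarrow> ('k, 'a) chain) \<Rightarrow>
     ('k, 'a) dga \<Rightarrow> (int \<Rightarrow> ('k, 'a) chain) \<Rightarrow> int \<Rightarrow> ('k, 'a) chain" where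
  "dual_connection D A f =
     (let \<A> = (\<lambda>g m. D (opp A) g m - ddu csmult g m)
      in (\<lambda>m. ddu csmult f m -
            inv_into (total_space (Ce A)) (Phi A) (u_flip (\<A> (u_flip (\<lambda>j. Phi A (f j)))) m)))"

end

theory Submission
  imports Defs
begin

text \<open>Both \<open>\<C>(A)\<close> and, up to \<open>h\<^sup>e\<close>, \<open>\<C>\<^sup>+(A)\<close> are the direct sum of the tensor powers of \<open>sA\<close>,
  and all the operators are built from three: \<open>d\<^sub>i\<close> differentiates the letter \<open>a\<^sub>i\<close>,
  \<open>m\<^sub>i\<close> multiplies \<open>a\<^sub>i\<close> and \<open>a\<^sub>i\<^sub>+\<^sub>1\<close>, and \<open>t = \<tau>\<^sup>-\<^sup>1\<close> moves the last letter to the front.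
  With \<open>\<mu>\<^sup>(\<^sup>n\<^sup>) = m\<^sub>0 t\<close> and \<open>b'\<close> the bar differential one has
  \<open>b\<^sup>e = ((b, 1 - t), (0, - b'))\<close>, \<open>B\<^sup>e = ((0, 0), (N, 0))\<close>,
  \<open>2 \<U> = ((- m\<^sub>0 d\<^sub>1, d\<^sub>0), (0, 0))\<close> and \<open>2 \<V> = ((0, 0), (- w, 0))\<close>, where
  \<open>w = \<Sum>\<^sub>i\<^sub>\<ge>\<^sub>1 (1 + t + \<dots> + t\<^sup>n\<^sup>-\<^sup>i) d\<^sub>i\<close>. The connection property amounts to \<open>[\<U>, b\<^sup>e] = 0\<close>,
  \<open>[\<U>, B\<^sup>e] + [\<V>, b\<^sup>e] = \<delta> / 2\<close> and \<open>[\<V>, B\<^sup>e] = 0\<close>. Entry by entry these identities follow from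
  the simplicial relations with Koszul signs between \<open>d\<^sub>i\<close>, \<open>m\<^sub>i\<close> and \<open>t\<close>. For the dual, \<open>\<Phi>\<close> exchanges
  \<open>d\<^sub>i\<close> with \<open>d\<^sub>n\<^sub>+\<^sub>1\<^sub>-\<^sub>i\<close>, \<open>\<tau>\<close> with \<open>t\<close>, and \<open>\<mu>\<^sup>(\<^sup>n\<^sup>)\<close> with the operator \<open>\<mu>\<^sup>(\<^sup>0\<^sup>)\<close> of the opposite
  algebra.\<close>

text \<open>The term \<open>Gamma\<close> accounts for the constants. Faces lower the degree by one,
  differentials keep it and B raises it by one, so [Gamma, mu] = mu / 2, [Gamma, delta] = 0 and
  [Gamma, B] = - B / 2. The first supplies the half of b / 2 that \<open>U_op\<close> and
  \<open>V_op\<close> do not produce; the last, added to the B that d/du extracts from uB, leaves B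
  / 2. The operator w solves an equation: the full differential minus d_0 N is the sum over i >= 1
  of d_i - d_0 t^(n+1-i), and d_0 t^(n+1-i) = t^(n+1-i) d_i, so each summand is 1 - t applied to a
  partial norm of d_i. The obstacle is that some relations fail on words: Leibniz, d d = 0 and the
  sign of the opposite product hold only modulo multilinearity. Hence the elementary operators are
  first shown to preserve \<open>tensor_rel\<close>, and the relations are verified on classes of
  words. Signs are kept as exponents in \<open>bit\<close>, where comparing them is arithmetic
  modulo 2.\<close>

section \<open>Linear extension and normal forms\<close>

text \<open>These rules turn sums of parities into propositional formulas, which prevents the
  normalization of signs.\<close>

declare add_bit_eq_xor [simp del] mult_bit_eq_and [simp del]

text \<open>Lets chains with different supports be summed over one common finite set.\<close>

lemma lin_ext_superset:
  assumes "finite S" "Poly_Mapping.keys x \<subseteq> S"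
  shows "lin_ext t x = (\<Sum>w\<in>S. csmult (Poly_Mapping.lookup x w) (t w))"
  unfolding lin_ext_def
  by (rule sum.mono_neutral_left[OF assms]) (auto simp: in_keys_iff)

lemma linear_lin_ext: "Vector_Spaces.linear csmult csmult (lin_ext t)"
proof -
  have add: "lin_ext t (x + y) = lin_ext t x + lin_ext t y" for x y
  proof -
    let ?S = "Poly_Mapping.keys x \<union> Poly_Mapping.keys y"
    have "lin_ext t z = (\<Sum>w\<in>?S. csmult (Poly_Mapping.lookup z w) (t w))"
      if "z \<in> {x, y, x + y}" for z
      using that keys_add[of x y] by (intro lin_ext_superset) auto
    then show ?thesis
      by (simp add: lookup_add chain.scale_left_distrib sum.distrib)
  qed
  have scale: "lin_ext t (csmult c x) = csmult c (lin_ext t x)" for c x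
  proof -
    have "lin_ext t z = (\<Sum>w\<in>Poly_Mapping.keys x. csmult (Poly_Mapping.lookup z w) (t w))"
      if "z \<in> {x, csmult c x}" for z
      using that by (intro lin_ext_superset) (auto simp: in_keys_iff)
    then show ?thesis
      by (simp add: chain.scale_sum_right)
  qed
  show ?thesis
    by (intro Vector_Spaces.linear_iff[THEN iffD2] conjI allI add scale) unfold_locales
qed

interpretation lin_ext: Vector_Spaces.linear csmult csmult "lin_ext t" for t
  by (rule linear_lin_ext)

interpretation nf: Vector_Spaces.linear csmult csmult "nf A" for A
  using is_nf_nf[of A] by (simp add: is_nf_def)

interpretation op_on: Vector_Spaces.linear csmult csmult "op_on A t" for A t
proof -
  have "op_on A t = nf A \<circ> lin_ext t" by (simp add: fun_eq_iff op_on_def)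
  then show "Vector_Spaces.linear csmult csmult (op_on A t)"
    using Vector_Spaces.linear_compose[OF lin_ext.linear_axioms nf.linear_axioms] by simp
qed

lemma lin_ext_single [simp]: "lin_ext t (Poly_Mapping.single w c) = csmult c (t w)"
  by (subst lin_ext_superset[of "{w}"]) auto

lemma csmult_single [simp]: "csmult c (Poly_Mapping.single w a) = Poly_Mapping.single w (c * a)"
  by (rule poly_mapping_eqI) (simp add: lookup_single when_def)

lemma chain_eq_sum:
  "x = (\<Sum>w\<in>Poly_Mapping.keys x. csmult (Poly_Mapping.lookup x w) (Poly_Mapping.single w 1))"
  by (rule poly_mapping_eqI) (simp add: lookup_sum lookup_single when_def in_keys_iff)

lemma lin_ext_lin_ext: "lin_ext s (lin_ext t x) = lin_ext (\<lambda>w. lin_ext s (t w)) x"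
  by (simp add: lin_ext_def[of t] lin_ext_def[of "\<lambda>w. lin_ext s (t w)"] lin_ext.sum lin_ext.scale)

lemma lin_ext_id [simp]: "lin_ext (\<lambda>w. Poly_Mapping.single w 1) x = x"
  using chain_eq_sum[of x] by (simp add: lin_ext_def)

lemma lin_ext_fun_add: "lin_ext (\<lambda>w. s w + t w) x = lin_ext s x + lin_ext t x"
  by (simp add: lin_ext_def chain.scale_right_distrib sum.distrib)

lemma lin_ext_fun_scale: "lin_ext (\<lambda>w. csmult c (t w)) x = csmult c (lin_ext t x)"
  by (simp add: lin_ext_def chain.scale_sum_right mult.commute)

lemma lin_ext_fun_0 [simp]: "lin_ext (\<lambda>w. 0) x = 0"
  by (simp add: lin_ext_def)

lemma lin_ext_fun_sum: "lin_ext (\<lambda>w. \<Sum>i\<in>I. t i w) x = (\<Sum>i\<in>I. lin_ext (t i) x)"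
  by (induction I rule: infinite_finite_induct) (simp_all add: lin_ext_fun_add)

lemma lin_ext_fun_uminus: "lin_ext (\<lambda>w. - t w) x = - lin_ext t x"
  using lin_ext_fun_scale[of "-1" t x] by simp

text \<open>Besides linearity, these two properties are all that the computations use of the chosen
  projection.\<close>

lemma nf_nf [simp]: "nf A (nf A x) = nf A x"
  and nf_eq_0_iff: "nf A x = 0 \<longleftrightarrow> x \<in> tensor_rel A"
  using is_nf_nf[of A] by (simp_all add: is_nf_def)

lemma nf_eq_iff: "nf A x = nf A y \<longleftrightarrow> x - y \<in> tensor_rel A"
  by (metis nf.diff nf_eq_0_iff right_minus_eq)

lemma subspace_tensor_rel: "chain.subspace (tensor_rel A)"
  unfolding tensor_rel_def by (rule chain.subspace_span)

section \<open>Words as lists of letters\<close>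

text \<open>The flag distinguishes \<open>\<C>(A)\<close> from \<open>\<C>\<^sup>+(A)\<close>; the empty list does not represent a word.\<close>

fun list_word :: "bool \<Rightarrow> 'a letter list \<Rightarrow> 'a word" where
  "list_word True [] = (None, [])"
| "list_word True (x # xs) = (Some x, xs)"
| "list_word False xs = (None, xs)"

definition valid :: "('k, 'a) dga \<Rightarrow> 'a letter list \<Rightarrow> bool" where
  "valid A ws \<longleftrightarrow> (\<forall>(p, a)\<in>set ws. a \<in> hom A p)"

lemma valid_simps [simp]:
  "valid A []"
  "valid A (x # xs) \<longleftrightarrow> snd x \<in> hom A (fst x) \<and> valid A xs"
  "valid A (xs @ ys) \<longleftrightarrow> valid A xs \<and> valid A ys"
  "valid A (rev xs) \<longleftrightarrow> valid A xs"
  by (auto simp: valid_def)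

text \<open>Each letter counts with its shifted parity |sa|; in \<open>bit\<close>, subtracting 1 is
  adding 1.\<close>

definition lpar :: "'a letter list \<Rightarrow> bit" where
  "lpar ws = (\<Sum>x\<leftarrow>ws. fst x + 1)"

lemma lpar_simps [simp]:
  "lpar [] = 0" "lpar (x # xs) = fst x + 1 + lpar xs" "lpar (xs @ ys) = lpar xs + lpar ys"
  "lpar (rev xs) = lpar xs"
  by (simp_all add: lpar_def rev_map[symmetric] sum_list_rev)

lemma words_eq: "words A = {list_word s ws | s ws. ws \<noteq> [] \<and> valid A ws}"
proof (intro equalityI subsetI)
  fix w assume w: "w \<in> words A"
  obtain x0 xs where "w = (x0, xs)" by (cases w)
  with w show "w \<in> {list_word s ws | s ws. ws \<noteq> [] \<and> valid A ws}"
    by (cases x0)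
      (force simp: words_def valid_def intro: exI[of _ False] exI[of _ xs],
       force simp: words_def valid_def intro: exI[of _ True] exI[of _ "the x0 # xs"])
next
  fix w assume "w \<in> {list_word s ws | s ws. ws \<noteq> [] \<and> valid A ws}"
  then obtain s ws where "w = list_word s ws" "ws \<noteq> []" "valid A ws" by blast
  then show "w \<in> words A"
    by (cases s; cases ws) (auto simp: words_def valid_def)
qed

lemma list_word_in_words [intro]: "ws \<noteq> [] \<Longrightarrow> valid A ws \<Longrightarrow> list_word s ws \<in> words A"
  unfolding words_eq by blast

lemma list_word_in_words_iff: "ws \<noteq> [] \<Longrightarrow> list_word s ws \<in> words A \<longleftrightarrow> valid A ws"
  by (cases s; cases ws) (auto simp: words_def valid_def)

text \<open>Treats a_0 and the bracketed letters alike: with \<open>s\<close> true and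
  \<open>ys\<close> empty the free letter is a_0.\<close>

lemma slots_eq: "slots = {\<lambda>x. list_word s (ys @ x # zs) | s ys zs. True}"
proof (intro equalityI subsetI)
  fix \<sigma> :: "'a letter \<Rightarrow> 'a word" assume "\<sigma> \<in> slots"
  then consider xs where "\<sigma> = (\<lambda>x. (Some x, xs))" | x0 ys zs where "\<sigma> = (\<lambda>x. (x0, ys @ x # zs))"
    by (auto simp: slots_def)
  then show "\<sigma> \<in> {\<lambda>x. list_word s (ys @ x # zs) | s ys zs. True}"
  proof cases
    case 1
    then have "\<sigma> = (\<lambda>x. list_word True ([] @ x # xs))" by simp
    then show ?thesis by blast
  next
    case 2
    show ?thesis
    proof (cases x0)
      case None
      with 2 have "\<sigma> = (\<lambda>x. list_word False (ys @ x # zs))" by simp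
      then show ?thesis by blast
    next
      case (Some y)
      with 2 have "\<sigma> = (\<lambda>x. list_word True ((y # ys) @ x # zs))" by simp
      then show ?thesis by blast
    qed
  qed
next
  fix \<sigma> :: "'a letter \<Rightarrow> 'a word" assume "\<sigma> \<in> {\<lambda>x. list_word s (ys @ x # zs) | s ys zs. True}"
  then obtain s ys zs where \<sigma>: "\<sigma> = (\<lambda>x. list_word s (ys @ x # zs))" by blast
  show "\<sigma> \<in> slots"
  proof (cases s)
    case True
    then show ?thesis by (cases ys) (auto simp: \<sigma> slots_def)
  next
    case False
    then show ?thesis by (auto simp: \<sigma> slots_def)
  qed
qed

lemma deg_list_word: "deg (list_word s ws) = (if s then length ws - 1 else length ws)"
  by (cases s; cases ws) (auto simp: deg_def)

lemma bit_simps [simp]: "(x :: bit) + (x + y) = y"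
  by (cases x; cases y) simp_all

lemma bit_double [simp]: "(x :: bit) + x = 0"
  by (cases x) simp_all

text \<open>A decision procedure for sums of signs: reordering brings equal terms together, and they
  cancel.\<close>

lemmas bit_ac = add.assoc add.commute add.left_commute bit_simps bit_double add_0_left add_0_right

lemma bit_minus [simp]: "(x :: bit) - y = x + y" "- y = (y :: bit)"
  by (cases x; cases y; simp)+

lemma par0_simps [simp]: "par0 (Some x, xs) = fst x" "par0 (None, xs) = 0"
  by (simp_all add: par0_def)

lemma sum_spar_le:
  "k \<le> length (snd w) \<Longrightarrow> (\<Sum>i=1..k. spar w i) = lpar (take k (snd w))"
proof (induction k)
  case (Suc k)
  then show ?case
    by (simp add: spar_def take_Suc_conv_app_nth)
qed simp

lemma sum_spar_less:
  assumes "0 < i" "i \<le> Suc (length (snd w))"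
  shows "(\<Sum>k<i. spar w k) = par0 w + 1 + lpar (take (i - 1) (snd w))"
proof -
  have "{..<i} = insert 0 {1..i-1}" using assms by auto
  then show ?thesis
    using sum_spar_le[of "i - 1" w] assms by (simp add: spar_def)
qed

lemma wpar_eq: "wpar w = par0 w + lpar (snd w)"
  unfolding wpar_def deg_def by (simp only: sum_spar_le[OF order_refl] take_all[OF order_refl])

text \<open>In C(A) the leading letter enters with |a_0| instead of |sa_0|, whence the 1; in C^+(A)
  the unit e is even and is not a letter of \<open>ws\<close>.\<close>

lemma wpar_list_word: "ws \<noteq> [] \<Longrightarrow> wpar (list_word s ws) = lpar ws + (if s then 1 else 0)"
  by (cases s; cases ws) (simp_all only: wpar_eq par0_simps list_word.simps snd_conv lpar_simps
      bit_ac simp_thms if_True if_False)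

lemma sgn_par_simps [simp]:
  "sgn_par 0 = 1" "sgn_par 1 = -1"
  by (simp_all add: sgn_par_def)

lemma sgn_par_add: "sgn_par (p + q) = (sgn_par p * sgn_par q :: 'k::ring_1)"
  by (cases p; cases q) simp_all

section \<open>Operators on cyclic words\<close>

text \<open>Each induction step adds a row and a column that cancel each other. No division by 2
  occurs, which is why the diagonal has a hypothesis of its own.\<close>

lemma sum_antisym_eq_0:
  fixes f :: "nat \<Rightarrow> nat \<Rightarrow> 'a::ab_group_add"
  assumes "\<And>i. i < n \<Longrightarrow> f i i = 0" "\<And>i j. i < j \<Longrightarrow> j < n \<Longrightarrow> f i j = - f j i"
  shows "(\<Sum>i<n. \<Sum>j<n. f i j) = 0"
  using assms
proof (induction n)
  case 0
  show ?case by simp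
next
  case (Suc n)
  have 1: "(\<Sum>i<n. f i n) = - (\<Sum>j<n. f n j)"
    unfolding sum_negf[symmetric] by (rule sum.cong) (auto intro: Suc.prems)
  have 2: "(\<Sum>i<n. \<Sum>j<n. f i j) = 0"
    by (rule Suc.IH) (auto intro: Suc.prems)
  have 3: "f n n = 0" by (rule Suc.prems) simp
  have "(\<Sum>i<Suc n. \<Sum>j<Suc n. f i j)
      = (\<Sum>i<n. \<Sum>j<n. f i j) + (\<Sum>i<n. f i n) + ((\<Sum>j<n. f n j) + f n n)"
    by (simp only: sum.lessThan_Suc sum.distrib ac_simps)
  also have "\<dots> = 0" unfolding 1 2 3 by simp
  finally show ?case .
qed

text \<open>The simplicial cancellation: the pair (j, i) with i \<le> j is matched with (i, j + 1),
  and row n cancels column n + 1.\<close>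

lemma sum_shift_antisym_eq_0:
  fixes f :: "nat \<Rightarrow> nat \<Rightarrow> 'a::ab_group_add"
  assumes "\<And>i j. i \<le> j \<Longrightarrow> j < n \<Longrightarrow> f j i = - f i (Suc j)"
  shows "(\<Sum>j<n. \<Sum>i<Suc n. f j i) = 0"
  using assms
proof (induction n)
  case 0
  show ?case by simp
next
  case (Suc n)
  have 1: "(\<Sum>i<Suc n. f n i) = - (\<Sum>i<Suc n. f i (Suc n))"
    unfolding sum_negf[symmetric] by (rule sum.cong) (auto intro: Suc.prems)
  have 2: "(\<Sum>j<n. \<Sum>i<Suc n. f j i) = 0"
    by (rule Suc.IH) (auto intro: Suc.prems)
  have "(\<Sum>j<Suc n. \<Sum>i<Suc (Suc n). f j i)
      = (\<Sum>j<n. \<Sum>i<Suc n. f j i) + (\<Sum>i<Suc n. f n i) + (\<Sum>i<Suc n. f i (Suc n))"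
    unfolding sum.lessThan_Suc[of _ "Suc n"] sum.distrib
    unfolding sum.lessThan_Suc[of _ n] by (simp only: ac_simps)
  also have "\<dots> = 0" unfolding 1 2 by simp
  finally show ?case .
qed

text \<open>For the Leibniz rule: slot l of the shortened word stands for the two letters l and l +
  1 of the original one.\<close>

lemma sum_split_at:
  fixes g :: "nat \<Rightarrow> 'a::ab_group_add"
  assumes "l < n"
  shows "(\<Sum>i<n. if i < l then g i else if i = l then g l + g (Suc l) else g (Suc i)) = (\<Sum>i<Suc n.
      g i)"
  using assms
proof (induction n)
  case (Suc n)
  show ?case
  proof (cases "l < n")
    case False
    then have "l = n" using Suc by simp
    then show ?thesis by (simp add: add.assoc)
  qed (use Suc in simp)
qed simp

text \<open>Here \<open>Q n\<close> stands for the \<open>n\<close>-th tensor power; the letters are numbered from \<open>0\<close>.\<close>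

locale cyclic_dg_module =
  fixes Q :: "nat \<Rightarrow> 'v::ab_group_add set" and d m :: "nat \<Rightarrow> 'v \<Rightarrow> 'v" and t :: "'v \<Rightarrow> 'v"
  assumes add_closed: "x \<in> Q n \<Longrightarrow> y \<in> Q n \<Longrightarrow> x + y \<in> Q n"
    and zero_closed: "0 \<in> Q n"
    and d_add: "d i (x + y) = d i x + d i y"
    and m_add: "m i (x + y) = m i x + m i y"
    and t_add: "t (x + y) = t x + t y"
    and d_closed: "x \<in> Q n \<Longrightarrow> i < n \<Longrightarrow> d i x \<in> Q n"
    and m_closed: "x \<in> Q (Suc n) \<Longrightarrow> i < n \<Longrightarrow> m i x \<in> Q n"
    and t_closed: "x \<in> Q n \<Longrightarrow> t x \<in> Q n"
    and d_d_same: "x \<in> Q n \<Longrightarrow> i < n \<Longrightarrow> d i (d i x) = 0"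
    and d_d: "x \<in> Q n \<Longrightarrow> i < j \<Longrightarrow> j < n \<Longrightarrow> d i (d j x) = - d j (d i x)"
    and d_m_less: "x \<in> Q (Suc n) \<Longrightarrow> i < j \<Longrightarrow> j < n \<Longrightarrow> d i (m j x) = - m j (d i x)"
    and d_m_same: "x \<in> Q (Suc n) \<Longrightarrow> i < n \<Longrightarrow> d i (m i x) = - m i (d i x + d (Suc i) x)"
    and d_m_greater: "x \<in> Q (Suc n) \<Longrightarrow> j < i \<Longrightarrow> i < n \<Longrightarrow> d i (m j x) = - m j (d (Suc i) x)"
    and m_m: "x \<in> Q (Suc (Suc n)) \<Longrightarrow> i \<le> j \<Longrightarrow> j < n \<Longrightarrow> m j (m i x) = - m i (m (Suc j) x)"
    and t_d: "x \<in> Q n \<Longrightarrow> Suc i < n \<Longrightarrow> t (d i x) = d (Suc i) (t x)"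
    and t_d_last: "x \<in> Q (Suc n) \<Longrightarrow> t (d n x) = d 0 (t x)"
    and t_m: "x \<in> Q (Suc n) \<Longrightarrow> Suc i < n \<Longrightarrow> t (m i x) = m (Suc i) (t x)"
    and t_m_last: "x \<in> Q (Suc (Suc n)) \<Longrightarrow> t (m n x) = m 0 (t (t x))"
    and t_cyclic: "x \<in> Q n \<Longrightarrow> (t ^^ n) x = x"
begin

sublocale d: additive "d i" for i by standard (rule d_add)
sublocale m: additive "m i" for i by standard (rule m_add)
sublocale t: additive t by standard (rule t_add)

lemma tp_add: "(t ^^ k) (x + y) = (t ^^ k) x + (t ^^ k) y"
  by (induction k) (simp_all add: t_add)

sublocale tp: additive "t ^^ k" for k by standard (rule tp_add)

lemma tp_closed: "x \<in> Q n \<Longrightarrow> (t ^^ k) x \<in> Q n"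
  by (induction k) (simp_all add: t_closed)

text \<open>The parameter \<open>n\<close> of all operators except \<open>N\<close> is the number of letters minus one.\<close>

definition mu_cyc :: "nat \<Rightarrow> nat \<Rightarrow> 'v \<Rightarrow> 'v" where
  "mu_cyc n l x = (if l < n then m l x else m 0 (t x))"

definition D :: "nat \<Rightarrow> 'v \<Rightarrow> 'v" where
  "D n x = (\<Sum>i<Suc n. d i x)"

definition M' :: "nat \<Rightarrow> 'v \<Rightarrow> 'v" where
  "M' n x = (\<Sum>l<n. m l x)"

text \<open>For n = 0 the wrap-around face in \<open>mu_cyc\<close> would act on a single letter,
  where nothing can be multiplied; the Hochschild face is 0 there.\<close>

definition M :: "nat \<Rightarrow> 'v \<Rightarrow> 'v" where
  "M n x = (if n = 0 then 0 else \<Sum>l<Suc n. mu_cyc n l x)"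

definition N :: "nat \<Rightarrow> 'v \<Rightarrow> 'v" where
  "N r x = (\<Sum>k<r. (t ^^ k) x)"

definition w :: "nat \<Rightarrow> 'v \<Rightarrow> 'v" where
  "w n x = (\<Sum>i=1..n. N (Suc n - i) (d i x))"

sublocale mu: additive "mu_cyc n l" for n l
  by standard (simp add: mu_cyc_def m_add t_add)
sublocale D: additive "D n" for n by standard (simp add: D_def d_add sum.distrib del:
    sum.lessThan_Suc)
sublocale M': additive "M' n" for n by standard (simp add: M'_def m_add sum.distrib)
sublocale M: additive "M n" for n by standard (simp add: M_def mu.add sum.distrib del:
    sum.lessThan_Suc)
sublocale N: additive "N n" for n by standard (simp add: N_def tp_add sum.distrib)
sublocale w: additive "w n" for n by standard (simp add: w_def d_add N.add sum.distrib)

lemma sum_closed: "(\<And>i. i \<in> I \<Longrightarrow> f i \<in> Q n) \<Longrightarrow> (\<Sum>i\<in>I. f i) \<in> Q n"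
  by (induction I rule: infinite_finite_induct) (auto intro: add_closed zero_closed)

lemma mu_closed: "x \<in> Q (Suc n) \<Longrightarrow> 0 < n \<Longrightarrow> mu_cyc n l x \<in> Q n"
  by (auto simp: mu_cyc_def intro: m_closed t_closed)
lemma D_closed: "x \<in> Q (Suc n) \<Longrightarrow> D n x \<in> Q (Suc n)"
  unfolding D_def by (rule sum_closed) (auto intro: d_closed)
lemma M'_closed: "x \<in> Q (Suc n) \<Longrightarrow> M' n x \<in> Q n"
  unfolding M'_def by (rule sum_closed) (auto intro: m_closed)
lemma M_closed: "x \<in> Q (Suc n) \<Longrightarrow> M n x \<in> Q n"
  unfolding M_def by (auto intro!: sum_closed zero_closed mu_closed simp del: sum.lessThan_Suc)
lemma N_closed: "x \<in> Q n \<Longrightarrow> N r x \<in> Q n"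
  unfolding N_def by (rule sum_closed) (auto intro: tp_closed)
lemma w_closed: "x \<in> Q (Suc n) \<Longrightarrow> w n x \<in> Q (Suc n)"
  unfolding w_def by (rule sum_closed) (auto intro!: N_closed d_closed)

lemma M'_0 [simp]: "M' 0 x = 0" by (simp add: M'_def)
lemma M_0 [simp]: "M 0 x = 0" by (simp add: M_def)
lemma M_eq: "0 < n \<Longrightarrow> M n x = M' n x + m 0 (t x)"
  by (simp add: M_def M'_def mu_cyc_def)

section \<open>The total differential against faces and rotations\<close>

lemma d_anticomm:
  "x \<in> Q n \<Longrightarrow> i < n \<Longrightarrow> j < n \<Longrightarrow> d i (d j x) = - d j (d i x)"
  by (metis d_d d_d_same linorder_neqE_nat add.inverse_inverse neg_equal_zero minus_zero)

lemma D_d: "x \<in> Q (Suc n) \<Longrightarrow> i < Suc n \<Longrightarrow> D n (d i x) = - d i (D n x)"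
  unfolding D_def d.sum sum_negf[symmetric]
  by (rule sum.cong[OF refl]) (use d_anticomm in blast)

lemma D_D: "x \<in> Q (Suc n) \<Longrightarrow> D n (D n x) = 0"
  unfolding D_def d.sum by (rule sum_antisym_eq_0) (auto intro: d_d d_d_same)

lemma D_m:
  assumes x: "x \<in> Q (Suc (Suc n))" and l: "l < Suc n"
  shows "D n (m l x) = - m l (D (Suc n) x)"
proof -
  have "D n (m l x) = - (\<Sum>i<Suc n. if i < l then m l (d i x)
      else if i = l then m l (d l x) + m l (d (Suc l) x) else m l (d (Suc i) x))"
    unfolding D_def sum_negf[symmetric]
  proof (rule sum.cong[OF refl])
    fix i assume "i \<in> {..<Suc n}"
    then show "d i (m l x) = - (if i < l then m l (d i x)
        else if i = l then m l (d l x) + m l (d (Suc l) x) else m l (d (Suc i) x))"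
      using d_m_less[OF x, of i l] d_m_same[OF x, of i] d_m_greater[OF x, of l i] l
      by (auto simp: m_add)
  qed
  also have "\<dots> = - m l (D (Suc n) x)"
    unfolding sum_split_at[OF l, of "\<lambda>i. m l (d i x)"] D_def m.sum ..
  finally show ?thesis .
qed

text \<open>At n = 0 there are no faces and both sides vanish, so the truncated \<open>n - 1\<close>
  does no harm; the same convention recurs below.\<close>

lemma D_M': "x \<in> Q (Suc n) \<Longrightarrow> D (n - 1) (M' n x) = - M' n (D n x)"
  by (cases n) (simp_all add: M'_def D.zero D.sum D_m sum_negf del: sum.lessThan_Suc)

lemma D_t: "x \<in> Q (Suc n) \<Longrightarrow> D n (t x) = t (D n x)"
proof -
  assume x: "x \<in> Q (Suc n)"
  have "t (D n x) = (\<Sum>i<n. t (d i x)) + t (d n x)"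
    by (simp add: D_def t_add t.sum)
  also have "(\<Sum>i<n. t (d i x)) = (\<Sum>i<n. d (Suc i) (t x))"
    by (rule sum.cong) (auto simp: t_d[OF x])
  also have "\<dots> + t (d n x) = D n (t x)"
    unfolding D_def sum.lessThan_Suc_shift by (simp add: t_d_last[OF x])
  finally show ?thesis ..
qed

lemma D_tp: "x \<in> Q (Suc n) \<Longrightarrow> D n ((t ^^ k) x) = (t ^^ k) (D n x)"
  by (induction k) (simp_all add: D_t tp_closed)

lemma N_Suc: "N (Suc r) x = N r x + (t ^^ r) x"
  by (simp add: N_def)

lemma D_N: "x \<in> Q (Suc n) \<Longrightarrow> D n (N r x) = N r (D n x)"
  by (simp add: N_def D.sum D_tp)

lemma D_M:
  assumes x: "x \<in> Q (Suc n)"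
  shows "D (n - 1) (M n x) = - M n (D n x)"
proof (cases n)
  case (Suc k)
  then have x': "x \<in> Q (Suc (Suc k))" using x by simp
  show ?thesis using D_M'[OF x] D_m[OF t_closed[OF x'], of 0] D_t[OF x']
    by (simp add: Suc M_eq D.add)
qed (simp add: D.zero)

section \<open>The squares of the face operators, and their relation to 1 - t\<close>

lemma M'_M': "x \<in> Q (Suc n) \<Longrightarrow> M' (n - 1) (M' n x) = 0"
proof (cases n)
  case (Suc k)
  assume x: "x \<in> Q (Suc n)"
  show ?thesis unfolding Suc M'_def diff_Suc_1 m.sum
    by (rule sum_shift_antisym_eq_0) (use m_m[of x k] x Suc in auto)
qed (simp add: M'.zero)

text \<open>Associativity around the seam: a_n (a_0 a_1) = (a_n a_0) a_1.\<close>

lemma m0_t_m0: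
  assumes x: "x \<in> Q (Suc (Suc (Suc n)))"
  shows "m 0 (t (m 0 x)) = - m 0 (m 0 (t x))"
proof (cases n)
  case 0
  then show ?thesis using t_m[of x "Suc (Suc n)" 0] x m_m[OF t_closed[OF x], of 0 0] by simp
next
  case (Suc k)
  then show ?thesis using t_m[of x "Suc (Suc n)" 0] x m_m[OF t_closed[OF x], of 0 0] by simp
qed

text \<open>Once a_0 a_1 has been formed, every further face comes from a face of \<open>x\<close>
  other than m_0 itself: the inner ones by \<open>m_m\<close>, the last one by
  \<open>m0_t_m0\<close>.\<close>

lemma M_m0:
  assumes x: "x \<in> Q (Suc (Suc n))" and n: "0 < n"
  shows "M n (m 0 x) = - m 0 (M (Suc n) x - m 0 x)"
proof -
  have 1: "M' n (m 0 x) = - (\<Sum>l<n. m 0 (m (Suc l) x))"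
    unfolding M'_def sum_negf[symmetric] by (rule sum.cong) (auto simp: m_m[OF x])
  have 2: "M (Suc n) x - m 0 x = (\<Sum>l<n. m (Suc l) x) + m 0 (t x)"
    by (simp add: M_eq M'_def sum.lessThan_Suc_shift del: sum.lessThan_Suc)
  obtain k where "n = Suc k" using n gr0_implies_Suc by blast
  then have 3: "m 0 (t (m 0 x)) = - m 0 (m 0 (t x))" using m0_t_m0[of x k] x by simp
  show ?thesis unfolding 2 M_eq[OF n] 1 3 m_add m.sum by simp
qed

lemma mu_t_0: "0 < n \<Longrightarrow> mu_cyc n 0 (t x) = mu_cyc n n x"
  by (simp add: mu_cyc_def)

text \<open>The rotation shifts the cyclic faces by one; for l = n - 1 an inner face turns into the
  wrap-around face, by \<open>t_m_last\<close>.\<close>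

lemma mu_t_Suc:
  assumes "x \<in> Q (Suc n)" "l < n"
  shows "mu_cyc n (Suc l) (t x) = t (mu_cyc n l x)"
proof (cases "Suc l < n")
  case True
  then show ?thesis using t_m[OF assms(1)] by (simp add: mu_cyc_def)
next
  case False
  then have "n = Suc l" using assms by simp
  then show ?thesis using t_m_last[of x l] assms by (simp add: mu_cyc_def)
qed

lemma M'_t:
  assumes x: "x \<in> Q (Suc n)" "0 < n"
  shows "M' n (t x) = m 0 (t x) + (\<Sum>l<n - 1. t (m l x))"
proof -
  obtain k where k: "n = Suc k" using assms by (cases n) auto
  have "(\<Sum>l<k. m (Suc l) (t x)) = (\<Sum>l<k. t (m l x))"
    by (rule sum.cong) (use t_m[of x n] k x in auto)
  then show ?thesis unfolding k M'_def sum.lessThan_Suc_shift by simp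
qed

text \<open>The multiplicative half of b (1 - t) = (1 - t) b', solved for the rotated term.\<close>

lemma M_t:
  assumes x: "x \<in> Q (Suc n)"
  shows "M n (t x) = M n x - M' n x + t (M' n x)"
proof (cases n)
  case (Suc k)
  then show ?thesis using x M'_t[OF x] t_m_last[of x k]
    by (simp add: M_eq, simp add: M'_def t_add t.sum)
qed (simp add: t.zero)

text \<open>With the wrap-around face split off from \<open>M n x\<close>, the two parts are sent to
  m_0 (t (M' n x)) with opposite signs.\<close>

lemma M_M: "x \<in> Q (Suc n) \<Longrightarrow> M (n - 1) (M n x) = 0"
proof (cases "n \<le> 1")
  case True
  then show ?thesis by (cases n) (auto simp: M.zero)
next
  case False
  then obtain k where n: "n = Suc (Suc k)" by (metis One_nat_def Suc_le_mono not0_implies_Suc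
      zero_le not_less_eq_eq)
  assume x: "x \<in> Q (Suc n)"
  let ?x' = "M' n x" and ?y = "m 0 (t x)"
  have tx: "t x \<in> Q (Suc (Suc (Suc k)))" using x n by (simp add: t_closed)
  have "M (n - 1) ?y = - m 0 (M n (t x) - m 0 (t x))"
    using M_m0[OF tx] n by simp
  also have "M n (t x) = m 0 (t x) + t ?x'"
    using M_t[OF x] n by (simp add: M_eq)
  finally have 1: "M (n - 1) ?y = - m 0 (t ?x')" by simp
  have 2: "M (n - 1) ?x' = m 0 (t ?x')"
    using M'_M'[OF x] n by (simp add: M_eq)
  have "M n x = ?x' + ?y" using n by (simp add: M_eq)
  then show ?thesis using 1 2 by (simp add: M.add)
qed

section \<open>Faces of norms and of partial norms\<close>

lemma t_N: "x \<in> Q n \<Longrightarrow> t (N n x) = N n x"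
proof (cases n)
  case (Suc k)
  assume x: "x \<in> Q n"
  have "t (N n x) = (\<Sum>i<k. (t ^^ Suc i) x) + (t ^^ Suc k) x"
    by (simp add: N_def Suc t.sum t_add)
  also have "\<dots> = N n x"
    using t_cyclic[OF x] unfolding N_def Suc sum.lessThan_Suc_shift by simp
  finally show ?thesis .
qed (simp add: N_def t.zero)

lemma N_t_commute: "N r (t x) = t (N r x)"
  by (simp add: N_def t.sum funpow_swap1)

lemma N_t: "x \<in> Q n \<Longrightarrow> N n (t x) = N n x"
  by (simp add: N_t_commute t_N)

text \<open>After s rotations the word reads a_{n-s+1}, ..., a_n, a_0, ..., a_{n-s}. Its inner faces
  are all cyclic faces of \<open>x\<close> except number n - s, whose factors are now at the two
  ends. A product formed among the letters moved to the front, or across the seam, leaves one letter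
  fewer to rotate: hence the exponent s - 1.\<close>

lemma M'_tp:
  assumes "x \<in> Q (Suc n)" "s \<le> n"
  shows "M' n ((t ^^ s) x) = (\<Sum>l<n - s. (t ^^ s) (mu_cyc n l x))
    + (\<Sum>l=Suc n - s..n. (t ^^ (s - 1)) (mu_cyc n l x))"
  using assms
proof (induction s arbitrary: x)
  case 0
  then show ?case by (simp add: M'_def mu_cyc_def)
next
  case (Suc s)
  let ?\<mu> = "mu_cyc n"
  have tx: "t x \<in> Q (Suc n)" using Suc by (simp add: t_closed)
  have n: "0 < n" "n - s = Suc (n - Suc s)" using Suc by auto
  have "M' n ((t ^^ Suc s) x) = (\<Sum>l<n - s. (t ^^ s) (?\<mu> l (t x)))
      + (\<Sum>l=Suc n - s..n. (t ^^ (s - 1)) (?\<mu> l (t x)))"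
    using Suc.IH[OF tx] Suc.prems by (simp add: funpow_swap1)
  also have "(\<Sum>l<n - s. (t ^^ s) (?\<mu> l (t x)))
      = (t ^^ s) (?\<mu> n x) + (\<Sum>l<n - Suc s. (t ^^ Suc s) (?\<mu> l x))"
    unfolding n(2) sum.lessThan_Suc_shift mu_t_0[OF n(1)]
    by (intro arg_cong2[where f = "(+)"] refl sum.cong)
      (use mu_t_Suc[OF Suc.prems(1)] Suc.prems(2) in \<open>auto simp: funpow_swap1\<close>)
  \<comment> \<open>Face l of the rotated word is the rotated face l - 1; for s = 0 both ranges are
    empty.\<close>
  also have "(\<Sum>l=Suc n - s..n. (t ^^ (s - 1)) (?\<mu> l (t x))) = (\<Sum>l=n - s..<n. (t ^^ s) (?\<mu> l x))"
  proof (cases s)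
    case (Suc s')
    have "(\<Sum>l=Suc n - s..n. (t ^^ (s - 1)) (?\<mu> l (t x)))
        = (\<Sum>l=Suc (n - s)..<Suc n. (t ^^ s') (?\<mu> l (t x)))"
      using n Suc \<open>Suc s \<le> n\<close> by (intro sum.cong) (auto simp: Suc_diff_le)
    also have "\<dots> = (\<Sum>l=n - s..<n. (t ^^ s') (?\<mu> (Suc l) (t x)))"
      by (rule sum.shift_bounds_Suc_ivl)
    also have "\<dots> = (\<Sum>l=n - s..<n. (t ^^ s) (?\<mu> l x))"
      by (rule sum.cong) (use mu_t_Suc[OF Suc.prems(1)] Suc in \<open>auto simp: funpow_swap1\<close>)
    finally show ?thesis .
  qed simp
  also have "(t ^^ s) (?\<mu> n x) + (\<Sum>l<n - Suc s. (t ^^ Suc s) (?\<mu> l x))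
      + (\<Sum>l=n - s..<n. (t ^^ s) (?\<mu> l x))
    = (\<Sum>l<n - Suc s. (t ^^ Suc s) (?\<mu> l x)) + (\<Sum>l=n - s..<Suc n. (t ^^ s) (?\<mu> l x))"
    unfolding sum.atLeastLessThan_Suc[OF diff_le_self] by (simp only: ac_simps)
  finally show ?case by (simp add: atLeastLessThanSuc_atLeastAtMost)
qed

text \<open>The case \<open>r = n\<close> is the multiplicative part of \<open>b' N = N b\<close>; the other cases compute
  \<open>b' w\<close>.\<close>

lemma M'_N:
  assumes x: "x \<in> Q (Suc n)" and r: "r \<le> n"
  shows "M' n (N (Suc r) x) = N (Suc r) (\<Sum>l<n - r. mu_cyc n l x) + N r (\<Sum>l=n - r..n. mu_cyc n l x)"
  using r
proof (induction r)
  case 0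
  then show ?case by (simp add: N_def M'_def mu_cyc_def)
next
  case (Suc r)
  let ?S = "\<lambda>r. \<Sum>l<n - r. mu_cyc n l x" and ?T = "\<lambda>r. \<Sum>l=n - r..n. mu_cyc n l x"
  have "M' n (N (Suc (Suc r)) x) = M' n (N (Suc r) x) + M' n ((t ^^ Suc r) x)"
    by (simp add: N_def M'.add)
  also have "M' n ((t ^^ Suc r) x) = (t ^^ Suc r) (?S (Suc r)) + (t ^^ r) (?T r)"
    using M'_tp[OF x Suc.prems] by (simp add: tp.sum t.sum)
  also have "M' n (N (Suc r) x) = N (Suc r) (?S r) + N r (?T r)"
    using Suc by simp
  also have "N (Suc r) (?S r) + N r (?T r) + ((t ^^ Suc r) (?S (Suc r)) + (t ^^ r) (?T r))
    = N (Suc r) (?S r + ?T r) + (t ^^ Suc r) (?S (Suc r))"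
    unfolding N_Suc[of r] N.add tp_add by (simp only: ac_simps)
  \<comment> \<open>The face with index n - r - 1 passes from the first sum to the second.\<close>
  also have "?S r + ?T r = ?S (Suc r) + ?T (Suc r)"
  proof -
    have "n - r = Suc (n - Suc r)" using Suc.prems by simp
    then show ?thesis by (simp add: sum.atLeast_Suc_atMost[of "n - Suc r" n] add.assoc)
  qed
  also have "N (Suc r) (?S (Suc r) + ?T (Suc r)) + (t ^^ Suc r) (?S (Suc r))
    = N (Suc (Suc r)) (?S (Suc r)) + N (Suc r) (?T (Suc r))"
    unfolding N_Suc[of "Suc r"] N.add by (simp only: ac_simps)
  finally show ?case .
qed

lemma M'_N_eq_N_M:
  assumes x: "x \<in> Q (Suc n)"
  shows "M' n (N (Suc n) x) = N n (M n x)"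
proof (cases n)
  case (Suc k)
  then show ?thesis using M'_N[OF x order_refl]
    by (simp add: M_def N.zero atMost_atLeast0[symmetric] lessThan_Suc_atMost del: sum.lessThan_Suc)
qed (simp add: N.zero)

section \<open>Identities for the operator w\<close>

lemma d_w:
  assumes x: "x \<in> Q (Suc n)"
  shows "D n (w n x) = - w n (D n x)"
  unfolding w_def D.sum sum_negf[symmetric]
proof (rule sum.cong[OF refl])
  fix i assume "i \<in> {1..n}"
  then have "i < Suc n" by simp
  then show "D n (N (Suc n - i) (d i x)) = - N (Suc n - i) (d i (D n x))"
    using x by (simp add: D_N d_closed D_d N.minus)
qed

lemma t_power_d:
  "x \<in> Q (Suc n) \<Longrightarrow> i + k \<le> n \<Longrightarrow> (t ^^ k) (d i x) = d (i + k) ((t ^^ k) x)"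
  by (induction k) (simp_all add: t_d[of _ "Suc n"] tp_closed)

text \<open>The first n - i rotations bring letter i to the last place, and one more brings it to
  the front.\<close>

lemma t_power_d_wrap:
  assumes "x \<in> Q (Suc n)" "i \<le> n"
  shows "(t ^^ (Suc n - i)) (d i x) = d 0 ((t ^^ (Suc n - i)) x)"
  using t_power_d[of x n i "n - i"] t_d_last[OF tp_closed[OF assms(1)]] assms
  by (simp add: Suc_diff_le)

lemma N_telescope: "N r x - t (N r x) = x - (t ^^ r) x"
proof (induction r)
  case (Suc r)
  have "N (Suc r) x - t (N (Suc r) x) = (N r x - t (N r x)) + ((t ^^ r) x - t ((t ^^ r) x))"
    by (simp add: N_def t_add)
  then show ?case unfolding Suc by simp
qed (simp add: N_def t.zero)

text \<open>By \<open>N_telescope\<close>, 1 - t turns the partial norm of d_i into d_i - t^(n+1-i)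
  d_i. By \<open>t_power_d_wrap\<close> the subtracted terms are those of d_0 N without its first
  one, d_0.\<close>

lemma d0_N:
  assumes x: "x \<in> Q (Suc n)"
  shows "d 0 (N (Suc n) x) + (w n x - t (w n x)) = D n x"
proof -
  have "w n x - t (w n x) = (\<Sum>i=1..n. N (Suc n - i) (d i x) - t (N (Suc n - i) (d i x)))"
    by (simp add: w_def t.sum sum_subtractf)
  also have "\<dots> = (\<Sum>i=1..n. d i x) - (\<Sum>i=1..n. d 0 ((t ^^ (Suc n - i)) x))"
    unfolding N_telescope sum_subtractf
    by (intro arg_cong2[where f = "(-)"] sum.cong refl t_power_d_wrap[OF x]) simp
  also have "(\<Sum>i=1..n. d 0 ((t ^^ (Suc n - i)) x)) = (\<Sum>i=1..n. d 0 ((t ^^ i) x))"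
    by (rule sum.reindex_bij_witness[where i = "\<lambda>i. Suc n - i" and j = "\<lambda>i. Suc n - i"]) auto
  also have "\<dots> = d 0 (N (Suc n) x) - d 0 x"
    by (simp add: N_def d.sum[symmetric] d.add atLeast1_atMost_eq_remove0 lessThan_Suc_atMost
        sum_diff1
      d.diff)
  also have "(\<Sum>i=1..n. d i x) = D n x - d 0 x"
    by (simp add: D_def atLeast1_atMost_eq_remove0 lessThan_Suc_atMost sum_diff1)
  finally show ?thesis by simp
qed

text \<open>Since d_{k+1} t = t d_k, the summand i = k + 1 of w t is N_{n-k} t d_k = N_{n+1-k} d_k -
  d_k. So w t repeats the sum for w with a new summand at i = 0, namely N d_0, and with the
  differential subtracted.\<close>

lemma w_t:
  assumes x: "x \<in> Q (Suc n)"
  shows "w n (x - t x) = D n x - N (Suc n) (d 0 x)"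
proof -
  have "N (Suc n - i) (d i (t x)) = N (Suc n - (i - 1)) (d (i - 1) x) - d (i - 1) x"
    if i: "i \<in> {1..n}" for i
  proof -
    obtain k where k: "i = Suc k" using i by (cases i) auto
    have "d i (t x) = t (d k x)" using t_d[OF x, of k] i k by simp
    moreover have "N (Suc n - k) y = N (n - k) (t y) + y" for y
    proof -
      have "Suc n - k = Suc (n - k)" using i k by simp
      then show ?thesis
        unfolding N_def by (simp only: sum.lessThan_Suc_shift) (simp add: funpow_swap1)
    qed
    ultimately show ?thesis using k by simp
  qed
  then have "w n (t x) = (\<Sum>i=1..n. N (Suc n - (i - 1)) (d (i - 1) x) - d (i - 1) x)"
    unfolding w_def by (rule sum.cong[OF refl])
  also have "\<dots> = (\<Sum>i<n. N (Suc n - i) (d i x) - d i x)"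
    by (rule sum.reindex_bij_witness[where i = Suc and j = "\<lambda>i. i - 1"]) auto
  \<comment> \<open>The summand i = n may be added because the partial norm of length 1 is the
    identity.\<close>
  also have "\<dots> = (\<Sum>i<Suc n. N (Suc n - i) (d i x)) - D n x"
    by (simp add: D_def sum_subtractf N_def)
  also have "(\<Sum>i<Suc n. N (Suc n - i) (d i x)) = N (Suc n) (d 0 x) + w n x"
  proof -
    have "w n x = (\<Sum>i<n. N (Suc n - Suc i) (d (Suc i) x))"
      unfolding w_def
      by (rule sum.reindex_bij_witness[where i = Suc and j = "\<lambda>i. i - 1"]) auto
    then show ?thesis unfolding sum.lessThan_Suc_shift by simp
  qed
  finally show ?thesis by (simp add: w.diff)
qed

text \<open>For 0 < i the wrap-around product sits in slot 0, away from the differentiated letter,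
  so the last face obeys the rule for l > i. At l = i both summands occur, by Leibniz.\<close>

lemma d_mu:
  assumes x: "x \<in> Q (Suc n)" and i: "0 < i" "i < n" and l: "l \<le> n"
  shows "d i (mu_cyc n l x) = - mu_cyc n l
    ((if l \<le> i then d (Suc i) x else 0) + (if i \<le> l then d i x else 0))"
proof (cases "l < n")
  case True
  then show ?thesis
    using d_m_less[OF x, of i l] d_m_same[OF x, of i] d_m_greater[OF x, of l i] i
    by (cases i l rule: linorder_cases) (simp_all add: mu_cyc_def add.commute)
next
  case False
  then show ?thesis
    using d_m_greater[OF t_closed[OF x], of 0 i] t_d[OF x, of i] i l by (simp add: mu_cyc_def)
qed

lemma d_M:
  assumes x: "x \<in> Q (Suc n)" and i: "0 < i" "i < n"
  shows "d i (M n x) =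
    - (\<Sum>l<Suc i. mu_cyc n l (d (Suc i) x)) - (\<Sum>l=i..n. mu_cyc n l (d i x))"
proof -
  have "d i (M n x) = (\<Sum>l\<in>{..n}. - ((if l < Suc i then mu_cyc n l (d (Suc i) x) else 0)
      + (if i \<le> l then mu_cyc n l (d i x) else 0)))"
    unfolding M_def d.sum lessThan_Suc_atMost using i
    by (auto intro!: sum.cong simp: d_mu[OF x] d.sum mu.add mu.zero simp del: sum.atMost_Suc)
  also have "\<dots> = - (\<Sum>l\<in>{l\<in>{..n}. l < Suc i}. mu_cyc n l (d (Suc i) x))
      - (\<Sum>l\<in>{l\<in>{..n}. i \<le> l}. mu_cyc n l (d i x))"
    unfolding sum_negf sum.distrib sum.inter_filter[OF finite_atMost] by simp
  also have "{l\<in>{..n}. l < Suc i} = {..<Suc i}" using i by auto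
  also have "{l\<in>{..n}. i \<le> l} = {i..n}" by auto
  finally show ?thesis .
qed

text \<open>Computing w M by \<open>d_M\<close> and M' w by \<open>M'_N\<close> yields the same
  terms with opposite signs, with the index of one family shifted by one; only the boundary term for
  i = 1 survives.\<close>

lemma w_M:
  assumes x: "x \<in> Q (Suc n)"
  shows "w (n - 1) (M n x) + M' n (w n x) = N n (m 0 (d 1 x))"
proof (cases n)
  case 0
  then show ?thesis by (simp add: w_def N_def M'.zero)
next
  case (Suc k)
  \<comment> \<open>\<open>f\<close> collects the faces before the differentiated letter and
    \<open>g\<close> those from it on, each with the length of partial norm that \<open>M'_N\<close>
    assigns. At i = n the norm in \<open>g\<close> is empty.\<close>
  define f where "f i = N (Suc n - i) (\<Sum>l<i. mu_cyc n l (d i x))" for i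
  define g where "g i = N (n - i) (\<Sum>l=i..n. mu_cyc n l (d i x))" for i
  have "w (n - 1) (M n x) = (\<Sum>i=1..k. N (n - i) (d i (M n x)))"
    by (simp add: w_def Suc)
  also have "\<dots> = (\<Sum>i=1..k. - f (Suc i) - g i)"
  proof (rule sum.cong[OF refl])
    fix i assume "i \<in> {1..k}"
    then have i: "0 < i" "i < n" using Suc by auto
    show "N (n - i) (d i (M n x)) = - f (Suc i) - g i"
      unfolding d_M[OF x i] f_def g_def N.diff N.minus by simp
  qed
  also have "\<dots> = - (\<Sum>i=1..k. f (Suc i)) - (\<Sum>i=1..k. g i)"
    by (simp add: sum_subtractf sum_negf)
  finally have 1: "w (n - 1) (M n x) = \<dots>" .
  have "M' n (w n x) = (\<Sum>i=1..n. f i + g i)"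
    unfolding w_def M'.sum
  proof (rule sum.cong[OF refl])
    fix i assume i: "i \<in> {1..n}"
    have "n - (n - i) = i" "Suc n - i = Suc (n - i)" using i by auto
    then show "M' n (N (Suc n - i) (d i x)) = f i + g i"
      using M'_N[OF d_closed[OF x], of i "n - i"] i by (simp add: f_def g_def)
  qed
  also have "\<dots> = f 1 + (\<Sum>i=1..k. f (Suc i)) + (\<Sum>i=1..k. g i)"
  proof -
    have "g n = 0" by (simp add: g_def N_def)
    moreover have "(\<Sum>i=1..n. f i) = f 1 + (\<Sum>i=1..k. f (Suc i))"
      unfolding Suc using sum.atLeast_Suc_atMost[of 1 "Suc k" f]
      by (simp only: sum.shift_bounds_cl_Suc_ivl)
    ultimately show ?thesis by (simp add: sum.distrib Suc add.assoc)
  qed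
  finally show ?thesis using 1 by (simp add: f_def mu_cyc_def Suc)
qed

section \<open>Identities for m_0 d_1 and d_0, needed for [U, b] = 0\<close>

lemma m0_d1_D:
  assumes x: "x \<in> Q (Suc (Suc n))"
  shows "m 0 (d 1 (D (Suc n) x)) = D n (m 0 (d 1 x))"
  using D_m[OF d_closed[OF x], of 1 0] D_d[OF x, of 1] by (simp add: m.minus)

text \<open>In m_0 (d_1 M) the terms with d_2 are the two bracketings of a_0 a_1 (d a_2) and cancel
  by associativity; the terms with d_1 are \<open>M_m0\<close>.\<close>

lemma m0_d1_M:
  assumes x: "x \<in> Q (Suc (Suc n))" and n: "0 < n"
  shows "m 0 (d 1 (M (Suc n) x)) = M n (m 0 (d 1 x))"
proof -
  obtain k where k: "n = Suc k" using n gr0_implies_Suc by blast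
  let ?\<mu> = "mu_cyc (Suc n)"
  have "d 1 (M (Suc n) x) = - (m 0 (d 2 x) + ?\<mu> 1 (d 2 x)) - (M (Suc n) (d 1 x) - m 0 (d 1 x))"
    using d_M[OF x, of 1] n
    by (simp add: M_def mu_cyc_def[of "Suc n" 0] numeral_2_eq_2 atLeast0AtMost[symmetric]
        lessThan_Suc_atMost sum.atLeast_Suc_atMost[of 0] del: sum.lessThan_Suc)
  moreover have "m 0 (m 0 (d 2 x)) = - m 0 (?\<mu> 1 (d 2 x))"
    using m_m[OF d_closed[OF x], of 2 0 0] n k by (simp add: mu_cyc_def)
  moreover have "M n (m 0 (d 1 x)) = - m 0 (M (Suc n) (d 1 x) - m 0 (d 1 x))"
    by (rule M_m0[OF d_closed[OF x] n]) simp
  ultimately show ?thesis by (simp add: m_add m.diff m.minus)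
qed

text \<open>Two surplus terms remain: Leibniz for d_0 m_0 gives m_0 d_1 x, and the wrap-around face
  of d_0 x gives m_0 d_1 t x because t d_0 = d_1 t.\<close>

lemma d0_M':
  assumes x: "x \<in> Q (Suc n)" and n: "0 < n"
  shows "d 0 (M' n x) + M n (d 0 x) + m 0 (d 1 (x - t x)) = 0"
proof -
  obtain k where k: "n = Suc k" using n gr0_implies_Suc by blast
  have "d 0 (M' n x) = d 0 (m 0 x) + (\<Sum>l<k. d 0 (m (Suc l) x))"
    unfolding M'_def k by (simp only: sum.lessThan_Suc_shift d_add d.sum)
  also have "(\<Sum>l<k. d 0 (m (Suc l) x)) = - (\<Sum>l<k. m (Suc l) (d 0 x))"
    unfolding sum_negf[symmetric] by (rule sum.cong) (auto simp: d_m_less[OF x] k)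
  also have "d 0 (m 0 x) = - m 0 (d 0 x) - m 0 (d 1 x)"
    using d_m_same[OF x, of 0] n by (simp add: m_add)
  finally have "d 0 (M' n x) = - M' n (d 0 x) - m 0 (d 1 x)"
    unfolding M'_def k sum.lessThan_Suc_shift by simp
  then show ?thesis
    using t_d[OF x, of 0] n by (simp add: M_eq m.diff d.diff)
qed

end

section \<open>The elementary operators on lists\<close>

lemma bit_mult_idem [simp]: "(x :: bit) * x = x" "x * (x * y) = x * (y :: bit)"
  by (cases x; simp)+

lemmas bit_ring = bit_ac distrib_left distrib_right mult.assoc mult.commute mult.left_commute
  bit_mult_idem mult_1_left mult_1_right

text \<open>Keeps a sign as its exponent, so that equality of signs reduces to \<open>bit\<close>
  arithmetic instead of products of scalars.\<close>

definition sg :: "bit \<Rightarrow> ('w \<Rightarrow>\<^sub>0 'k::field) \<Rightarrow> ('w \<Rightarrow>\<^sub>0 'k)" where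
  "sg p = csmult (sgn_par p)"

lemma single_sgn: "Poly_Mapping.single w (sgn_par p) = sg p (Poly_Mapping.single w 1)"
  "Poly_Mapping.single w (- sgn_par p) = sg (p + 1) (Poly_Mapping.single w 1)"
  by (simp_all add: sg_def sgn_par_add)

lemma delta_list_word_True:
  assumes "i < length ws"
  shows "delta A i (list_word True ws) = sg (lpar (take i ws)) (Poly_Mapping.single (list_word
      True (ws[i := ldif A (ws ! i)])) 1)"
proof (cases ws)
  case (Cons x xs)
  show ?thesis
  proof (cases i)
    case (Suc j)
    have "(\<Sum>k<i. spar (Some x, xs) k) = fst x + 1 + lpar (take j xs)"
      using assms Cons Suc by (subst sum_spar_less) auto
    then show ?thesis using assms unfolding single_sgn(1)[symmetric]
      by (simp add: delta_def Cons Suc deg_def)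
  qed (simp add: Cons delta_def sg_def)
qed (use assms in simp)

text \<open>The unit e occupies slot 0, so the letters are numbered from 1, and |se| contributes the
  extra 1 to the exponent.\<close>

lemma delta_list_word_False:
  assumes "i < length ws"
  shows "delta A (Suc i) (list_word False ws) = sg (lpar (take i ws) + 1) (Poly_Mapping.single
      (list_word False (ws[i := ldif A (ws ! i)])) 1)"
proof -
  have "(\<Sum>k<Suc i. spar (None, ws) k) = lpar (take i ws) + 1"
    using assms by (subst sum_spar_less) (auto simp del: sum.lessThan_Suc)
  then show ?thesis using assms unfolding single_sgn(1)[symmetric]
    by (simp add: delta_def deg_def del: sum.lessThan_Suc)
qed

lemma delta_0_list_word_False: "delta A 0 (list_word False ws) = 0"
  by (simp add: delta_def)

lemma delta_beyond: "deg w < i \<Longrightarrow> delta A i w = 0"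
  by (cases w) (simp add: delta_def)

text \<open>The product is a parameter so that the same combinatorics serves \<open>A\<close> and
  \<open>opp A\<close>.\<close>

definition lmul_at :: "('a letter \<Rightarrow> 'a letter \<Rightarrow> 'a letter) \<Rightarrow> nat \<Rightarrow> 'a letter list \<Rightarrow> 'a letter
    list" where
  "lmul_at L i ws = take i ws @ L (ws ! i) (ws ! Suc i) # drop (Suc (Suc i)) ws"

definition rot :: "'a letter list \<Rightarrow> 'a letter list" where
  "rot ws = last ws # butlast ws"

lemma mu_first:
  "mu A 0 (x0, y # ys) = Poly_Mapping.single
    (Some (case x0 of None \<Rightarrow> y | Some a \<Rightarrow> lmul A a y), ys) (sgn_par (par0 (x0, y # ys)))"
  by (cases x0) (simp_all add: mu_def deg_def)

lemma mu_middle: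
  assumes "Suc i < length xs"
  shows "mu A (Suc i) (x0, xs) =
    Poly_Mapping.single (x0, lmul_at (lmul A) i xs) (sgn_par (par0 (x0, xs) + lpar (take (Suc i)
        xs)))"
proof -
  have "(\<Sum>k\<le>Suc i. spar (x0, xs) k) + 1 = par0 (x0, xs) + lpar (take (Suc i) xs)"
    using sum_spar_less[of "Suc (Suc i)" "(x0, xs)"] assms
    by (simp add: lessThan_Suc_atMost[symmetric] bit_ac del: sum.lessThan_Suc)
  then show ?thesis using assms
    by (auto simp add: mu_def deg_def lmul_at_def Let_def simp del: sum.atMost_Suc)
qed

lemma mu_last:
  "mu A (Suc (length ys)) (x0, ys @ [y]) = Poly_Mapping.single
    (Some (case x0 of None \<Rightarrow> y | Some a \<Rightarrow> lmul A y a), ys)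
    (- sgn_par ((fst y + 1) * (par0 (x0, ys @ [y]) + lpar ys)))"
proof -
  have "(\<Sum>k=1..length ys. spar (x0, ys @ [y]) k) = lpar ys"
    by (subst sum_spar_le) auto
  moreover have "spar (x0, ys @ [y]) (Suc (length ys)) = fst y + 1"
    by (simp add: spar_def)
  ultimately show ?thesis by (cases x0) (simp_all add: mu_def deg_def Let_def)
qed

lemma mu_beyond: "deg w = 0 \<or> deg w < i \<Longrightarrow> mu A i w = 0"
  by (cases w) (auto simp add: mu_def)

lemma mu_list_word_True:
  assumes "Suc i < length ws"
  shows "mu A i (list_word True ws) =
    sg (lpar (take (Suc i) ws) + 1) (Poly_Mapping.single (list_word True (lmul_at (lmul A) i ws))
        1)"
proof -
  obtain x y ys where ws: "ws = x # y # ys"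
    using assms by (metis Suc_less_eq length_Suc_conv less_imp_Suc_add list.exhaust list.size(3)
        not_less_zero)
  show ?thesis
  proof (cases i)
    case 0
    have "lpar (take (Suc i) ws) + 1 = fst x" using 0 ws by (simp only: take_Suc_Cons take_0
        lpar_simps bit_ac)
    then show ?thesis unfolding single_sgn(1)[symmetric] list_word.simps ws
      using 0 by (simp only: list_word.simps mu_first) (simp add: lmul_at_def)
  next
    case (Suc j)
    then have "lpar (take (Suc i) ws) + 1 = fst x + lpar (take (Suc j) (y # ys))"
      using ws by (simp only: take_Suc_Cons lpar_simps bit_ac)
    moreover have "Suc j < length (y # ys)" using assms Suc ws by simp
    ultimately show ?thesis using Suc unfolding single_sgn(1)[symmetric] ws
      by (simp only: list_word.simps mu_middle) (simp add: lmul_at_def)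
  qed
qed

text \<open>The exponent is arranged as the sign of the rotation plus the sign of m_0, the
  factorization of the last face in \<open>mu_op_last\<close>.\<close>

lemma mu_list_word_True_last:
  "mu A (Suc (length ws)) (list_word True (x # ws @ [y])) =
    sg ((fst y + 1) * lpar (x # ws) + fst y) (Poly_Mapping.single (list_word True (lmul A y x #
        ws)) 1)"
proof -
  have "(fst y + 1) * lpar (x # ws) + fst y = (fst y + 1) * (fst x + lpar ws) + 1"
    by (simp only: lpar_simps bit_ring)
  then show ?thesis unfolding list_word.simps mu_last single_sgn by (simp only: par0_simps
      option.case)
qed

lemma mu_list_word_False_first: "ws \<noteq> [] \<Longrightarrow> mu A 0 (list_word False ws) = Poly_Mapping.single
    (list_word True ws) 1"
  by (cases ws) (simp_all add: mu_first)

lemma mu_list_word_False_middle: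
  assumes "Suc i < length ws"
  shows "mu A (Suc i) (list_word False ws) =
    sg (lpar (take (Suc i) ws)) (Poly_Mapping.single (list_word False (lmul_at (lmul A) i ws)) 1)"
  using assms by (simp only: list_word.simps mu_middle par0_simps single_sgn add_0_left)

lemma mu_list_word_False_last:
  "mu A (Suc (length ys)) (list_word False (ys @ [y])) =
    sg ((fst y + 1) * lpar ys + 1) (Poly_Mapping.single (list_word True (y # ys)) 1)"
  by (simp only: list_word.simps mu_last par0_simps single_sgn add_0_left option.case)

lemma tau_list_word_True:
  "tau (list_word True (x # xs)) = sg ((fst x + 1) * lpar xs) (Poly_Mapping.single (list_word True
      (xs @ [x])) 1)"
proof -
  have *: "spar (Some x, xs) 0 * (\<Sum>k=1..deg (Some x, xs). spar (Some x, xs) k) = (fst x + 1) *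
      lpar xs"
    unfolding deg_def by (subst sum_spar_le) (simp_all add: spar_def)
  show ?thesis
    unfolding single_sgn(1)[symmetric] *[symmetric] by (cases xs) (simp_all add: tau_def)
qed

lemma tau_list_word_False: "tau (list_word False xs) = 0"
  by (simp add: tau_def)

lemma he_list_word_True: "ws \<noteq> [] \<Longrightarrow> he (list_word True ws) = Poly_Mapping.single (list_word False
    ws) 1"
  by (cases ws) (simp_all add: he_def)

lemma he_list_word_False: "he (list_word False ws) = 0"
  by (simp add: he_def)

text \<open>Defined on words, so that it descends to chains like the other operators; it is 0 on
  C^+(A), as \<open>tau\<close> is.\<close>

definition tau_inv :: "'a word \<Rightarrow> ('k::field, 'a) chain" where
  "tau_inv w = (case w of (None, xs) \<Rightarrow> 0 | (Some x, xs) \<Rightarrow>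
     sg ((fst (last (x # xs)) + 1) * lpar (butlast (x # xs))) (Poly_Mapping.single (list_word True
         (rot (x # xs))) 1))"

lemma tau_inv_list_word_True:
  "tau_inv (list_word True (xs @ [x])) = sg ((fst x + 1) * lpar xs) (Poly_Mapping.single
      (list_word True (x # xs)) 1)"
  by (cases xs) (simp_all add: tau_inv_def rot_def)

lemma tau_inv_list_word_False: "tau_inv (list_word False xs) = 0"
  by (simp add: tau_inv_def)

section \<open>Operators respecting multilinearity\<close>

definition wspan :: "('k::field, 'a) dga \<Rightarrow> bit \<Rightarrow> ('k, 'a) chain set" where
  "wspan A p = chain.span {Poly_Mapping.single w 1 | w. w \<in> words A \<and> wpar w = p}"

text \<open>The operators on words that descend to chains and shift the parity by \<open>q\<close>.\<close>

definition chain_op :: "('k::field, 'a::ab_group_add) dga \<Rightarrow> bit \<Rightarrow> ('a word \<Rightarrow> ('k, 'a) chain) \<Rightarrow>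
    bool" where
  "chain_op A q t \<longleftrightarrow> (\<forall>x\<in>tensor_rel A. lin_ext t x \<in> tensor_rel A) \<and>
     (\<forall>w\<in>words A. t w \<in> wspan A (wpar w + q))"

lemma subspace_wspan: "chain.subspace (wspan A p)"
  unfolding wspan_def by (rule chain.subspace_span)

lemmas wspan_closed = chain.subspace_0[OF subspace_wspan] chain.subspace_add[OF subspace_wspan]
  chain.subspace_diff[OF subspace_wspan] chain.subspace_neg[OF subspace_wspan]
  chain.subspace_scale[OF subspace_wspan] chain.subspace_sum[OF subspace_wspan]

lemmas tensor_rel_closed = chain.subspace_0[OF subspace_tensor_rel] chain.subspace_add[OF
    subspace_tensor_rel]
  chain.subspace_diff[OF subspace_tensor_rel] chain.subspace_neg[OF subspace_tensor_rel]
  chain.subspace_scale[OF subspace_tensor_rel] chain.subspace_sum[OF subspace_tensor_rel]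

lemma wspan_single: "w \<in> words A \<Longrightarrow> wpar w = p \<Longrightarrow> Poly_Mapping.single w 1 \<in> wspan A p"
  unfolding wspan_def by (rule chain.span_base) blast

lemma chain_op_wspan:
  assumes "chain_op A q t" "x \<in> wspan A p"
  shows "lin_ext t x \<in> wspan A (p + q)"
  using assms(2) unfolding wspan_def[of A p]
proof (induction rule: chain.span_induct_alt)
  case base
  show ?case by (simp add: lin_ext.zero wspan_closed)
next
  case (step c y z)
  then obtain w where "y = Poly_Mapping.single w 1" "w \<in> words A" "wpar w = p" by blast
  then show ?case using assms(1) step(2)
    by (auto simp: lin_ext.add lin_ext.scale chain_op_def intro!: wspan_closed)
qed

lemma chain_op_0: "chain_op A q (\<lambda>w. 0)"
  by (simp add: chain_op_def tensor_rel_closed wspan_closed)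

lemma chain_op_add: "chain_op A q s \<Longrightarrow> chain_op A q t \<Longrightarrow> chain_op A q (\<lambda>w. s w + t w)"
  by (simp add: chain_op_def lin_ext_fun_add tensor_rel_closed wspan_closed)

lemma chain_op_scale: "chain_op A q t \<Longrightarrow> chain_op A q (\<lambda>w. csmult c (t w))"
  by (simp add: chain_op_def lin_ext_fun_scale tensor_rel_closed wspan_closed)

lemma chain_op_uminus: "chain_op A q t \<Longrightarrow> chain_op A q (\<lambda>w. - t w)"
  by (simp add: chain_op_def lin_ext_fun_uminus tensor_rel_closed wspan_closed)

lemma chain_op_sum: "(\<And>i. i \<in> I \<Longrightarrow> chain_op A q (t i)) \<Longrightarrow> chain_op A q (\<lambda>w. \<Sum>i\<in>I. t i w)"
  by (simp add: chain_op_def lin_ext_fun_sum tensor_rel_closed wspan_closed)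

lemma chain_op_lin_ext:
  assumes "chain_op A p s" "chain_op A q t" "r = q + p"
  shows "chain_op A r (\<lambda>w. lin_ext s (t w))"
  using assms(1,2) chain_op_wspan[OF assms(1)] unfolding chain_op_def assms(3)
  by (simp add: add.assoc[symmetric] flip: lin_ext_lin_ext)

lemma chain_op_single: "chain_op A 0 (\<lambda>w. Poly_Mapping.single w 1)"
  by (simp add: chain_op_def wspan_single)

section \<open>Multilinear rearrangements of lists\<close>

definition letter_linear :: "('k::field, 'a::ab_group_add) dga \<Rightarrow> bit \<Rightarrow> bit \<Rightarrow> ('a \<Rightarrow> 'a) \<Rightarrow> bool" where
  "letter_linear A p p' \<phi> \<longleftrightarrow> (\<forall>a\<in>hom A p. \<phi> a \<in> hom A p' \<and>
     (\<forall>b\<in>hom A p. \<phi> (a + b) = \<phi> a + \<phi> b) \<and> (\<forall>c. \<phi> (scl A c a) = scl A c (\<phi> a)))"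

text \<open>Stated for one slot at a time, to match the generators of \<open>tensor_rel\<close>:
  with the other letters frozen, exactly one letter of the result depends on the free letter, and it
  does so linearly.\<close>

definition multilinear_op :: "('k::field, 'a::ab_group_add) dga \<Rightarrow> nat \<Rightarrow> nat \<Rightarrow>
    ('a letter list \<Rightarrow> 'a letter list) \<Rightarrow> bool" where
  "multilinear_op A k l f \<longleftrightarrow> (\<forall>ys p zs. valid A ys \<longrightarrow> valid A zs \<longrightarrow> length ys + length zs + 1 = k \<longrightarrow>
     (\<exists>ys' p' zs' \<phi>. valid A ys' \<and> valid A zs' \<and> length ys' + length zs' + 1 = l \<and>
       letter_linear A p p' \<phi> \<and> (\<forall>a\<in>hom A p. f (ys @ (p, a) # zs) = ys' @ (p', \<phi> a) # zs')))"

lemma letter_linear_id: "letter_linear A p p (\<lambda>a. a)"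
  by (simp add: letter_linear_def)

lemma multilinear_opI:
  assumes "\<And>ys p zs. valid A ys \<Longrightarrow> valid A zs \<Longrightarrow> length ys + length zs + 1 = k \<Longrightarrow>
    \<exists>ys' p' zs' \<phi>. valid A ys' \<and> valid A zs' \<and> length ys' + length zs' + 1 = l \<and>
       letter_linear A p p' \<phi> \<and> (\<forall>a\<in>hom A p. f (ys @ (p, a) # zs) = ys' @ (p', \<phi> a) # zs')"
  shows "multilinear_op A k l f"
  using assms unfolding multilinear_op_def by blast

lemma multilinear_opE:
  assumes "multilinear_op A k l f" "valid A ys" "valid A zs" "length ys + length zs + 1 = k"
  obtains ys' p' zs' \<phi> where "valid A ys'" "valid A zs'" "length ys' + length zs' + 1 = l"
    "letter_linear A p p' \<phi>" "\<forall>a\<in>hom A p. f (ys @ (p, a) # zs) = ys' @ (p', \<phi> a) # zs'"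
  using assms(1)[unfolded multilinear_op_def, THEN spec, THEN spec[of _ p], THEN spec, THEN mp,
      THEN mp, THEN mp, OF assms(2-4)]
  by (elim exE conjE) (rule that)

lemma multilinear_op_id: "multilinear_op A k k (\<lambda>ws. ws)"
proof (rule multilinear_opI)
  fix ys p zs assume v: "valid A ys" "valid A zs" and k: "length ys + length zs + 1 = k"
  show "\<exists>ys' q zs' \<psi>. valid A ys' \<and> valid A zs' \<and> length ys' + length zs' + 1 = k \<and>
      letter_linear A p q \<psi> \<and> (\<forall>a\<in>hom A p. ys @ (p, a) # zs = ys' @ (q, \<psi> a) # zs')"
    by (rule exI[of _ ys], rule exI[of _ p], rule exI[of _ zs], rule exI[of _ "\<lambda>a. a"])
      (use v k in \<open>simp add: letter_linear_id\<close>)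
qed

lemma multilinear_op_comp:
  assumes "multilinear_op A k l f" "multilinear_op A l m g"
  shows "multilinear_op A k m (\<lambda>ws. g (f ws))"
proof (rule multilinear_opI)
  fix ys p zs assume "valid A ys" "valid A zs" "length ys + length zs + 1 = k"
  then obtain ys' p' zs' \<phi> where 1: "valid A ys'" "valid A zs'" "length ys' + length zs' + 1 = l"
    "letter_linear A p p' \<phi>" "\<forall>a\<in>hom A p. f (ys @ (p, a) # zs) = ys' @ (p', \<phi> a) # zs'"
    by (rule multilinear_opE[OF assms(1)])
  from 1(1-3) obtain ys'' p'' zs'' \<psi> where 2: "valid A ys''" "valid A zs''" "length ys'' + length
      zs'' + 1 = m"
    "letter_linear A p' p'' \<psi>" "\<forall>a\<in>hom A p'. g (ys' @ (p', a) # zs') = ys'' @ (p'', \<psi> a) # zs''"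
    by (rule multilinear_opE[OF assms(2)])
  have "letter_linear A p p'' (\<psi> \<circ> \<phi>)"
    using 1(4) 2(4) by (simp add: letter_linear_def)
  moreover have "\<forall>a\<in>hom A p. g (f (ys @ (p, a) # zs)) = ys'' @ (p'', (\<psi> \<circ> \<phi>) a) # zs''"
    using 1(4,5) 2(5) by (simp add: letter_linear_def)
  ultimately show "\<exists>ys' p' zs' \<phi>. valid A ys' \<and> valid A zs' \<and> length ys' + length zs' + 1 = m \<and>
       letter_linear A p p' \<phi> \<and> (\<forall>a\<in>hom A p. g (f (ys @ (p, a) # zs)) = ys' @ (p', \<phi> a) # zs')"
    using 2(1-3) by blast
qed

lemma multilinear_op_valid:
  assumes "multilinear_op A k l f" "valid A ws" "length ws = k" "0 < k"
  shows "valid A (f ws)" "length (f ws) = l"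
proof -
  obtain x xs where ws: "ws = [] @ x # xs" using assms(3,4) by (cases ws) auto
  then obtain ys' p' zs' \<phi> where 1: "valid A ys'" "valid A zs'" "length ys' + length zs' + 1 = l"
    "letter_linear A (fst x) p' \<phi>" "\<forall>a\<in>hom A (fst x). f ([] @ (fst x, a) # xs) = ys' @ (p', \<phi> a) #
        zs'"
    using assms(1)[unfolded multilinear_op_def, rule_format, of "[]" xs "fst x"] assms(2,3) by auto
  have "f ws = ys' @ (p', \<phi> (snd x)) # zs'" "snd x \<in> hom A (fst x)"
    using bspec[OF 1(5), of "snd x"] ws assms(2) by auto
  then show "valid A (f ws)" "length (f ws) = l"
    using 1 by (auto simp: letter_linear_def)
qed

lemma nat_cases_below_above:
  fixes i l :: nat
  obtains (left) "i < l" | (here) "i = l" | (right) j where "i = l + 1 + j"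
  by (metis Suc_eq_plus1 add_Suc less_imp_Suc_add linorder_cases)

lemma valid_nth: "valid A ws \<Longrightarrow> i < length ws \<Longrightarrow> snd (ws ! i) \<in> hom A (fst (ws ! i))"
  using nth_mem by (fastforce simp: valid_def)

lemma valid_update:
  "valid A ws \<Longrightarrow> snd x \<in> hom A (fst x) \<Longrightarrow> valid A (ws[i := x])"
  using set_update_subset_insert[of ws i x] by (fastforce simp: valid_def)

lemma valid_take [simp]: "valid A ws \<Longrightarrow> valid A (take i ws)"
  and valid_drop [simp]: "valid A ws \<Longrightarrow> valid A (drop i ws)"
  by (auto simp: valid_def dest: in_set_takeD in_set_dropD)

lemma multilinear_op_update:
  assumes L: "\<And>p. letter_linear A p (p' p) \<phi>" and i: "i < k"
  shows "multilinear_op A k k (\<lambda>ws. ws[i := (p' (fst (ws ! i)), \<phi> (snd (ws ! i)))])"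
proof (rule multilinear_opI)
  fix ys p zs assume v: "valid A ys" "valid A zs" and k: "length ys + length zs + 1 = k"
  let ?F = "\<lambda>ws i. ws[i := (p' (fst (ws ! i)), \<phi> (snd (ws ! i)))]"
  have valid: "valid A (?F ws i)" if "valid A ws" "i < length ws" for ws i
    using that L valid_nth[OF that] by (intro valid_update) (auto simp: letter_linear_def)
  have "\<exists>ys' q zs' \<psi>. valid A ys' \<and> valid A zs' \<and> length ys' + length zs' + 1 = k \<and>
      letter_linear A p q \<psi> \<and> (\<forall>a. ?F (ys @ (p, a) # zs) i = ys' @ (q, \<psi> a) # zs')"
  proof (cases rule: nat_cases_below_above[of i "length ys"])
    case left
    show ?thesis
      by (rule exI[of _ "?F ys i"], rule exI[of _ p], rule exI[of _ zs], rule exI[of _ "\<lambda>a. a"])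
        (use left v k in \<open>simp add: valid letter_linear_id nth_append list_update_append\<close>)
  next
    case here
    show ?thesis
      by (rule exI[of _ ys], rule exI[of _ "p' p"], rule exI[of _ zs], rule exI[of _ \<phi>])
        (use here v k L in \<open>simp add: nth_append list_update_append\<close>)
  next
    case (right j)
    show ?thesis
      by (rule exI[of _ ys], rule exI[of _ p], rule exI[of _ "?F zs j"], rule exI[of _ "\<lambda>a. a"])
        (use right v k i in \<open>simp add: valid letter_linear_id nth_append list_update_append\<close>)
  qed
  then show "\<exists>ys' q zs' \<psi>. valid A ys' \<and> valid A zs' \<and> length ys' + length zs' + 1 = k \<and>
      letter_linear A p q \<psi> \<and> (\<forall>a\<in>hom A p. ?F (ys @ (p, a) # zs) i = ys' @ (q, \<psi> a) # zs')"
    by blast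
qed

lemma multilinear_op_lmul_at:
  assumes L1: "\<And>p q y. y \<in> hom A q \<Longrightarrow> letter_linear A p (p + q) (\<lambda>a. snd (L (p, a) (q, y)))"
    and L2: "\<And>p q y. y \<in> hom A q \<Longrightarrow> letter_linear A p (q + p) (\<lambda>a. snd (L (q, y) (p, a)))"
    and L3: "\<And>x y. fst (L x y) = fst x + fst y"
    and i: "Suc i < k"
  shows "multilinear_op A k (k - 1) (lmul_at L i)"
proof (rule multilinear_opI)
  fix ys p zs assume v: "valid A ys" "valid A zs" and k: "length ys + length zs + 1 = k"
  have L: "L x y = (fst x + fst y, snd (L x y))" for x y
    by (metis L3 prod.collapse)
  have valid: "valid A (lmul_at L i ws)" "length (lmul_at L i ws) = length ws - 1"
    if "valid A ws" "Suc i < length ws" for ws i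
    using that valid_nth[OF that(1), of i] valid_nth[OF that(1), of "Suc i"] L1
    by (fastforce simp: lmul_at_def L3 letter_linear_def)+
  \<comment> \<open>In the cases below, the free letter follows the product, is its right factor, is
    its left factor, or precedes it.\<close>
  have "\<exists>ys' q zs' \<psi>. valid A ys' \<and> valid A zs' \<and> length ys' + length zs' + 1 = k - 1 \<and>
      letter_linear A p q \<psi> \<and> (\<forall>a. lmul_at L i (ys @ (p, a) # zs) = ys' @ (q, \<psi> a) # zs')"
  proof (cases rule: nat_cases_below_above[of "Suc i" "length ys"])
    case left
    have "lmul_at L i (ys @ (p, a) # zs) = lmul_at L i ys @ (p, a) # zs" for a
      using left by (simp add: lmul_at_def nth_append)
    then show ?thesis
      by (intro exI[of _ "lmul_at L i ys"] exI[of _ p] exI[of _ zs] exI[of _ "\<lambda>a. a"])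
        (use left v k in \<open>simp add: valid letter_linear_id\<close>)
  next
    case here
    let ?y = "ys ! i"
    have "snd ?y \<in> hom A (fst ?y)" using here v valid_nth[of A ys i] by simp
    from L2[OF this] show ?thesis
      by (intro exI[of _ "take i ys"] exI[of _ "fst ?y + p"] exI[of _ zs] exI[of _ "\<lambda>a. snd (L ?y
          (p, a))"])
        (use here v k in \<open>simp add: lmul_at_def nth_append L3 prod_eq_iff\<close>)
  next
    case (right j)
    show ?thesis
    proof (cases j)
      case 0
      then have i': "i = length ys" using right by simp
      obtain z zs' where zs: "zs = z # zs'" using i i' k by (cases zs) auto
      have "letter_linear A p (p + fst z) (\<lambda>a. snd (L (p, a) z))"
        using L1[of "snd z" "fst z" p] zs v by simp
      then show ?thesis
        by (intro exI[of _ ys] exI[of _ "p + fst z"] exI[of _ zs'] exI[of _ "\<lambda>a. snd (L (p, a) z)"])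
          (use i' zs v k in \<open>simp add: lmul_at_def nth_append L3 prod_eq_iff\<close>)
    next
      case (Suc l)
      then have i': "i = length ys + 1 + l" using right by simp
      then have "Suc l < length zs" using i k by simp
      moreover have "lmul_at L i (ys @ (p, a) # zs) = ys @ (p, a) # lmul_at L l zs" for a
        using i' by (simp add: lmul_at_def nth_append numeral_3_eq_3)
      ultimately show ?thesis
        by (intro exI[of _ ys] exI[of _ p] exI[of _ "lmul_at L l zs"] exI[of _ "\<lambda>a. a"])
          (use i' v k in \<open>simp add: valid letter_linear_id\<close>)
    qed
  qed
  then show "\<exists>ys' q zs' \<psi>. valid A ys' \<and> valid A zs' \<and> length ys' + length zs' + 1 = k - 1 \<and>
      letter_linear A p q \<psi> \<and> (\<forall>a\<in>hom A p. lmul_at L i (ys @ (p, a) # zs) = ys' @ (q, \<psi> a) # zs')"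
    by blast
qed

lemma multilinear_op_rot: "multilinear_op A k k rot"
proof (rule multilinear_opI)
  fix ys p zs assume v: "valid A ys" "valid A zs" and k: "length ys + length zs + 1 = k"
  show "\<exists>ys' q zs' \<psi>. valid A ys' \<and> valid A zs' \<and> length ys' + length zs' + 1 = k \<and>
      letter_linear A p q \<psi> \<and> (\<forall>a\<in>hom A p. rot (ys @ (p, a) # zs) = ys' @ (q, \<psi> a) # zs')"
  proof (cases zs rule: rev_cases)
    case Nil
    show ?thesis
      by (intro exI[of _ "[]"] exI[of _ p] exI[of _ ys] exI[of _ "\<lambda>a. a"])
        (use v k Nil in \<open>simp add: rot_def letter_linear_id\<close>)
  next
    case (snoc zs' z)
    show ?thesis
      by (intro exI[of _ "z # ys"] exI[of _ p] exI[of _ zs'] exI[of _ "\<lambda>a. a"])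
        (use v k snoc in \<open>simp add: rot_def letter_linear_id butlast_append\<close>)
  qed
qed

lemma multilinear_op_rotate1: "multilinear_op A k k rotate1"
proof (rule multilinear_opI)
  fix ys p zs assume v: "valid A ys" "valid A zs" and k: "length ys + length zs + 1 = k"
  show "\<exists>ys' q zs' \<psi>. valid A ys' \<and> valid A zs' \<and> length ys' + length zs' + 1 = k \<and>
      letter_linear A p q \<psi> \<and> (\<forall>a\<in>hom A p. rotate1 (ys @ (p, a) # zs) = ys' @ (q, \<psi> a) # zs')"
  proof (cases ys)
    case Nil
    show ?thesis
      by (intro exI[of _ zs] exI[of _ p] exI[of _ "[]"] exI[of _ "\<lambda>a. a"])
        (use v k Nil in \<open>simp add: letter_linear_id\<close>)
  next
    case (Cons y ys')
    show ?thesis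
      by (intro exI[of _ ys'] exI[of _ p] exI[of _ "zs @ [y]"] exI[of _ "\<lambda>a. a"])
        (use v k Cons in \<open>simp add: letter_linear_id\<close>)
  qed
qed

lemma multilinear_op_rev: "multilinear_op A k k rev"
proof (rule multilinear_opI)
  fix ys p zs assume v: "valid A ys" "valid A zs" and k: "length ys + length zs + 1 = k"
  show "\<exists>ys' q zs' \<psi>. valid A ys' \<and> valid A zs' \<and> length ys' + length zs' + 1 = k \<and>
      letter_linear A p q \<psi> \<and> (\<forall>a\<in>hom A p. rev (ys @ (p, a) # zs) = ys' @ (q, \<psi> a) # zs')"
    by (intro exI[of _ "rev zs"] exI[of _ p] exI[of _ "rev ys"] exI[of _ "\<lambda>a. a"])
      (use v k in \<open>simp add: letter_linear_id\<close>)
qed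

section \<open>From rearrangements of lists to operators on chains\<close>

context dg_algebra
begin

lemma hom_closed:
  "0 \<in> hom A p" "a \<in> hom A p \<Longrightarrow> b \<in> hom A p \<Longrightarrow> a + b \<in> hom A p" "a \<in> hom A p \<Longrightarrow> scl A c a \<in> hom A p"
  using subspace_0 subspace_add subspace_scale subspace_hom by blast+

lemma tensor_rel_add:
  assumes "valid A ys" "valid A zs" "a \<in> hom A p" "b \<in> hom A p"
  shows "Poly_Mapping.single (list_word s (ys @ (p, a + b) # zs)) 1 - Poly_Mapping.single
      (list_word s (ys @ (p, a) # zs)) 1
    - Poly_Mapping.single (list_word s (ys @ (p, b) # zs)) 1 \<in> tensor_rel A"
  unfolding tensor_rel_def
proof (rule chain.span_base, rule UnI1, rule CollectI, intro exI conjI)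
  show "(\<lambda>x. list_word s (ys @ x # zs)) \<in> slots" unfolding slots_eq by blast
  show "list_word s (ys @ (p, a) # zs) \<in> words A" "list_word s (ys @ (p, b) # zs) \<in> words A"
    using assms by (auto intro!: list_word_in_words)
qed simp

lemma tensor_rel_scale:
  assumes "valid A ys" "valid A zs" "a \<in> hom A p"
  shows "Poly_Mapping.single (list_word s (ys @ (p, scl A c a) # zs)) 1
    - csmult c (Poly_Mapping.single (list_word s (ys @ (p, a) # zs)) 1) \<in> tensor_rel A"
  unfolding tensor_rel_def
proof (rule chain.span_base, rule UnI2, rule CollectI, intro exI conjI)
  show "(\<lambda>x. list_word s (ys @ x # zs)) \<in> slots" unfolding slots_eq by blast
  show "list_word s (ys @ (p, a) # zs) \<in> words A"
    using assms by (auto intro!: list_word_in_words)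
qed simp

lemma tensor_rel_induct [consumes 1, case_names zero plus scl add scale]:
  assumes "x \<in> tensor_rel A"
    and "P 0"
    and plus: "\<And>s ys p a b zs. valid A ys \<Longrightarrow> valid A zs \<Longrightarrow> a \<in> hom A p \<Longrightarrow> b \<in> hom A p \<Longrightarrow>
      P (Poly_Mapping.single (list_word s (ys @ (p, a + b) # zs)) 1 - Poly_Mapping.single
          (list_word s (ys @ (p, a) # zs)) 1
        - Poly_Mapping.single (list_word s (ys @ (p, b) # zs)) 1)"
    and scl: "\<And>s ys p a c zs. valid A ys \<Longrightarrow> valid A zs \<Longrightarrow> a \<in> hom A p \<Longrightarrow>
      P (Poly_Mapping.single (list_word s (ys @ (p, scl A c a) # zs)) 1
        - csmult c (Poly_Mapping.single (list_word s (ys @ (p, a) # zs)) 1))"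
    and "\<And>x y. P x \<Longrightarrow> P y \<Longrightarrow> P (x + y)"
    and "\<And>c x. P x \<Longrightarrow> P (csmult c x)"
  shows "P x"
  using assms(1) unfolding tensor_rel_def
proof (induction rule: chain.span_induct_alt)
  case (step c y z)
  have "P y"
    using step(1)
  proof (elim UnE CollectE exE conjE)
    fix \<sigma> p a b
    assume "\<sigma> \<in> slots" "\<sigma> (p, a) \<in> words A" "\<sigma> (p, b) \<in> words A" and y: "y = Poly_Mapping.single
        (\<sigma> (p, a + b)) 1
      - Poly_Mapping.single (\<sigma> (p, a)) 1 - Poly_Mapping.single (\<sigma> (p, b)) 1"
    moreover then obtain s ys zs where "\<sigma> = (\<lambda>x. list_word s (ys @ x # zs))" unfolding slots_eq by
        blast
    ultimately show "P y" by (simp add: list_word_in_words_iff plus)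
  next
    fix \<sigma> p a c
    assume "\<sigma> \<in> slots" "\<sigma> (p, a) \<in> words A" and y: "y = Poly_Mapping.single (\<sigma> (p, scl A c a)) 1
      - csmult c (Poly_Mapping.single (\<sigma> (p, a)) 1)"
    moreover then obtain s ys zs where "\<sigma> = (\<lambda>x. list_word s (ys @ x # zs))" unfolding slots_eq by
        blast
    ultimately show "P y" using scl by (simp add: list_word_in_words_iff del: csmult_single)
  qed
  then show ?case using assms step by blast
qed (rule assms(2))

text \<open>All words in a generator of \<open>tensor_rel\<close> have the same degree. Hence sums
  whose bounds depend on \<open>deg w\<close> descend as soon as they do for every fixed
  bound.\<close>

lemma chain_op_deg:
  assumes "\<And>n. chain_op A q (t n)"
  shows "chain_op A q (\<lambda>w. t (deg w) w)"
  unfolding chain_op_def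
proof (intro conjI ballI)
  fix x assume "x \<in> tensor_rel A"
  then show "lin_ext (\<lambda>w. t (deg w) w) x \<in> tensor_rel A"
  proof (induction rule: tensor_rel_induct)
    case (plus s ys p a b zs)
    define n where "n = deg (list_word s (ys @ (p, a) # zs))"
    have deg: "deg (list_word s (ys @ x # zs)) = n" for x
      by (simp add: n_def deg_list_word)
    have "lin_ext (t n) (Poly_Mapping.single (list_word s (ys @ (p, a + b) # zs)) 1
      - Poly_Mapping.single (list_word s (ys @ (p, a) # zs)) 1 - Poly_Mapping.single (list_word s
          (ys @ (p, b) # zs)) 1) \<in> tensor_rel A"
      using tensor_rel_add[OF plus] assms[of n] unfolding chain_op_def by blast
    then show ?case by (simp add: lin_ext.diff deg)
  next
    case (scl s ys p a c zs)
    define n where "n = deg (list_word s (ys @ (p, a) # zs))"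
    have deg: "deg (list_word s (ys @ x # zs)) = n" for x
      by (simp add: n_def deg_list_word)
    have "lin_ext (t n) (Poly_Mapping.single (list_word s (ys @ (p, scl A c a) # zs)) 1
      - csmult c (Poly_Mapping.single (list_word s (ys @ (p, a) # zs)) 1)) \<in> tensor_rel A"
      using tensor_rel_scale[OF scl] assms[of n] unfolding chain_op_def by blast
    then show ?case by (simp add: lin_ext.diff deg)
  qed (simp_all add: lin_ext.zero lin_ext.add lin_ext.scale tensor_rel_closed)
qed (use assms in \<open>auto simp: chain_op_def\<close>)

text \<open>The coefficient may depend on the parities only, so it is common to all words of one
  relation. Where it vanishes, no condition on the length or the parity of the result is
  imposed.\<close>

lemma chain_opI:
  assumes "\<And>s k. 0 < k \<Longrightarrow> \<exists>s' l f c. multilinear_op A k l f \<and> (\<forall>ws. valid A ws \<longrightarrow> length ws = k \<longrightarrow>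
      t (list_word s ws) = csmult (c (map fst ws)) (Poly_Mapping.single (list_word s' (f ws)) 1) \<and>
      (c (map fst ws) \<noteq> 0 \<longrightarrow> 0 < l \<and> wpar (list_word s' (f ws)) = wpar (list_word s ws) + q))"
  shows "chain_op A q t"
  unfolding chain_op_def
proof (intro conjI ballI)
  fix x assume "x \<in> tensor_rel A"
  then show "lin_ext t x \<in> tensor_rel A"
  proof (induction rule: tensor_rel_induct)
    case (plus s ys p a b zs)
    let ?k = "length ys + length zs + 1"
    obtain s' l f c where f: "multilinear_op A ?k l f" and t: "\<And>ws. valid A ws \<Longrightarrow> length ws = ?k \<Longrightarrow>
      t (list_word s ws) = csmult (c (map fst ws)) (Poly_Mapping.single (list_word s' (f ws)) 1)"
      using assms[of ?k s] by auto
    obtain ys' p' zs' \<phi> where 1: "valid A ys'" "valid A zs'"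
      "letter_linear A p p' \<phi>" "\<And>a. a\<in>hom A p \<Longrightarrow> f (ys @ (p, a) # zs) = ys' @ (p', \<phi> a) # zs'"
      using f[unfolded multilinear_op_def, rule_format, of ys zs p] plus by auto
    have "csmult (c (map fst ys @ p # map fst zs)) (Poly_Mapping.single (list_word s' (ys' @ (p',
        \<phi> a + \<phi> b) # zs')) 1
      - Poly_Mapping.single (list_word s' (ys' @ (p', \<phi> a) # zs')) 1
      - Poly_Mapping.single (list_word s' (ys' @ (p', \<phi> b) # zs')) 1) \<in> tensor_rel A"
      using 1(1-3) plus by (intro tensor_rel_closed tensor_rel_add) (auto simp: letter_linear_def)
    then show ?case using plus 1(3)
      by (simp add: lin_ext.diff t 1(4) hom_closed letter_linear_def chain.scale_right_diff_distrib)
  next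
    case (scl s ys p a e zs)
    let ?k = "length ys + length zs + 1"
    obtain s' l f c where f: "multilinear_op A ?k l f" and t: "\<And>ws. valid A ws \<Longrightarrow> length ws = ?k \<Longrightarrow>
      t (list_word s ws) = csmult (c (map fst ws)) (Poly_Mapping.single (list_word s' (f ws)) 1)"
      using assms[of ?k s] by auto
    obtain ys' p' zs' \<phi> where 1: "valid A ys'" "valid A zs'"
      "letter_linear A p p' \<phi>" "\<And>a. a\<in>hom A p \<Longrightarrow> f (ys @ (p, a) # zs) = ys' @ (p', \<phi> a) # zs'"
      using f[unfolded multilinear_op_def, rule_format, of ys zs p] scl by auto
    have "csmult (c (map fst ys @ p # map fst zs)) (Poly_Mapping.single (list_word s' (ys' @ (p',
        scl A e (\<phi> a)) # zs')) 1
      - csmult e (Poly_Mapping.single (list_word s' (ys' @ (p', \<phi> a) # zs')) 1)) \<in> tensor_rel A"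
      using 1(1-3) scl by (intro tensor_rel_closed tensor_rel_scale) (auto simp: letter_linear_def)
    then show ?case using scl 1(3)
      by (simp add: lin_ext.diff t 1(4) hom_closed letter_linear_def
          chain.scale_right_diff_distrib mult.commute)
  qed (simp_all add: lin_ext.zero lin_ext.add lin_ext.scale tensor_rel_closed)
next
  fix w assume "w \<in> words A"
  then obtain s ws where w: "w = list_word s ws" "ws \<noteq> []" "valid A ws" unfolding words_eq by blast
  then obtain s' l f c where 1: "multilinear_op A (length ws) l f"
      "t (list_word s ws) = csmult (c (map fst ws)) (Poly_Mapping.single (list_word s' (f ws)) 1)"
      "c (map fst ws) \<noteq> 0 \<Longrightarrow> 0 < l \<and> wpar (list_word s' (f ws)) = wpar (list_word s ws) + q"
    using assms[of "length ws" s] by auto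
  show "t w \<in> wspan A (wpar w + q)"
  proof (cases "c (map fst ws) = 0")
    case False
    have "valid A (f ws)" "f ws \<noteq> []"
      using multilinear_op_valid[OF 1(1) w(3) refl] w(2) 1(3)[OF False] by auto
    then show ?thesis
      unfolding w(1) 1(2) by (intro wspan_closed wspan_single) (use 1(3)[OF False] in auto)
  qed (use 1 w in \<open>simp add: wspan_closed\<close>)
qed

end

section \<open>Parities of rearranged lists and the sign of the reversal\<close>

lemma lpar_eq: "lpar ws = (\<Sum>p\<leftarrow>map fst ws. p + 1)"
  by (simp add: lpar_def comp_def)

lemma lpar_take_eq: "lpar (take i ws) = (\<Sum>p\<leftarrow>take i (map fst ws). p + 1)"
  by (simp add: lpar_eq take_map)

lemma lpar_update_ldif: "i < length ws \<Longrightarrow> lpar (ws[i := ldif A (ws ! i)]) = lpar ws + 1"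
  by (induction ws arbitrary: i) (auto simp: ldif_def bit_ac split: nat.splits)

lemma lpar_lmul_at:
  assumes "Suc i < length ws" "\<And>x y. fst (L x y) = fst x + fst y"
  shows "lpar (lmul_at L i ws) = lpar ws + 1"
proof -
  have "ws = take i ws @ ws ! i # ws ! Suc i # drop (Suc (Suc i)) ws"
    using assms(1) by (simp add: Cons_nth_drop_Suc)
  then have "lpar ws = lpar (take i ws @ ws ! i # ws ! Suc i # drop (Suc (Suc i)) ws)" by simp
  then show ?thesis by (simp add: lmul_at_def assms(2) bit_ac)
qed

lemma lpar_rot: "ws \<noteq> [] \<Longrightarrow> lpar (rot ws) = lpar ws"
  by (cases ws rule: rev_cases) (simp_all add: rot_def bit_ac)

lemma lpar_rotate1: "lpar (rotate1 ws) = lpar ws"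
  by (cases ws) (simp_all add: bit_ac)

text \<open>The sum of p_i p_j over i < j, i.e. the Koszul exponent of reversing a list of elements
  with these parities.\<close>

fun koszul :: "bit list \<Rightarrow> bit" where
  "koszul [] = 0"
| "koszul (p # ps) = p * sum_list ps + koszul ps"

lemma koszul_append: "koszul (ps @ qs) = koszul ps + sum_list ps * sum_list qs + koszul qs"
  by (induction ps) (simp_all add: bit_ring)

lemma koszul_rev: "koszul (rev ps) = koszul ps"
  by (induction ps) (simp_all add: koszul_append sum_list_rev bit_ring)

lemma sum_spar_spar:
  "(\<Sum>j=1..deg w. \<Sum>i\<in>{1..<j}. spar w i * spar w j) = koszul (map (\<lambda>x. fst x + 1) (snd w))"
proof -
  have "(\<Sum>j=1..k. \<Sum>i\<in>{1..<j}. spar w i * spar w j) = koszul (map (\<lambda>x. fst x + 1) (take k (snd w)))"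
    if "k \<le> length (snd w)" for k
    using that
  proof (induction k)
    case (Suc k)
    have "{1..<Suc k} = {1..k}" by auto
    then have "(\<Sum>i\<in>{1..<Suc k}. spar w i * spar w (Suc k)) = lpar (take k (snd w)) * (fst (snd w !
        k) + 1)"
      using Suc.prems sum_spar_le[of k w] by (simp add: sum_distrib_right[symmetric] spar_def)
    then show ?case using Suc
      by (simp add: take_Suc_conv_app_nth koszul_append lpar_def del: One_nat_def)
  qed simp
  from this[of "deg w"] show ?thesis by (simp add: deg_def)
qed

text \<open>The exponent in \<open>Phi\<close>, as a function of the unshifted parities of the
  letters that are reversed; in C(A), a_0 is not among them.\<close>

definition phi_par :: "bit list \<Rightarrow> bit" where
  "phi_par ps = of_nat (length ps) + koszul (map (\<lambda>p. p + 1) ps)"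

definition phi_word :: "'a word \<Rightarrow> ('k::field, 'a) chain" where
  "phi_word w = Poly_Mapping.single (fst w, rev (snd w))
     (sgn_par (of_nat (deg w) + (\<Sum>j=1..deg w. \<Sum>i\<in>{1..<j}. spar w i * spar w j)))"

lemma phi_word_eq:
  "phi_word w = sg (phi_par (map fst (snd w))) (Poly_Mapping.single (fst w, rev (snd w)) 1)"
  unfolding phi_word_def sum_spar_spar by (simp add: phi_par_def deg_def single_sgn comp_def)

lemma phi_list_word_True:
  "phi_word (list_word True (x # xs)) = sg (phi_par (map fst xs)) (Poly_Mapping.single (list_word
      True (x # rev xs)) 1)"
  by (simp add: phi_word_eq)

lemma phi_list_word_False:
  "phi_word (list_word False xs) = sg (phi_par (map fst xs)) (Poly_Mapping.single (list_word False
      (rev xs)) 1)"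
  by (simp add: phi_word_eq)

context dg_algebra
begin

lemma chain_op_sgI:
  assumes "\<And>s k. 0 < k \<Longrightarrow> (\<forall>ws. length ws = k \<longrightarrow> t (list_word s ws) = 0) \<or>
    (\<exists>s' l f e. 0 < l \<and> multilinear_op A k l f \<and> (\<forall>ws. length ws = k \<longrightarrow>
      t (list_word s ws) = sg (e (map fst ws)) (Poly_Mapping.single (list_word s' (f ws)) 1) \<and>
      lpar (f ws) + (if s' then 1 else 0) = lpar ws + (if s then 1 else 0) + q))"
  shows "chain_op A q t"
proof (rule chain_opI)
  fix s :: bool and k :: nat assume k: "0 < k"
  from assms[OF k, of s] show "\<exists>s' l f c. multilinear_op A k l f \<and> (\<forall>ws. valid A ws \<longrightarrow> length ws =
      k \<longrightarrow>
      t (list_word s ws) = csmult (c (map fst ws)) (Poly_Mapping.single (list_word s' (f ws)) 1) \<and>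
      (c (map fst ws) \<noteq> 0 \<longrightarrow> 0 < l \<and> wpar (list_word s' (f ws)) = wpar (list_word s ws) + q))"
  proof (elim disjE exE conjE)
    assume "\<forall>ws. length ws = k \<longrightarrow> t (list_word s ws) = 0"
    then show ?thesis
      by (intro exI[of _ s] exI[of _ k] exI[of _ "\<lambda>ws. ws"] exI[of _ "\<lambda>ps. 0"])
        (simp add: multilinear_op_id)
  next
    fix s' l f e
    assume l: "0 < l" and f: "multilinear_op A k l f"
      and t: "\<forall>ws. length ws = k \<longrightarrow>
        t (list_word s ws) = sg (e (map fst ws)) (Poly_Mapping.single (list_word s' (f ws)) 1) \<and>
        lpar (f ws) + (if s' then 1 else 0) = lpar ws + (if s then 1 else 0) + q"
    show ?thesis
    proof (intro exI[of _ s'] exI[of _ l] exI[of _ f] exI[of _ "\<lambda>ps. sgn_par (e ps)"] conjI allI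
        impI)
      fix ws assume ws: "valid A ws" "length ws = k"
      show "t (list_word s ws) = csmult (sgn_par (e (map fst ws))) (Poly_Mapping.single (list_word
          s' (f ws)) 1)"
        using t ws by (simp add: sg_def)
      have ne: "f ws \<noteq> []" "ws \<noteq> []" using multilinear_op_valid[OF f ws k] l ws k by auto
      show "wpar (list_word s' (f ws)) = wpar (list_word s ws) + q"
        using t ws unfolding wpar_list_word[OF ne(1)] wpar_list_word[OF ne(2)] by blast
    qed (rule l f)+
  qed
qed

section \<open>The elementary operators descend to chains\<close>

lemma letter_linear_dif: "letter_linear A p (p + 1) (dif A)"
  by (simp add: letter_linear_def dif_hom dif_add dif_scl)

lemma multilinear_op_ldif: "i < k \<Longrightarrow> multilinear_op A k k (\<lambda>ws. ws[i := ldif A (ws ! i)])"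
  unfolding ldif_def by (rule multilinear_op_update[OF letter_linear_dif])

lemma multilinear_op_lmul: "Suc i < k \<Longrightarrow> multilinear_op A k (k - 1) (lmul_at (lmul A) i)"
  by (rule multilinear_op_lmul_at)
    (auto simp: letter_linear_def lmul_def mul_hom mul_add_left mul_add_right mul_scl_left
        mul_scl_right)

lemma chain_op_delta: "chain_op A 1 (delta A i)"
proof (rule chain_op_sgI)
  fix s :: bool and k :: nat assume "0 < k"
  show "(\<forall>ws. length ws = k \<longrightarrow> delta A i (list_word s ws) = 0) \<or>
    (\<exists>s' l f e. 0 < l \<and> multilinear_op A k l f \<and> (\<forall>ws. length ws = k \<longrightarrow>
      delta A i (list_word s ws) = sg (e (map fst ws)) (Poly_Mapping.single (list_word s' (f ws))
          1) \<and>
      lpar (f ws) + (if s' then 1 else 0) = lpar ws + (if s then 1 else 0) + 1))"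
  proof (cases s)
    case True
    show ?thesis
    proof (cases "i < k")
      case i: True
      show ?thesis
        by (rule disjI2, intro exI[of _ True] exI[of _ k] exI[of _ "\<lambda>ws. ws[i := ldif A (ws ! i)]"]
            exI[of _ "\<lambda>ps. \<Sum>p\<leftarrow>take i ps. p + 1"])
          (use True i in \<open>simp add: multilinear_op_ldif delta_list_word_True lpar_take_eq
              lpar_update_ldif bit_ac\<close>)
    qed (use True \<open>0 < k\<close> in \<open>simp add: delta_beyond deg_list_word\<close>)
  next
    case False
    show ?thesis
    proof (cases "i = 0 \<or> k < i")
      case True
      then show ?thesis using False
        by (intro disjI1 allI impI) (auto simp: deg_list_word delta_0_list_word_False delta_beyond
            simp del: list_word.simps)
    next
      case i: False
      then obtain j where j: "i = Suc j" "j < k" by (cases i) auto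
      show ?thesis
        by (rule disjI2, intro exI[of _ False] exI[of _ k] exI[of _ "\<lambda>ws. ws[j := ldif A (ws ! j)]"]
            exI[of _ "\<lambda>ps. (\<Sum>p\<leftarrow>take j ps. p + 1) + 1"])
          (use False j in \<open>simp add: multilinear_op_ldif delta_list_word_False lpar_take_eq
              lpar_update_ldif bit_ac del: list_word.simps\<close>)
    qed
  qed
qed

lemma chain_op_mu: "chain_op A 1 (mu A i)"
proof (rule chain_op_sgI)
  fix s :: bool and k :: nat assume k: "0 < k"
  let ?C = "(\<forall>ws. length ws = k \<longrightarrow> mu A i (list_word s ws) = 0) \<or>
    (\<exists>s' l f e. 0 < l \<and> multilinear_op A k l f \<and> (\<forall>ws. length ws = k \<longrightarrow>
      mu A i (list_word s ws) = sg (e (map fst ws)) (Poly_Mapping.single (list_word s' (f ws)) 1) \<and>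
      lpar (f ws) + (if s' then 1 else 0) = lpar ws + (if s then 1 else 0) + 1))"
  have fst_lmul: "fst (lmul A x y) = fst x + fst y" for x y by (simp add: lmul_def)
  show ?C
  proof (cases s)
    case s: True
    consider "k = 1 \<or> k \<le> i" | "Suc i < k" | "1 < k" "k = Suc i" using k by linarith
    then show ?thesis
    proof cases
      case 1
      then show ?thesis using s k by (intro disjI1) (auto simp: deg_list_word intro!: mu_beyond)
    next
      case 2
      show ?thesis
        by (rule disjI2, intro exI[of _ True] exI[of _ "k - 1"] exI[of _ "lmul_at (lmul A) i"]
            exI[of _ "\<lambda>ps. (\<Sum>p\<leftarrow>take (Suc i) ps. p + 1) + 1"])
          (use s 2 in \<open>simp add: multilinear_op_lmul mu_list_word_True lpar_take_eq lpar_lmul_at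
              fst_lmul bit_ac del: One_nat_def\<close>)
    next
      case 3
      \<comment> \<open>The last face is a rotation followed by the product in slot 0, so it is
        multilinear as a composite.\<close>
      show ?thesis
      proof (rule disjI2, intro exI[of _ True] exI[of _ "k - 1"] exI[of _ "\<lambda>ws. lmul_at (lmul A) 0
          (rot ws)"]
          exI[of _ "\<lambda>ps. (last ps + 1) * (\<Sum>p\<leftarrow>butlast ps. p + 1) + last ps"] conjI allI impI)
        show "multilinear_op A k (k - 1) (\<lambda>ws. lmul_at (lmul A) 0 (rot ws))"
          by (rule multilinear_op_comp[OF multilinear_op_rot multilinear_op_lmul]) (use 3 in simp)
        fix ws :: "'a letter list" assume ws: "length ws = k"
        obtain x zs where 1: "ws = x # zs" using ws 3 by (cases ws) auto
        moreover obtain xs y where "zs = xs @ [y]" using ws 3 1 by (cases zs rule: rev_cases) auto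
        ultimately have *: "ws = x # xs @ [y]" "i = Suc (length xs)" using ws 3 by auto
        show "mu A i (list_word s ws) = sg ((last (map fst ws) + 1) * (\<Sum>p\<leftarrow>butlast (map fst ws). p
            + 1) + last (map fst ws))
            (Poly_Mapping.single (list_word True (lmul_at (lmul A) 0 (rot ws))) 1)"
          using s unfolding * by (simp add: mu_list_word_True_last lpar_eq rot_def lmul_at_def
              butlast_append comp_def del: list_word.simps)
        show "lpar (lmul_at (lmul A) 0 (rot ws)) + (if True then 1 else 0) = lpar ws + (if s then
            1 else 0) + 1"
          using s unfolding * by (subst lpar_lmul_at) (simp_all add: lpar_rot fst_lmul, simp_all
              add: rot_def bit_ac)
      qed (use 3 in simp)
    qed
  next
    case s: False
    consider "k < i" | "i = 0" | j where "i = Suc j" "Suc j < k" | j where "i = Suc j" "k = Suc j"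
      by (metis less_antisym linorder_neqE_nat not0_implies_Suc not_less_eq)
    then show ?thesis
    proof cases
      case 1
      then show ?thesis using s k by (intro disjI1) (auto simp: deg_def intro!: mu_beyond)
    next
      case 2
      \<comment> \<open>Since e a_1 = a_1, the list stays the same and only the flag
        changes.\<close>
      show ?thesis
        by (rule disjI2, intro exI[of _ True] exI[of _ k] exI[of _ "\<lambda>ws. ws"] exI[of _ "\<lambda>ps. 0"])
          (use s k 2 in \<open>auto simp add: multilinear_op_id mu_list_word_False_first sg_def bit_ac
              simp del: list_word.simps\<close>)
    next
      case 3
      show ?thesis
        by (rule disjI2, intro exI[of _ False] exI[of _ "k - 1"] exI[of _ "lmul_at (lmul A) j"]
            exI[of _ "\<lambda>ps. (\<Sum>p\<leftarrow>take (Suc j) ps. p + 1)"])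
          (use s 3 in \<open>simp add: multilinear_op_lmul mu_list_word_False_middle lpar_take_eq
              lpar_lmul_at fst_lmul bit_ac del: One_nat_def list_word.simps\<close>)
    next
      case 4
      \<comment> \<open>Since a_n e = a_n, the last letter becomes the leading one, which is a plain
        rotation of the list.\<close>
      show ?thesis
      proof (rule disjI2, intro exI[of _ True] exI[of _ k] exI[of _ rot]
          exI[of _ "\<lambda>ps. (last ps + 1) * (\<Sum>p\<leftarrow>butlast ps. p + 1) + 1"] conjI allI impI)
        fix ws :: "'a letter list" assume ws: "length ws = k"
        then obtain xs y where *: "ws = xs @ [y]" "i = Suc (length xs)" using 4 by (cases ws rule:
            rev_cases) auto
        show "mu A i (list_word s ws) = sg ((last (map fst ws) + 1) * (\<Sum>p\<leftarrow>butlast (map fst ws). p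
            + 1) + 1)
            (Poly_Mapping.single (list_word True (rot ws)) 1)"
          using s unfolding * by (simp add: mu_list_word_False_last lpar_eq rot_def comp_def del:
              list_word.simps)
        show "lpar (rot ws) + (if True then 1 else 0) = lpar ws + (if s then 1 else 0) + 1"
          using s * by (simp add: lpar_rot)
      qed (use k multilinear_op_rot in auto)
    qed
  qed
qed

lemma chain_op_tau: "chain_op A 0 tau"
proof (rule chain_op_sgI)
  fix s :: bool and k :: nat assume k: "0 < k"
  show "(\<forall>ws. length ws = k \<longrightarrow> tau (list_word s ws) = (0 :: ('k, 'a) chain)) \<or>
    (\<exists>s' l f e. 0 < l \<and> multilinear_op A k l f \<and> (\<forall>ws. length ws = k \<longrightarrow>
      tau (list_word s ws) = sg (e (map fst ws)) (Poly_Mapping.single (list_word s' (f ws)) (1 ::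
          'k)) \<and>
      lpar (f ws) + (if s' then 1 else 0) = lpar ws + (if s then 1 else 0) + 0))"
  proof (cases s)
    case True
    have "tau (list_word True ws) = sg ((hd (map fst ws) + 1) * (\<Sum>p\<leftarrow>tl (map fst ws). p + 1))
        (Poly_Mapping.single (list_word True (rotate1 ws)) (1 :: 'k))"
      if "length ws = k" for ws :: "'a letter list"
      using that k by (cases ws) (simp_all add: tau_list_word_True lpar_eq comp_def del:
          list_word.simps)
    with True show ?thesis
      by (intro disjI2 exI[of _ True] exI[of _ k] exI[of _ rotate1]
          exI[of _ "\<lambda>ps. (hd ps + 1) * (\<Sum>p\<leftarrow>tl ps. p + 1)"])
        (use k in \<open>simp add: multilinear_op_rotate1 lpar_rotate1\<close>)
  qed (simp add: tau_list_word_False del: list_word.simps)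
qed

lemma chain_op_tau_inv: "chain_op A 0 tau_inv"
proof (rule chain_op_sgI)
  fix s :: bool and k :: nat assume k: "0 < k"
  show "(\<forall>ws. length ws = k \<longrightarrow> tau_inv (list_word s ws) = (0 :: ('k, 'a) chain)) \<or>
    (\<exists>s' l f e. 0 < l \<and> multilinear_op A k l f \<and> (\<forall>ws. length ws = k \<longrightarrow>
      tau_inv (list_word s ws) = sg (e (map fst ws)) (Poly_Mapping.single (list_word s' (f ws)) (1
          :: 'k)) \<and>
      lpar (f ws) + (if s' then 1 else 0) = lpar ws + (if s then 1 else 0) + 0))"
  proof (cases s)
    case True
    have "tau_inv (list_word True ws) = sg ((last (map fst ws) + 1) * (\<Sum>p\<leftarrow>butlast (map fst ws). p
        + 1)) (Poly_Mapping.single (list_word True (rot ws)) (1 :: 'k))"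
      if "length ws = k" for ws :: "'a letter list"
      using that k by (cases ws rule: rev_cases) (simp_all add: tau_inv_list_word_True lpar_eq
          comp_def rot_def del: list_word.simps)
    with True show ?thesis
      by (intro disjI2 exI[of _ True] exI[of _ k] exI[of _ rot]
          exI[of _ "\<lambda>ps. (last ps + 1) * (\<Sum>p\<leftarrow>butlast ps. p + 1)"])
        (use k in \<open>auto simp add: multilinear_op_rot intro: lpar_rot\<close>)
  qed (simp add: tau_inv_list_word_False del: list_word.simps)
qed

lemma chain_op_he: "chain_op A 1 he"
proof (rule chain_op_sgI)
  fix s :: bool and k :: nat assume k: "0 < k"
  show "(\<forall>ws. length ws = k \<longrightarrow> he (list_word s ws) = (0 :: ('k, 'a) chain)) \<or>
    (\<exists>s' l f e. 0 < l \<and> multilinear_op A k l f \<and> (\<forall>ws. length ws = k \<longrightarrow>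
      he (list_word s ws) = sg (e (map fst ws)) (Poly_Mapping.single (list_word s' (f ws)) (1 ::
          'k)) \<and>
      lpar (f ws) + (if s' then 1 else 0) = lpar ws + (if s then 1 else 0) + 1))"
  proof (cases s)
    case True
    then show ?thesis
      by (intro disjI2 exI[of _ False] exI[of _ k] exI[of _ "\<lambda>ws. ws"] exI[of _ "\<lambda>ps. 0"])
        (use k in \<open>auto simp add: multilinear_op_id he_list_word_True sg_def bit_ac simp del:
            list_word.simps\<close>)
  qed (simp add: he_list_word_False del: list_word.simps)
qed

lemma chain_op_phi: "chain_op A 0 phi_word"
proof (rule chain_op_sgI)
  fix s :: bool and k :: nat assume k: "0 < k"
  show "(\<forall>ws. length ws = k \<longrightarrow> phi_word (list_word s ws) = (0 :: ('k, 'a) chain)) \<or>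
    (\<exists>s' l f e. 0 < l \<and> multilinear_op A k l f \<and> (\<forall>ws. length ws = k \<longrightarrow>
      phi_word (list_word s ws) = sg (e (map fst ws)) (Poly_Mapping.single (list_word s' (f ws))
          (1 :: 'k)) \<and>
      lpar (f ws) + (if s' then 1 else 0) = lpar ws + (if s then 1 else 0) + 0))"
  proof (cases s)
    case True
    \<comment> \<open>Reversing all letters but the first is moving the first to the end and then
      reversing everything.\<close>
    have "phi_word (list_word True ws) = sg (phi_par (tl (map fst ws))) (Poly_Mapping.single
        (list_word True (rev (rotate1 ws))) (1 :: 'k))"
      if "length ws = k" for ws :: "'a letter list"
      using that k by (cases ws) (simp_all add: phi_list_word_True del: list_word.simps)
    with True show ?thesis
      by (intro disjI2 exI[of _ True] exI[of _ k] exI[of _ "\<lambda>ws. rev (rotate1 ws)"]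
          exI[of _ "\<lambda>ps. phi_par (tl ps)"])
        (use k in \<open>simp add: multilinear_op_comp[OF multilinear_op_rotate1 multilinear_op_rev]
            lpar_rotate1\<close>)
  next
    case False
    then show ?thesis
      by (intro disjI2 exI[of _ False] exI[of _ k] exI[of _ rev] exI[of _ phi_par])
        (use k in \<open>simp add: multilinear_op_rev phi_list_word_False del: list_word.simps\<close>)
  qed
qed

end

section \<open>Relations between the elementary operators\<close>

definition word_class :: "('k::field, 'a::ab_group_add) dga \<Rightarrow> bool \<Rightarrow> 'a letter list \<Rightarrow> ('k, 'a)
    chain" where
  "word_class A s ws = nf A (Poly_Mapping.single (list_word s ws) 1)"

definition word_space :: "('k::field, 'a::ab_group_add) dga \<Rightarrow> bool \<Rightarrow> nat \<Rightarrow> ('k, 'a) chain set" where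
  "word_space A s n = chain.span {word_class A s ws | ws. ws \<noteq> [] \<and> valid A ws \<and> length ws = n}"

lemma sg_sg [simp]: "sg p (sg q x) = sg (p + q) x"
  by (simp add: sg_def sgn_par_add)

lemma sg_0 [simp]: "sg 0 x = x"
  by (simp add: sg_def)

lemma sg_linear: "sg p (x + y) = sg p x + sg p y" "sg p (csmult c x) = csmult c (sg p x)" "sg p 0
    = 0"
  "sg p (- x) = - sg p x" "sg p (x - y) = sg p x - sg p y"
  by (simp_all add: sg_def chain.scale_right_distrib chain.scale_right_diff_distrib mult.commute)

lemma sg_uminus: "- sg p x = sg (p + 1) x"
  by (simp add: sg_def sgn_par_add)

lemma op_on_sg: "op_on A t (sg p x) = sg p (op_on A t x)" and nf_sg: "nf A (sg p x) = sg p (nf A x)"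
  by (simp_all add: sg_def op_on.scale nf.scale)

lemmas op_on_linear = op_on.add op_on.scale op_on.zero op_on.neg op_on.diff

lemma word_space_induct [consumes 1, case_names zero word_class add scale]:
  assumes "x \<in> word_space A s n"
    and "P 0" "\<And>ws. ws \<noteq> [] \<Longrightarrow> valid A ws \<Longrightarrow> length ws = n \<Longrightarrow> P (word_class A s ws)"
    and "\<And>x y. P x \<Longrightarrow> P y \<Longrightarrow> P (x + y)" "\<And>c x. P x \<Longrightarrow> P (csmult c x)"
  shows "P x"
  using assms(1) unfolding word_space_def
proof (induction rule: chain.span_induct_alt)
  case (step c y z)
  then have "P y" using assms(3) by blast
  with assms(4,5) step show ?case by blast
qed (rule assms(2))

lemma subspace_word_space: "chain.subspace (word_space A s n)"
  unfolding word_space_def by (rule chain.subspace_span)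

lemmas word_space_closed = chain.subspace_0[OF subspace_word_space] chain.subspace_add[OF
    subspace_word_space]
  chain.subspace_diff[OF subspace_word_space] chain.subspace_neg[OF subspace_word_space]
  chain.subspace_scale[OF subspace_word_space] chain.subspace_sum[OF subspace_word_space]

lemma word_class_in_word_space: "valid A ws \<Longrightarrow> ws \<noteq> [] \<Longrightarrow> length ws = n \<Longrightarrow> word_class A s ws \<in>
    word_space A s n"
  unfolding word_space_def by (rule chain.span_base) blast

lemma sg_in_word_space: "x \<in> word_space A s n \<Longrightarrow> sg p x \<in> word_space A s n"
  by (simp add: sg_def word_space_closed)

lemma nf_diff_in_tensor_rel: "nf A x - x \<in> tensor_rel A"
  by (simp flip: nf_eq_iff)

text \<open>\<open>nf A x\<close> and \<open>x\<close> differ by a relation, which a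
  \<open>chain_op\<close> preserves. This is what allows induced operators to be composed on
  arbitrary representatives.\<close>

lemma op_on_nf: "chain_op A q t \<Longrightarrow> op_on A t (nf A x) = op_on A t x"
  using nf_diff_in_tensor_rel[of A x] by (simp add: chain_op_def op_on_def nf_eq_iff flip:
      lin_ext.diff)

lemma op_on_word_class: "chain_op A q t \<Longrightarrow> op_on A t (word_class A s ws) = nf A (t (list_word s ws))"
  unfolding word_class_def by (simp add: op_on_nf) (simp add: op_on_def)

lemma op_on_lin_ext: "chain_op A q s \<Longrightarrow> op_on A (\<lambda>w. lin_ext s (t w)) x = op_on A s (op_on A t x)"
  by (simp add: op_on_def[of A t] op_on_nf) (simp add: op_on_def lin_ext_lin_ext)

lemma op_on_fun_0: "op_on A (\<lambda>w. 0) x = 0"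
  and op_on_fun_add: "op_on A (\<lambda>w. s w + t w) x = op_on A s x + op_on A t x"
  and op_on_fun_scale: "op_on A (\<lambda>w. csmult c (t w)) x = csmult c (op_on A t x)"
  and op_on_fun_uminus: "op_on A (\<lambda>w. - t w) x = - op_on A t x"
  by (simp_all add: op_on_def lin_ext_fun_add lin_ext_fun_scale lin_ext_fun_uminus nf.add nf.scale
      nf.neg nf.zero)

lemma op_on_fun_sum: "op_on A (\<lambda>w. \<Sum>i\<in>I. t i w) x = (\<Sum>i\<in>I. op_on A (t i) x)"
  by (simp add: op_on_def lin_ext_fun_sum nf.sum)

lemma op_on_word_space_cong:
  assumes "x \<in> word_space A s n" "chain_op A q t" "chain_op A q' t'"
    and "\<And>ws. ws \<noteq> [] \<Longrightarrow> valid A ws \<Longrightarrow> length ws = n \<Longrightarrow> t (list_word s ws) = t' (list_word s ws)"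
  shows "op_on A t x = op_on A t' x"
  using assms(1)
  by (induction rule: word_space_induct) (simp_all add: op_on_linear op_on_word_class[OF assms(2)]
      op_on_word_class[OF assms(3)] assms(4))

context dg_algebra
begin

lemma word_class_add:
  assumes "valid A ys" "valid A zs" "a \<in> hom A p" "b \<in> hom A p"
  shows "word_class A s (ys @ (p, a + b) # zs) = word_class A s (ys @ (p, a) # zs) + word_class A
      s (ys @ (p, b) # zs)"
  using tensor_rel_add[OF assms, of s] unfolding nf_eq_0_iff[symmetric] nf.diff
  by (simp add: word_class_def algebra_simps)

lemma word_class_scl:
  assumes "valid A ys" "valid A zs" "a \<in> hom A p"
  shows "word_class A s (ys @ (p, scl A c a) # zs) = csmult c (word_class A s (ys @ (p, a) # zs))"
  using tensor_rel_scale[OF assms, of s c] unfolding nf_eq_0_iff[symmetric] nf.diff nf.scale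
  by (simp add: word_class_def)

lemma word_class_zero: "valid A ys \<Longrightarrow> valid A zs \<Longrightarrow> word_class A s (ys @ (p, 0) # zs) = 0"
  using word_class_scl[of ys zs 0 p s 0] hom_closed(1) by simp

definition delta_op :: "nat \<Rightarrow> ('k, 'a) chain \<Rightarrow> ('k, 'a) chain" where "delta_op i = op_on A (delta
    A i)"
definition mu_op :: "nat \<Rightarrow> ('k, 'a) chain \<Rightarrow> ('k, 'a) chain" where "mu_op i = op_on A (mu A i)"
definition tau_inv_op :: "('k, 'a) chain \<Rightarrow> ('k, 'a) chain" where "tau_inv_op = op_on A tau_inv"
definition tau_op :: "('k, 'a) chain \<Rightarrow> ('k, 'a) chain" where "tau_op = op_on A tau"
definition he_op :: "('k, 'a) chain \<Rightarrow> ('k, 'a) chain" where "he_op = op_on A he"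

lemmas op_defs = delta_op_def mu_op_def tau_inv_op_def tau_op_def he_op_def

lemma op_linear:
  "delta_op i (x + y) = delta_op i x + delta_op i y" "delta_op i (csmult c x) = csmult c (delta_op
      i x)" "delta_op i 0 = 0" "delta_op i (sg p x) = sg p (delta_op i x)"
  "mu_op i (x + y) = mu_op i x + mu_op i y" "mu_op i (csmult c x) = csmult c (mu_op i x)" "mu_op i
      0 = 0" "mu_op i (sg p x) = sg p (mu_op i x)"
  "tau_inv_op (x + y) = tau_inv_op x + tau_inv_op y" "tau_inv_op (csmult c x) = csmult c
      (tau_inv_op x)" "tau_inv_op 0 = 0" "tau_inv_op (sg p x) = sg p (tau_inv_op x)"
  "tau_op (x + y) = tau_op x + tau_op y" "tau_op (csmult c x) = csmult c (tau_op x)" "tau_op 0 =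
      0" "tau_op (sg p x) = sg p (tau_op x)"
  "he_op (x + y) = he_op x + he_op y" "he_op (csmult c x) = csmult c (he_op x)" "he_op 0 = 0"
      "he_op (sg p x) = sg p (he_op x)"
  by (simp_all add: op_defs op_on_linear op_on_sg)

lemma delta_op_word_class:
  "i = length ys \<Longrightarrow> delta_op i (word_class A True (ys @ x # zs)) = sg (lpar ys) (word_class A True
      (ys @ ldif A x # zs))"
  unfolding delta_op_def op_on_word_class[OF chain_op_delta]
  by (subst delta_list_word_True) (simp_all add: nf_sg word_class_def)

lemma mu_op_word_class:
  "i = length ys \<Longrightarrow> mu_op i (word_class A True (ys @ x # y # zs)) = sg (lpar ys + fst x)
      (word_class A True (ys @ lmul A x y # zs))"
  unfolding mu_op_def op_on_word_class[OF chain_op_mu]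
  by (subst mu_list_word_True) (simp_all add: nf_sg word_class_def lmul_at_def nth_append bit_ac)

lemma tau_inv_op_word_class: "tau_inv_op (word_class A True (xs @ [x])) = sg ((fst x + 1) * lpar
    xs) (word_class A True (x # xs))"
  unfolding tau_inv_op_def op_on_word_class[OF chain_op_tau_inv] tau_inv_list_word_True by (simp
      add: nf_sg word_class_def)

lemma tau_op_word_class: "tau_op (word_class A True (x # xs)) = sg ((fst x + 1) * lpar xs)
    (word_class A True (xs @ [x]))"
  unfolding tau_op_def op_on_word_class[OF chain_op_tau] tau_list_word_True by (simp add: nf_sg
      word_class_def)

lemma he_op_word_class: "ws \<noteq> [] \<Longrightarrow> he_op (word_class A True ws) = word_class A False ws"
  unfolding he_op_def op_on_word_class[OF chain_op_he] by (simp add: he_list_word_True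
      word_class_def)

lemma tau_op_tau_inv_op: "x \<in> word_space A True n \<Longrightarrow> tau_op (tau_inv_op x) = x"
proof (induction rule: word_space_induct)
  case (word_class ws)
  then obtain xs x where "ws = xs @ [x]" by (cases ws rule: rev_cases) auto
  then show ?case by (simp add: tau_inv_op_word_class tau_op_word_class op_linear)
qed (simp_all add: op_linear)

lemma ldif_valid: "snd x \<in> hom A (fst x) \<Longrightarrow> snd (ldif A x) \<in> hom A (fst x + 1)"
  and lmul_valid: "snd x \<in> hom A (fst x) \<Longrightarrow> snd y \<in> hom A (fst y) \<Longrightarrow> snd (lmul A x y) \<in> hom A (fst x
      + fst y)"
  by (simp_all add: ldif_def lmul_def dif_hom mul_hom)

lemma fst_ldif [simp]: "fst (ldif A x) = fst x + 1" and fst_lmul [simp]: "fst (lmul A x y) = fst x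
    + fst y"
  by (simp_all add: ldif_def lmul_def)

lemma lmul_assoc: "lmul A (lmul A x y) z = lmul A x (lmul A y z)"
  by (simp add: lmul_def mul_assoc add.assoc)

section \<open>The simplicial relations on classes of words\<close>

lemma split_at:
  assumes "i < length ws"
  obtains ys x zs where "ws = ys @ x # zs" "length ys = i"
  using assms by (metis id_take_nth_drop length_take min.absorb4)

lemma delta_op_closed:
  assumes "x \<in> word_space A True n" "i < n" shows "delta_op i x \<in> word_space A True n"
  using assms(1)
proof (induction rule: word_space_induct)
  case (word_class ws)
  then obtain ys x zs where "ws = ys @ x # zs" "length ys = i"
    using split_at[of i ws] assms(2) by metis
  with word_class show ?case by (simp add: delta_op_word_class sg_in_word_space
      word_class_in_word_space ldif_valid)
qed (simp_all add: op_linear word_space_closed)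

lemma split_at2:
  assumes "Suc i < length ws"
  obtains ys x y zs where "ws = ys @ x # y # zs" "length ys = i"
proof -
  obtain ys x zs where 1: "ws = ys @ x # zs" "length ys = i" using split_at[of i ws] assms by auto
  then obtain y zs' where "zs = y # zs'" using assms by (cases zs) auto
  with 1 that show thesis by blast
qed

lemma mu_op_closed:
  assumes "x \<in> word_space A True (Suc n)" "i < n" shows "mu_op i x \<in> word_space A True n"
  using assms(1)
proof (induction rule: word_space_induct)
  case (word_class ws)
  then obtain ys x y zs where "ws = ys @ x # y # zs" "length ys = i"
    by (metis Suc_mono assms(2) split_at2)
  with word_class show ?case by (simp add: mu_op_word_class sg_in_word_space
      word_class_in_word_space lmul_valid)
qed (simp_all add: op_linear word_space_closed)

lemma tau_inv_op_closed: "x \<in> word_space A True n \<Longrightarrow> tau_inv_op x \<in> word_space A True n"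
proof (induction rule: word_space_induct)
  case (word_class ws)
  then obtain xs x where "ws = xs @ [x]" by (cases ws rule: rev_cases) auto
  with word_class show ?case by (simp add: tau_inv_op_word_class sg_in_word_space
      word_class_in_word_space)
qed (simp_all add: op_linear word_space_closed)

text \<open>A statement about classes only: the word obtained contains the letter 0, which is a
  nonzero basis vector of the free space.\<close>

lemma delta_op_delta_op_same:
  assumes "x \<in> word_space A True n" "i < n" shows "delta_op i (delta_op i x) = 0"
  using assms(1)
proof (induction rule: word_space_induct)
  case (word_class ws)
  then obtain ys x zs where *: "ws = ys @ x # zs" "length ys = i"
    using split_at[of i ws] assms(2) by metis
  have "ldif A (ldif A x) = (fst x, 0)" by (simp add: ldif_def dif_dif add.assoc)
  with word_class * show ?case by (simp add: delta_op_word_class op_linear word_class_zero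
      sg_linear)
qed (simp_all add: op_linear)

lemma split_at_at:
  assumes "i < j" "j < length ws"
  obtains ys x zs y vs where "ws = ys @ x # zs @ y # vs" "length ys = i" "length ys + 1 + length
      zs = j"
proof -
  obtain ys' y vs where 1: "ws = ys' @ y # vs" "length ys' = j" using split_at[of j ws] assms by
      auto
  then obtain ys x zs where 2: "ys' = ys @ x # zs" "length ys = i" using split_at[of i ys'] assms
      by auto
  show thesis by (rule that[of ys x zs y vs]) (use 1 2 in auto)
qed

lemma delta_op_delta_op:
  assumes "x \<in> word_space A True n" "i < j" "j < n" shows "delta_op i (delta_op j x) = - delta_op
      j (delta_op i x)"
  using assms(1)
proof (induction rule: word_space_induct)
  case (word_class ws)
  then obtain ys x zs y vs where *: "ws = ys @ x # zs @ y # vs" "length ys = i" "length ys + 1 +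
      length zs = j"
    using split_at_at[of i j ws] assms by metis
  show ?case unfolding *(1) using *(2,3)
    delta_op_word_class[of j "ys @ x # zs" y vs] delta_op_word_class[of j "ys @ ldif A x # zs" y vs]
    delta_op_word_class[of i ys x "zs @ y # vs"] delta_op_word_class[of i ys x "zs @ ldif A y # vs"]
    by (simp add: op_linear sg_uminus bit_ac)
qed (simp_all add: op_linear)

lemma delta_op_mu_op_less:
  assumes "x \<in> word_space A True (Suc n)" "i < j" "j < n" shows "delta_op i (mu_op j x) = - mu_op
      j (delta_op i x)"
  using assms(1)
proof (induction rule: word_space_induct)
  case (word_class ws)
  then obtain ys x zs y vs' where *: "ws = ys @ x # zs @ y # vs'" "length ys = i" "length ys + 1 +
      length zs = j"
    using split_at_at[of i j ws] assms by (metis less_SucI)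
  then obtain z vs where vs: "vs' = z # vs" using word_class assms by (cases vs') auto
  show ?case unfolding * vs using *(2,3)
    mu_op_word_class[of j "ys @ x # zs" y z vs] mu_op_word_class[of j "ys @ ldif A x # zs" y z vs]
    delta_op_word_class[of i ys x "zs @ y # z # vs"] delta_op_word_class[of i ys x "zs @ lmul A y
        z # vs"]
    by (simp add: op_linear sg_uminus bit_ac)
qed (simp_all add: op_linear)

lemma delta_op_mu_op_greater:
  assumes "x \<in> word_space A True (Suc n)" "j < i" "i < n" shows "delta_op i (mu_op j x) = - mu_op
      j (delta_op (Suc i) x)"
  using assms(1)
proof (induction rule: word_space_induct)
  case (word_class ws)
  then obtain ys x zs' y vs where *: "ws = ys @ x # zs' @ y # vs" "length ys = j" "length ys + 1 +
      length zs' = Suc i"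
    using split_at_at[of j "Suc i" ws] assms by (metis Suc_mono less_SucI)
  then obtain z zs where zs: "zs' = z # zs" using word_class assms by (cases zs') auto
  show ?case unfolding *(1) zs using *(2,3)
    delta_op_word_class[of "Suc i" "ys @ x # z # zs" y vs] delta_op_word_class[of i "ys @ lmul A x
        z # zs" y vs]
    mu_op_word_class[of j ys x z "zs @ y # vs"] mu_op_word_class[of j ys x z "zs @ ldif A y # vs"]
    by (simp add: zs op_linear sg_uminus bit_ac)
qed (simp_all add: op_linear)

text \<open>The Leibniz rule enters here. A sum inside one letter becomes a sum of words only modulo
  \<open>tensor_rel\<close>.\<close>

lemma word_class_ldif_lmul:
  assumes v: "valid A (ys @ x # y # zs)"
  shows "word_class A s (ys @ ldif A (lmul A x y) # zs) =
    word_class A s (ys @ lmul A (ldif A x) y # zs) + sg (fst x) (word_class A s (ys @ lmul A x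
        (ldif A y) # zs))"
proof -
  obtain p a where x: "x = (p, a)" by (cases x)
  obtain q b where y: "y = (q, b)" by (cases y)
  have ab: "a \<in> hom A p" "b \<in> hom A q" using v x y by auto
  have 1: "mul A (dif A a) b \<in> hom A (p + q + 1)"
    using mul_hom[OF dif_hom[OF ab(1)] ab(2)] by (simp add: ac_simps)
  have 2: "mul A a (dif A b) \<in> hom A (p + q + 1)"
    using mul_hom[OF ab(1) dif_hom[OF ab(2)]] by (simp add: ac_simps)
  have "ldif A (lmul A x y) = (p + q + 1, mul A (dif A a) b + scl A (sgn_par p) (mul A a (dif A
      b)))"
    using leibniz[OF ab(1), of b] by (simp add: x y ldif_def lmul_def)
  moreover have "lmul A (ldif A x) y = (p + q + 1, mul A (dif A a) b)"
    "lmul A x (ldif A y) = (p + q + 1, mul A a (dif A b))"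
    by (simp_all add: x y ldif_def lmul_def ac_simps)
  ultimately show ?thesis
    using v word_class_add[OF _ _ 1 hom_closed(3)[OF 2]] word_class_scl[OF _ _ 2] x
    by (simp add: sg_def)
qed

lemma delta_op_mu_op_same:
  assumes "x \<in> word_space A True (Suc n)" "i < n" shows "delta_op i (mu_op i x) = - mu_op i
      (delta_op i x + delta_op (Suc i) x)"
  using assms(1)
proof (induction rule: word_space_induct)
  case (word_class ws)
  then have "Suc i < length ws" using assms(2) by simp
  then obtain ys x y zs where *: "ws = ys @ x # y # zs" "length ys = i"
    by (rule split_at2)
  have v: "valid A (ys @ x # y # zs)" using word_class * by simp
  show ?case unfolding *(1) using *(2)
    delta_op_word_class[of i ys x "y # zs"] delta_op_word_class[of "Suc i" "ys @ [x]" y zs]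
    mu_op_word_class[of i ys x y zs] mu_op_word_class[of i ys "ldif A x" y zs] mu_op_word_class[of
        i ys x "ldif A y" zs]
    delta_op_word_class[of i ys "lmul A x y" zs]
    by (simp add: op_linear sg_linear sg_uminus word_class_ldif_lmul[OF v] bit_ac minus_add)
qed (simp_all add: op_linear chain.scale_right_diff_distrib)

lemma mu_op_mu_op:
  assumes "x \<in> word_space A True (Suc (Suc n))" "i \<le> j" "j < n" shows "mu_op j (mu_op i x) = -
      mu_op i (mu_op (Suc j) x)"
  using assms(1)
proof (induction rule: word_space_induct)
  case (word_class ws)
  \<comment> \<open>For i = j the two products overlap and associativity is needed; otherwise they
    are disjoint and only the sign has to be compared.\<close>
  show ?case
  proof (cases "i = j")
    case True
    have "Suc i < length ws" using assms(2,3) word_class by simp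
    then obtain ys x y zs' where *: "ws = ys @ x # y # zs'" "length ys = i"
      by (rule split_at2)
    then obtain z zs where zs: "zs' = z # zs" using word_class assms True by (cases zs') auto
    show ?thesis unfolding *(1) zs True[symmetric] using *(2)
      mu_op_word_class[of i ys x y "z # zs"] mu_op_word_class[of i ys "lmul A x y" z zs]
      mu_op_word_class[of "Suc i" "ys @ [x]" y z zs] mu_op_word_class[of i ys x "lmul A y z" zs]
      by (simp add: op_linear sg_uminus lmul_assoc bit_ac)
  next
    case False
    then obtain ys x zs' u vs' where *: "ws = ys @ x # zs' @ u # vs'" "length ys = i" "length ys +
        1 + length zs' = Suc j"
      using split_at_at[of i "Suc j" ws] assms word_class by (metis less_Suc_eq_le less_SucI
          Suc_mono)
    then obtain y zs where zs: "zs' = y # zs" using word_class assms False by (cases zs') auto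
    obtain v vs where vs: "vs' = v # vs" using * word_class assms False by (cases vs') auto
    show ?thesis unfolding *(1) zs vs using *(2,3)
      mu_op_word_class[of i ys x y "zs @ u # v # vs"] mu_op_word_class[of j "ys @ lmul A x y # zs"
          u v vs]
      mu_op_word_class[of "Suc j" "ys @ x # y # zs" u v vs] mu_op_word_class[of i ys x y "zs @
          lmul A u v # vs"]
      by (simp add: zs op_linear sg_uminus bit_ac)
  qed
qed (simp_all add: op_linear)

lemma tau_inv_op_delta_op:
  assumes "x \<in> word_space A True n" "Suc i < n" shows "tau_inv_op (delta_op i x) = delta_op (Suc
      i) (tau_inv_op x)"
  using assms(1)
proof (induction rule: word_space_induct)
  case (word_class ws)
  then obtain ys x zs' where *: "ws = ys @ x # zs'" "length ys = i"
    using split_at[of i ws] assms(2) by (metis Suc_lessD)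
  then obtain zs z where zs: "zs' = zs @ [z]" using word_class assms by (cases zs' rule:
      rev_cases) auto
  show ?case unfolding *(1) zs using *(2)
    delta_op_word_class[of i ys x "zs @ [z]"] delta_op_word_class[of "Suc i" "z # ys" x zs]
    tau_inv_op_word_class[of "ys @ x # zs" z] tau_inv_op_word_class[of "ys @ ldif A x # zs" z]
    by (simp add: op_linear bit_ring)
qed (simp_all add: op_linear)

lemma tau_inv_op_delta_op_last:
  assumes "x \<in> word_space A True (Suc n)" shows "tau_inv_op (delta_op n x) = delta_op 0
      (tau_inv_op x)"
  using assms(1)
proof (induction rule: word_space_induct)
  case (word_class ws)
  then obtain xs x where "ws = xs @ [x]" "length xs = n" by (cases ws rule: rev_cases) auto
  then show ?case using tau_inv_op_word_class[of xs x] tau_inv_op_word_class[of xs "ldif A x"]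
      delta_op_word_class[of n xs x "[]"] delta_op_word_class[of 0 "[]" x xs]
    by (simp add: op_linear bit_ring)
qed (simp_all add: op_linear)

lemma tau_inv_op_mu_op:
  assumes "x \<in> word_space A True (Suc n)" "Suc i < n" shows "tau_inv_op (mu_op i x) = mu_op (Suc
      i) (tau_inv_op x)"
  using assms(1)
proof (induction rule: word_space_induct)
  case (word_class ws)
  then have "Suc i < length ws" using assms(2) by simp
  then obtain ys x y zs' where *: "ws = ys @ x # y # zs'" "length ys = i"
    by (rule split_at2)
  then obtain zs z where zs: "zs' = zs @ [z]" using word_class assms by (cases zs' rule:
      rev_cases) auto
  show ?case unfolding *(1) zs using *(2)
    mu_op_word_class[of i ys x y "zs @ [z]"] mu_op_word_class[of "Suc i" "z # ys" x y zs]
    tau_inv_op_word_class[of "ys @ x # y # zs" z] tau_inv_op_word_class[of "ys @ lmul A x y # zs" z]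
    by (simp add: op_linear bit_ring)
qed (simp_all add: op_linear)

lemma tau_inv_op_mu_op_last:
  assumes "x \<in> word_space A True (Suc (Suc n))" shows "tau_inv_op (mu_op n x) = mu_op 0
      (tau_inv_op (tau_inv_op x))"
  using assms(1)
proof (induction rule: word_space_induct)
  case (word_class ws)
  then obtain xs y where 1: "ws = xs @ [y]" "length xs = Suc n" by (cases ws rule: rev_cases) auto
  then obtain ys x where "xs = ys @ [x]" by (cases xs rule: rev_cases) auto
  with 1 have *: "ws = ys @ [x, y]" "length ys = n" by auto
  show ?case unfolding *(1) using *(2)
    mu_op_word_class[of n ys x y "[]"] tau_inv_op_word_class[of "ys @ [x]" y]
        tau_inv_op_word_class[of "y # ys" x] tau_inv_op_word_class[of ys "lmul A x y"]
    mu_op_word_class[of 0 "[]" x y ys]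
    by (simp add: op_linear bit_ring)
qed (simp_all add: op_linear)

lemma op_pow_linear:
  "(tau_inv_op ^^ k) (x + y) = (tau_inv_op ^^ k) x + (tau_inv_op ^^ k) y" "(tau_inv_op ^^ k)
      (csmult c x) = csmult c ((tau_inv_op ^^ k) x)"
  "(tau_inv_op ^^ k) 0 = 0" "(tau_inv_op ^^ k) (sg p x) = sg p ((tau_inv_op ^^ k) x)"
  "(tau_op ^^ k) (x + y) = (tau_op ^^ k) x + (tau_op ^^ k) y" "(tau_op ^^ k) (csmult c x) = csmult
      c ((tau_op ^^ k) x)"
  "(tau_op ^^ k) 0 = 0" "(tau_op ^^ k) (sg p x) = sg p ((tau_op ^^ k) x)"
  by (induction k) (simp_all add: op_linear)

text \<open>Splitting the list makes the induction work. For empty \<open>xs\<close> the sign is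
  trivial and every letter has gone round once.\<close>

lemma tau_inv_op_pow_word_class:
  "(tau_inv_op ^^ length ys) (word_class A True (xs @ ys)) = sg (lpar xs * lpar ys) (word_class A
      True (ys @ xs))"
proof (induction ys arbitrary: xs rule: rev_induct)
  case (snoc y ys)
  have "(tau_inv_op ^^ length (ys @ [y])) (word_class A True (xs @ ys @ [y])) = (tau_inv_op ^^
      length ys) (tau_inv_op (word_class A True ((xs @ ys) @ [y])))"
    by (simp add: funpow_swap1)
  also have "\<dots> = sg (lpar xs * lpar (ys @ [y])) (word_class A True ((ys @ [y]) @ xs))"
    using snoc[of "y # xs"] unfolding tau_inv_op_word_class by (simp add: op_pow_linear bit_ring)
  finally show ?case .
qed simp

lemma tau_inv_op_cyclic: "x \<in> word_space A True n \<Longrightarrow> (tau_inv_op ^^ n) x = x"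
proof (induction rule: word_space_induct)
  case (word_class ws)
  then show ?case using tau_inv_op_pow_word_class[of ws "[]"] by simp
qed (simp_all add: op_pow_linear)

text \<open>Makes the abstract identities available on C(A), with the rotation \<open>t\<close>
  taken to be the inverse of tau; C^+(A) is reached from there through \<open>he_op\<close>.\<close>

sublocale cyc: cyclic_dg_module "word_space A True" delta_op mu_op tau_inv_op
  by standard
    (fact word_space_closed delta_op_closed mu_op_closed tau_inv_op_closed delta_op_delta_op_same
        delta_op_delta_op delta_op_mu_op_less delta_op_mu_op_same delta_op_mu_op_greater mu_op_mu_op
      tau_inv_op_delta_op tau_inv_op_delta_op_last tau_inv_op_mu_op tau_inv_op_mu_op_last
          tau_inv_op_cyclic op_linear)+


section \<open>Values of the operators in a fixed degree\<close>

lemma he_op_closed: "x \<in> word_space A True n \<Longrightarrow> he_op x \<in> word_space A False n"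
  by (induction rule: word_space_induct) (simp_all add: op_linear word_space_closed
      he_op_word_class word_class_in_word_space)

text \<open>Here \<open>k\<close> counts letters: a_0 does not contribute to the degree in C(A),
  whereas in C^+(A) every letter does.\<close>

lemma op_on_deg:
  assumes "\<And>n. chain_op A q (t n)" "x \<in> word_space A s k" "k = (if s then Suc d else d)"
  shows "op_on A (\<lambda>w. t (deg w) w) x = op_on A (t d) x"
  by (rule op_on_word_space_cong[OF assms(2) chain_op_deg[OF assms(1)] assms(1)[of d]])
    (use assms(3) in \<open>simp add: deg_list_word split: if_splits\<close>)

lemma chain_op_tau_pow: "chain_op A q t \<Longrightarrow> chain_op A q (\<lambda>w. tau_pow j (t w))"
proof (induction j)
  case (Suc j)
  from chain_op_lin_ext[OF chain_op_tau Suc.IH[OF Suc.prems], of q] show ?case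
    by (simp add: tau_pow_def)
qed (simp add: tau_pow_def)

lemma op_on_tau_pow:
  "op_on A (\<lambda>w. tau_pow j (t w)) x = (tau_op ^^ j) (op_on A t x)"
proof (induction j)
  case (Suc j)
  have "op_on A (\<lambda>w. tau_pow (Suc j) (t w)) x = op_on A (\<lambda>w. lin_ext tau (tau_pow j (t w))) x"
    by (simp add: tau_pow_def)
  then show ?case using Suc by (simp add: op_on_lin_ext[OF chain_op_tau] tau_op_def)
qed (simp add: tau_pow_def)

lemma op_on_single: "x \<in> word_space A s n \<Longrightarrow> op_on A (\<lambda>w. Poly_Mapping.single w 1) x = x"
  by (induction rule: word_space_induct) (simp_all add: op_on_linear op_on_word_class[OF
      chain_op_single], simp add: word_class_def)

lemma chain_op_be: "chain_op A 1 (\<lambda>w. (\<Sum>i\<le>n. delta A i w) + (\<Sum>i\<le>n. mu A i w))"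
  by (intro chain_op_add chain_op_sum chain_op_delta chain_op_mu)

lemma be_deg:
  "x \<in> word_space A s k \<Longrightarrow> k = (if s then Suc d else d) \<Longrightarrow> be A x = (\<Sum>i\<le>d. delta_op i x) + (\<Sum>i\<le>d.
      mu_op i x)"
  unfolding be_def
  by (subst op_on_deg[where t = "\<lambda>n w. (\<Sum>i\<le>n. delta A i w) + (\<Sum>i\<le>n. mu A i w)", OF chain_op_be])
    (simp_all add: op_on_fun_add op_on_fun_sum delta_op_def mu_op_def)

lemma chain_op_Be: "chain_op A 1 (\<lambda>w. lin_ext he (\<Sum>i\<le>n. tau_pow i (Poly_Mapping.single w 1)))"
  by (rule chain_op_lin_ext[OF chain_op_he chain_op_sum[OF chain_op_tau_pow[OF chain_op_single]]])
      simp

lemma Be_deg: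
  "x \<in> word_space A s k \<Longrightarrow> k = (if s then Suc d else d) \<Longrightarrow> Be A x = he_op (\<Sum>i\<le>d. (tau_op ^^ i) x)"
  unfolding Be_def
  by (subst op_on_deg[where t = "\<lambda>n w. lin_ext he (\<Sum>i\<le>n. tau_pow i (Poly_Mapping.single w 1))", OF
      chain_op_Be])
    (simp_all add: op_on_lin_ext[OF chain_op_he] op_on_fun_sum op_on_tau_pow op_on_single he_op_def)

lemma Gamma_deg:
  assumes "x \<in> word_space A s k" "k = (if s then Suc d else d)"
  shows "Gamma A x = csmult (- (of_nat d / 2)) x"
proof -
  have "Gamma A = op_on A (\<lambda>w. csmult (- (of_nat (deg w) / 2)) (Poly_Mapping.single w 1))"
    by (simp add: Gamma_def)
  then show ?thesis
    using op_on_deg[OF chain_op_scale[OF chain_op_single] assms, of "\<lambda>n. - (of_nat n / 2)"] assms(1)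
    by (simp only: op_on_fun_scale op_on_single)
qed

lemma chain_op_U: "chain_op A 0 (\<lambda>w. if n = 0 then 0 else csmult (1 / 2) (- lin_ext (mu A 0)
    (delta A 1 w)))"
  using chain_op_scale[OF chain_op_uminus[OF chain_op_lin_ext[OF chain_op_mu chain_op_delta]], of
      0 "1/2" 0 1]
  by (cases "n = 0") (simp_all add: chain_op_0)

lemma U_deg:
  "x \<in> word_space A s k \<Longrightarrow> k = (if s then Suc d else d) \<Longrightarrow>
    U_op A x = (if d = 0 then 0 else csmult (1 / 2) (- mu_op 0 (delta_op 1 x)))"
  unfolding U_op_def
  by (subst op_on_deg[where t = "\<lambda>n w. if n = 0 then 0 else csmult (1 / 2) (- lin_ext (mu A 0)
      (delta A 1 w))", OF chain_op_U])
    (cases "d = 0"; simp add: op_on_fun_0 op_on_fun_scale op_on_fun_uminus op_on_lin_ext[OF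
        chain_op_mu] mu_op_def delta_op_def)+

lemma chain_op_U_dual: "chain_op A 0 (\<lambda>w. if n = 0 then 0 else csmult (1 / 2) (lin_ext (mu A n)
    (delta A n w)))"
  using chain_op_scale[OF chain_op_lin_ext[OF chain_op_mu chain_op_delta], of 0 "1/2" n n]
  by (cases "n = 0") (simp_all add: chain_op_0)

lemma U_dual_deg:
  "x \<in> word_space A s k \<Longrightarrow> k = (if s then Suc d else d) \<Longrightarrow>
    U_op_dual A x = (if d = 0 then 0 else csmult (1 / 2) (mu_op d (delta_op d x)))"
  unfolding U_op_dual_def
  by (subst op_on_deg[where t = "\<lambda>n w. if n = 0 then 0 else csmult (1 / 2) (lin_ext (mu A n)
      (delta A n w))", OF chain_op_U_dual])
    (cases "d = 0"; simp add: op_on_fun_0 op_on_fun_scale op_on_lin_ext[OF chain_op_mu] mu_op_def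
        delta_op_def)+

lemma chain_op_V: "chain_op A 0 (\<lambda>w. csmult (1 / 2)
    (- lin_ext he (\<Sum>i=1..n. \<Sum>j=i+1..n+1. tau_pow j (delta A i w))))"
  by (intro chain_op_scale chain_op_uminus chain_op_lin_ext[OF chain_op_he chain_op_sum[OF
      chain_op_sum[OF chain_op_tau_pow[OF chain_op_delta]]]]) simp

lemma V_deg:
  "x \<in> word_space A s k \<Longrightarrow> k = (if s then Suc d else d) \<Longrightarrow>
    V_op A x = csmult (1 / 2) (- he_op (\<Sum>i=1..d. \<Sum>j=i+1..d+1. (tau_op ^^ j) (delta_op i x)))"
  unfolding V_op_def
  by (subst op_on_deg[where t = "\<lambda>n w. csmult (1 / 2) (- lin_ext he (\<Sum>i=1..n. \<Sum>j=i+1..n+1. tau_pow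
      j (delta A i w)))", OF chain_op_V])
    (assumption | simp only: op_on_fun_scale op_on_fun_uminus op_on_lin_ext[OF chain_op_he]
        op_on_fun_sum op_on_tau_pow he_op_def delta_op_def)+

lemma chain_op_V_dual: "chain_op A 0 (\<lambda>w. csmult (1 / 2)
    (lin_ext he (\<Sum>i=1..n. \<Sum>j=1..i. tau_pow j (delta A i w))))"
  by (intro chain_op_scale chain_op_lin_ext[OF chain_op_he chain_op_sum[OF chain_op_sum[OF
      chain_op_tau_pow[OF chain_op_delta]]]]) simp

lemma V_dual_deg:
  "x \<in> word_space A s k \<Longrightarrow> k = (if s then Suc d else d) \<Longrightarrow>
    V_op_dual A x = csmult (1 / 2) (he_op (\<Sum>i=1..d. \<Sum>j=1..i. (tau_op ^^ j) (delta_op i x)))"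
  unfolding V_op_dual_def
  by (subst op_on_deg[where t = "\<lambda>n w. csmult (1 / 2) (lin_ext he (\<Sum>i=1..n. \<Sum>j=1..i. tau_pow j
      (delta A i w)))", OF chain_op_V_dual])
    (assumption | simp only: op_on_fun_scale op_on_lin_ext[OF chain_op_he] op_on_fun_sum
        op_on_tau_pow he_op_def delta_op_def)+

section \<open>The elementary operators after \<open>he_op\<close>\<close>

lemma delta_op_he_op_0: "x \<in> word_space A True n \<Longrightarrow> delta_op 0 (he_op x) = 0"
  by (induction rule: word_space_induct)
    (simp_all add: op_linear he_op_word_class, simp add: delta_op_def op_on_word_class[OF
        chain_op_delta] delta_0_list_word_False nf.zero del: list_word.simps)

lemma delta_op_he_op_Suc:
  assumes "x \<in> word_space A True n" "i < n" shows "delta_op (Suc i) (he_op x) = - he_op (delta_op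
      i x)"
  using assms(1)
proof (induction rule: word_space_induct)
  case (word_class ws)
  with assms(2) show ?case
    by (simp add: he_op_word_class delta_op_def op_on_word_class[OF chain_op_delta]
        delta_list_word_False delta_list_word_True nf_sg word_class_def[symmetric]
        op_on_sg del: list_word.simps)
      (simp add: he_op_def[symmetric] op_linear he_op_word_class sg_uminus)
qed (simp_all add: op_linear)

lemma mu_op_he_op_0: "x \<in> word_space A True n \<Longrightarrow> mu_op 0 (he_op x) = x"
proof (induction rule: word_space_induct)
  case (word_class ws)
  then show ?case
    by (simp add: he_op_word_class mu_op_def op_on_word_class[OF chain_op_mu]
        mu_list_word_False_first word_class_def[symmetric] del: list_word.simps)
qed (simp_all add: op_linear)

lemma mu_op_he_op_Suc:
  assumes "x \<in> word_space A True (Suc n)" "i < n" shows "mu_op (Suc i) (he_op x) = - he_op (mu_op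
      i x)"
  using assms(1)
proof (induction rule: word_space_induct)
  case (word_class ws)
  with assms(2) show ?case
    by (simp add: he_op_word_class mu_op_def op_on_word_class[OF chain_op_mu]
        mu_list_word_False_middle mu_list_word_True nf_sg word_class_def[symmetric]
        op_on_sg del: list_word.simps)
      (simp add: he_op_def[symmetric] op_linear he_op_word_class sg_uminus lmul_at_def bit_ac)
qed (simp_all add: op_linear)

text \<open>Since a_n e = a_n, this face only brings the last letter to the front. Together with
  \<open>mu_op_he_op_0\<close> it yields the entry 1 - t of b^e.\<close>

lemma mu_op_he_op_last:
  assumes "x \<in> word_space A True (Suc n)" shows "mu_op (Suc n) (he_op x) = - tau_inv_op x"
  using assms
proof (induction rule: word_space_induct)
  case (word_class ws)
  then obtain xs y where "ws = xs @ [y]" "length xs = n" by (cases ws rule: rev_cases) auto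
  moreover have "mu_op (Suc (length xs)) (word_class A False (xs @ [y])) = sg ((fst y + 1) * lpar
      xs + 1) (word_class A True (y # xs))"
    unfolding mu_op_def op_on_word_class[OF chain_op_mu] mu_list_word_False_last nf_sg by (simp
        only: word_class_def)
  ultimately show ?case
    by (simp add: he_op_word_class tau_inv_op_word_class sg_uminus)
qed (simp_all add: op_linear)

lemma mu_op_last:
  assumes "x \<in> word_space A True (Suc n)" "0 < n" shows "mu_op n x = mu_op 0 (tau_inv_op x)"
  using assms(1)
proof (induction rule: word_space_induct)
  case (word_class ws)
  then obtain xs y where ws: "ws = xs @ [y]" "length xs = n" by (cases ws rule: rev_cases) auto
  then obtain x zs where xs: "xs = x # zs" "n = Suc (length zs)" using assms by (cases xs) auto
  have "mu_op n (word_class A True (x # zs @ [y])) = sg ((fst y + 1) * lpar (x # zs) + fst y)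
      (word_class A True (lmul A y x # zs))"
    unfolding mu_op_def op_on_word_class[OF chain_op_mu] xs(2) mu_list_word_True_last nf_sg by
        (simp only: word_class_def)
  then show ?case unfolding ws xs using tau_inv_op_word_class[of "x # zs" y] mu_op_word_class[of 0
      "[]" y x zs]
    by (simp add: op_linear xs)
qed (simp_all add: op_linear)

lemma mu_op_0_zero: "x \<in> word_space A True (Suc 0) \<Longrightarrow> mu_op 0 x = 0"
proof (induction rule: word_space_induct)
  case (word_class ws)
  then have "deg (list_word True ws) = 0" by (simp add: deg_list_word)
  then show ?case by (simp add: mu_op_def op_on_word_class[OF chain_op_mu] mu_beyond nf.zero)
qed (simp_all add: op_linear)

lemma tau_op_he_op: "x \<in> word_space A True n \<Longrightarrow> tau_op (he_op x) = 0"
  by (induction rule: word_space_induct)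
    (simp_all add: op_linear he_op_word_class, simp add: tau_op_def op_on_word_class[OF
        chain_op_tau] tau_list_word_False nf.zero del: list_word.simps)

lemma he_op_he_op: "x \<in> word_space A True n \<Longrightarrow> he_op (he_op x) = 0"
  by (induction rule: word_space_induct)
    (simp_all add: op_linear he_op_word_class, simp add: he_op_def op_on_word_class[OF
        chain_op_he] he_list_word_False nf.zero del: list_word.simps)

sublocale tau_op: additive tau_op by standard (rule op_linear)
sublocale he_op: additive he_op by standard (rule op_linear)
sublocale taup: additive "tau_op ^^ j" for j by standard (rule op_pow_linear)

lemma tau_op_closed: "x \<in> word_space A True n \<Longrightarrow> tau_op x \<in> word_space A True n"
proof (induction rule: word_space_induct)
  case (word_class ws)
  then obtain xs x where "ws = x # xs" by (cases ws) auto
  with word_class show ?case by (simp add: tau_op_word_class sg_in_word_space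
      word_class_in_word_space)
qed (simp_all add: op_linear word_space_closed)

lemma tau_op_pow_he_op: "x \<in> word_space A True n \<Longrightarrow> 0 < j \<Longrightarrow> (tau_op ^^ j) (he_op x) = 0"
  by (cases j) (simp_all add: funpow_swap1 tau_op_he_op op_pow_linear)

lemma tau_op_pow:
  assumes "x \<in> word_space A True n" "j \<le> n" shows "(tau_op ^^ j) x = (tau_inv_op ^^ (n - j)) x"
  using assms(2)
proof (induction j)
  case 0
  then show ?case using assms(1) by (simp add: tau_inv_op_cyclic)
next
  case (Suc j)
  then have *: "n - j = Suc (n - Suc j)" by simp
  have "(tau_op ^^ Suc j) x = tau_op (tau_inv_op ((tau_inv_op ^^ (n - Suc j)) x))"
    using Suc unfolding * by simp
  also have "\<dots> = (tau_inv_op ^^ (n - Suc j)) x"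
    by (rule tau_op_tau_inv_op[OF cyc.tp_closed[OF assms(1)]])
  finally show ?case .
qed

section \<open>Matrix entries in terms of the cyclic calculus\<close>

lemma be_C: "x \<in> word_space A True (Suc n) \<Longrightarrow> be A x = cyc.D n x + cyc.M n x"
proof -
  assume x: "x \<in> word_space A True (Suc n)"
  have "(\<Sum>i\<le>n. mu_op i x) = cyc.M n x"
  proof (cases n)
    case 0
    then show ?thesis using mu_op_0_zero x by simp
  next
    case (Suc k)
    then show ?thesis using mu_op_last[OF x]
      by (simp add: cyc.M_eq cyc.M'_def lessThan_Suc_atMost[symmetric] del: sum.lessThan_Suc)
        (simp only: sum.lessThan_Suc[of _ "Suc k"])
  qed
  then show ?thesis using be_deg[OF x, of n] by (simp add: cyc.D_def lessThan_Suc_atMost)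
qed

lemma be_he_op:
  assumes x: "x \<in> word_space A True (Suc n)"
  shows "be A (he_op x) = x - tau_inv_op x - he_op (cyc.D n x) - he_op (cyc.M' n x)"
proof -
  have "(\<Sum>i\<le>Suc n. delta_op i (he_op x)) = delta_op 0 (he_op x) + (\<Sum>i\<le>n. delta_op (Suc i) (he_op
      x))"
    by (rule sum.atMost_Suc_shift)
  also have "(\<Sum>i\<le>n. delta_op (Suc i) (he_op x)) = (\<Sum>i\<le>n. - he_op (delta_op i x))"
    by (rule sum.cong) (simp_all add: delta_op_he_op_Suc[OF x])
  finally have 1: "(\<Sum>i\<le>Suc n. delta_op i (he_op x)) = - he_op (cyc.D n x)"
    by (simp only: cyc.D_def lessThan_Suc_atMost he_op.sum sum_negf delta_op_he_op_0[OF x]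
        add_0_left)
  have "(\<Sum>i\<le>Suc n. mu_op i (he_op x)) = mu_op 0 (he_op x) + (\<Sum>i<Suc n. mu_op (Suc i) (he_op x))"
    unfolding lessThan_Suc_atMost by (rule sum.atMost_Suc_shift)
  also have "(\<Sum>i<Suc n. mu_op (Suc i) (he_op x)) = (\<Sum>i<n. mu_op (Suc i) (he_op x)) + mu_op (Suc n)
      (he_op x)"
    by simp
  also have "(\<Sum>i<n. mu_op (Suc i) (he_op x)) = (\<Sum>i<n. - he_op (mu_op i x))"
    by (rule sum.cong) (simp_all add: mu_op_he_op_Suc[OF x])
  finally have 2: "(\<Sum>i\<le>Suc n. mu_op i (he_op x)) = x - he_op (cyc.M' n x) - tau_inv_op x"
    by (simp add: cyc.M'_def he_op.sum sum_negf mu_op_he_op_0[OF x] mu_op_he_op_last[OF x])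
  show ?thesis using be_deg[OF he_op_closed[OF x], of "Suc n"] unfolding 1 2 by simp
qed

lemma Be_C:
  assumes x: "x \<in> word_space A True (Suc n)"
  shows "Be A x = he_op (cyc.N (Suc n) x)"
proof -
  \<comment> \<open>The powers of tau become powers of t with exponents 1, ..., n + 1; the surplus
    factor t is absorbed by the norm.\<close>
  have "(\<Sum>i\<le>n. (tau_op ^^ i) x) = (\<Sum>i\<le>n. (tau_inv_op ^^ (Suc n - i)) x)"
    by (rule sum.cong) (simp_all add: tau_op_pow[OF x])
  also have "\<dots> = (\<Sum>i<Suc n. (tau_inv_op ^^ Suc i) x)"
    by (rule sum.reindex_bij_witness[where i = "\<lambda>i. n - i" and j = "\<lambda>i. n - i"])
      (auto simp: Suc_diff_le simp del: funpow.simps)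
  also have "\<dots> = tau_inv_op (cyc.N (Suc n) x)"
    by (simp add: cyc.N_def cyc.t.sum cyc.t.add)
  also have "\<dots> = cyc.N (Suc n) x"
    by (rule cyc.t_N[OF x])
  finally show ?thesis using Be_deg[OF x, of n] by simp
qed

lemma Be_he_op: "x \<in> word_space A True n \<Longrightarrow> Be A (he_op x) = 0"
proof -
  assume x: "x \<in> word_space A True n"
  have "(\<Sum>i\<le>n. (tau_op ^^ i) (he_op x)) = he_op x"
    using tau_op_pow_he_op[OF x] by (simp add: sum.atMost_shift del: funpow.simps)
  then show ?thesis using Be_deg[OF he_op_closed[OF x], of n] he_op_he_op[OF x] by simp
qed

lemma U_C: "x \<in> word_space A True (Suc n) \<Longrightarrow> U_op A x = (if n = 0 then 0 else csmult (1 / 2) (-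
    mu_op 0 (delta_op 1 x)))"
  using U_deg[of x True] by simp

text \<open>After h^e the letter a_0 sits in slot 1: it is differentiated there, and the product
  with e brings it back in front. The minus sign of \<open>U_op\<close> cancels against that of
  moving d past h^e.\<close>

lemma U_he_op: "x \<in> word_space A True (Suc n) \<Longrightarrow> U_op A (he_op x) = csmult (1 / 2) (delta_op 0 x)"
proof -
  assume x: "x \<in> word_space A True (Suc n)"
  have "mu_op 0 (delta_op 1 (he_op x)) = - delta_op 0 x"
    using delta_op_he_op_Suc[OF x, of 0] mu_op_he_op_0[OF delta_op_closed[OF x, of 0]] by (simp
        add: cyc.m.minus)
  then show ?thesis using U_deg[OF he_op_closed[OF x], of "Suc n"] by simp
qed

text \<open>tau^j is t^(n+1-j), so the exponents of t run through 0, ..., n - i.\<close>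

lemma sum_tau_op_pow:
  assumes "x \<in> word_space A True (Suc n)" "i \<le> n"
  shows "(\<Sum>j=i+1..n+1. (tau_op ^^ j) x) = cyc.N (Suc n - i) x"
proof -
  have "(\<Sum>j=i+1..n+1. (tau_op ^^ j) x) = (\<Sum>j=i+1..n+1. (tau_inv_op ^^ (Suc n - j)) x)"
    by (rule sum.cong) (simp_all add: tau_op_pow[OF assms(1)])
  also have "\<dots> = (\<Sum>k<Suc n - i. (tau_inv_op ^^ k) x)"
    by (rule sum.reindex_bij_witness[where i = "\<lambda>k. Suc n - k" and j = "\<lambda>j. Suc n - j"]) (use
        assms(2) in auto)
  finally show ?thesis by (simp add: cyc.N_def)
qed

lemma V_C: "x \<in> word_space A True (Suc n) \<Longrightarrow> V_op A x = csmult (1 / 2) (- he_op (cyc.w n x))"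
proof -
  assume x: "x \<in> word_space A True (Suc n)"
  have "(\<Sum>i=1..n. \<Sum>j=i+1..n+1. (tau_op ^^ j) (delta_op i x)) = cyc.w n x"
    unfolding cyc.w_def
    by (rule sum.cong[OF refl], rule sum_tau_op_pow) (use delta_op_closed[OF x] in auto)
  then show ?thesis using V_deg[OF x, of n] by simp
qed

text \<open>All powers of tau in \<open>V_op\<close> have positive exponent, and tau is 0 on
  C^+(A).\<close>

lemma V_he_op: "x \<in> word_space A True n \<Longrightarrow> V_op A (he_op x) = 0"
proof -
  assume x: "x \<in> word_space A True n"
  have "(tau_op ^^ j) (delta_op i (he_op x)) = 0" if ij: "i \<in> {1..n}" "j \<in> {i+1..n+1}" for i j
  proof -
    obtain k where k: "i = Suc k" using ij by (cases i) auto
    then have "delta_op i (he_op x) = - he_op (delta_op k x)" using delta_op_he_op_Suc[OF x, of k]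
        ij by simp
    then show ?thesis using tau_op_pow_he_op[OF delta_op_closed[OF x, of k], of j] ij k by (simp
        add: taup.minus)
  qed
  then have "(\<Sum>i=1..n. \<Sum>j=i+1..n+1. (tau_op ^^ j) (delta_op i (he_op x))) = 0"
    by (intro sum.neutral ballI)
  then show ?thesis using V_deg[OF he_op_closed[OF x], of n] by (simp add: he_op.zero)
qed

lemma Gamma_C: "x \<in> word_space A True (Suc n) \<Longrightarrow> Gamma A x = - csmult (of_nat n / 2) x"
  using Gamma_deg[of x True] by simp

text \<open>Behind e all n letters count, one more than in C(A); this is the source of [Gamma, B] =
  - B / 2.\<close>

lemma Gamma_he_op: "x \<in> word_space A True n \<Longrightarrow> Gamma A (he_op x) = - csmult (of_nat n / 2) (he_op x)"
  using Gamma_deg[OF he_op_closed, of x n n] by simp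

end

section \<open>The connection\<close>

interpretation be: Vector_Spaces.linear csmult csmult "be A" for A
  unfolding be_def by (rule op_on.linear_axioms)
interpretation Be: Vector_Spaces.linear csmult csmult "Be A" for A
  unfolding Be_def by (rule op_on.linear_axioms)
interpretation U_op: Vector_Spaces.linear csmult csmult "U_op A" for A
  unfolding U_op_def by (rule op_on.linear_axioms)
interpretation V_op: Vector_Spaces.linear csmult csmult "V_op A" for A
  unfolding V_op_def by (rule op_on.linear_axioms)
interpretation Gamma: Vector_Spaces.linear csmult csmult "Gamma A" for A
  unfolding Gamma_def by (rule op_on.linear_axioms)
interpretation U_op_dual: Vector_Spaces.linear csmult csmult "U_op_dual A" for A
  unfolding U_op_dual_def by (rule op_on.linear_axioms)
interpretation V_op_dual: Vector_Spaces.linear csmult csmult "V_op_dual A" for A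
  unfolding V_op_dual_def by (rule op_on.linear_axioms)
interpretation Phi: Vector_Spaces.linear csmult csmult "Phi A" for A
  unfolding Phi_def by (rule op_on.linear_axioms)

lemmas be_linear = be.add be.diff be.neg be.zero be.scale
lemmas Be_linear = Be.add Be.diff Be.neg Be.zero Be.scale
lemmas U_linear = U_op.add U_op.diff U_op.neg U_op.zero U_op.scale
lemmas V_linear = V_op.add V_op.diff V_op.neg V_op.zero V_op.scale
lemmas Gamma_linear = Gamma.add Gamma.diff Gamma.neg Gamma.zero Gamma.scale
lemmas chain_linear = be_linear Be_linear U_linear V_linear Gamma_linear
lemmas csmult_linear = chain.scale_right_distrib chain.scale_right_diff_distrib
    chain.scale_minus_right
  chain.scale_minus_left chain.scale_left_distrib

section \<open>The graded space of chains\<close>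

lemma Ce_eq: "Ce A p = nf A ` wspan A p"
  by (simp add: Ce_def wspan_def)

lemma subspace_Ce: "chain.subspace (Ce A p)"
  unfolding Ce_eq by (rule nf.subspace_image[OF subspace_wspan])

lemma op_on_Ce: "chain_op A q t \<Longrightarrow> x \<in> Ce A p \<Longrightarrow> op_on A t x \<in> Ce A (p + q)"
  unfolding Ce_eq by (auto simp: op_on_nf) (auto simp: op_on_def intro: chain_op_wspan)

lemma subspace_total_space: "chain.subspace (total_space (Ce A))"
proof -
  have "total_space (Ce A) = {x + y | x y. x \<in> Ce A 0 \<and> y \<in> Ce A 1}" by (simp add: total_space_def)
  then show ?thesis using chain.subspace_sums[OF subspace_Ce subspace_Ce, of A 0 A 1] by simp
qed

lemma Ce_subset_total_space: "x \<in> Ce A p \<Longrightarrow> x \<in> total_space (Ce A)"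
  unfolding total_space_def
  by (cases p) (use chain.subspace_0[OF subspace_Ce] in \<open>force intro: exI[of _ 0]\<close>)+

lemmas total_space_closed = chain.subspace_0[OF subspace_total_space] chain.subspace_add[OF
    subspace_total_space]
  chain.subspace_diff[OF subspace_total_space] chain.subspace_neg[OF subspace_total_space]
  chain.subspace_scale[OF subspace_total_space]

lemma op_on_total_space: "chain_op A q t \<Longrightarrow> x \<in> total_space (Ce A) \<Longrightarrow> op_on A t x \<in> total_space (Ce
    A)"
proof -
  assume t: "chain_op A q t" and "x \<in> total_space (Ce A)"
  then obtain y z where "x = y + z" "y \<in> Ce A 0" "z \<in> Ce A 1" by (auto simp: total_space_def)
  then show ?thesis
    using op_on_Ce[OF t, THEN Ce_subset_total_space] by (simp add: op_on.add total_space_closed)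
qed

lemma linear_op_on_total_space: "chain_op A q t \<Longrightarrow> linear_op_on csmult (total_space (Ce A)) (op_on
    A t)"
  by (simp add: linear_op_on_def op_on_total_space op_on_linear)

section \<open>Laurent series with coefficients in chains\<close>

lemma laurent_upow: "f \<in> laurent S \<Longrightarrow> upow k f \<in> laurent S"
proof -
  assume "f \<in> laurent S"
  then obtain M where "\<And>m. f m \<in> S" "\<And>m. m < M \<Longrightarrow> f m = 0" by (auto simp: laurent_def)
  then show ?thesis by (auto simp: laurent_def upow_def intro!: exI[of _ "M + k"])
qed

lemma laurent_map:
  "f \<in> laurent S \<Longrightarrow> (\<And>x. x \<in> S \<Longrightarrow> T x \<in> S') \<Longrightarrow> T 0 = 0 \<Longrightarrow> (\<lambda>m. T (f m)) \<in> laurent S'"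
  unfolding laurent_def by (auto) metis

lemma laurent_add:
  "chain.subspace S \<Longrightarrow> f \<in> laurent S \<Longrightarrow> g \<in> laurent S \<Longrightarrow> (\<lambda>m. f m + g m) \<in> laurent S"
proof -
  assume S: "chain.subspace S" and "f \<in> laurent S" "g \<in> laurent S"
  then obtain M M' where "\<And>m. f m \<in> S" "\<And>m. g m \<in> S" "\<And>m. m < M \<Longrightarrow> f m = 0" "\<And>m. m < M' \<Longrightarrow> g m = 0"
    by (auto simp: laurent_def)
  then show ?thesis
    by (auto simp: laurent_def intro!: exI[of _ "min M M'"] chain.subspace_add[OF S])
qed

lemma laurent_ddu:
  assumes "chain.subspace S" "f \<in> laurent S"
  shows "ddu csmult f \<in> laurent S"
proof -
  obtain M where "\<And>m. f m \<in> S" "\<And>m. m < M \<Longrightarrow> f m = 0" using assms(2) by (auto simp: laurent_def)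
  then show ?thesis using assms(1)
    by (auto simp: laurent_def ddu_def intro!: exI[of _ "M - 1"] chain.subspace_scale)
qed

lemma fls_scale_eq:
  assumes "finite I" "\<And>i. fls_nth s i \<noteq> 0 \<Longrightarrow> f (m - i) \<noteq> 0 \<Longrightarrow> i \<in> I"
  shows "fls_scale csmult s f m = (\<Sum>i\<in>I. csmult (fls_nth s i) (f (m - i)))"
  unfolding fls_scale_def by (rule sum.mono_neutral_left) (use assms in auto)

lemma fls_scale_upow: "fls_scale csmult s (upow k f) = upow k (fls_scale csmult s f)"
  by (auto simp: fls_scale_def upow_def fun_eq_iff algebra_simps intro!: sum.cong)

lemma laurent_fls_finite:
  assumes "f \<in> laurent S"
  obtains I :: "int set" where "finite I" "\<And>i. fls_nth s i \<noteq> 0 \<Longrightarrow> f (m - i) \<noteq> 0 \<Longrightarrow> i \<in> I"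
proof -
  obtain M where M: "\<And>m. m < M \<Longrightarrow> f m = 0" using assms by (auto simp: laurent_def)
  show thesis
  proof (rule that[of "{fls_subdegree s..m - M}"])
    fix i assume "fls_nth s i \<noteq> 0" "f (m - i) \<noteq> 0"
    then have "\<not> i < fls_subdegree s" "\<not> m - i < M" using fls_eq0_below_subdegree M by blast+
    then show "i \<in> {fls_subdegree s..m - M}" by auto
  qed simp
qed

lemma fls_scale_map:
  assumes "f \<in> laurent S" "Vector_Spaces.linear csmult csmult T"
  shows "fls_scale csmult s (\<lambda>m. T (f m)) = (\<lambda>m. T (fls_scale csmult s f m))"
proof
  interpret T: Vector_Spaces.linear csmult csmult T by (rule assms(2))
  fix m
  obtain I where I: "finite I" "\<And>i. fls_nth s i \<noteq> 0 \<Longrightarrow> f (m - i) \<noteq> 0 \<Longrightarrow> i \<in> I"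
    using laurent_fls_finite[OF assms(1)] by metis
  have "i \<in> I" if "fls_nth s i \<noteq> 0" "T (f (m - i)) \<noteq> 0" for i
    using I(2) that by (cases "f (m - i) = 0") (auto simp: T.zero)
  then show "fls_scale csmult s (\<lambda>m. T (f m)) m = T (fls_scale csmult s f m)"
    by (simp add: fls_scale_eq[OF I] fls_scale_eq[OF I(1), of s "\<lambda>m. T (f m)"] T.sum T.scale)
qed

lemma fls_scale_add:
  assumes "f \<in> laurent S" "g \<in> laurent S"
  shows "fls_scale csmult s (\<lambda>m. f m + g m) = (\<lambda>m. fls_scale csmult s f m + fls_scale csmult s g m)"
proof
  fix m
  obtain I where I: "finite I" "\<And>i. fls_nth s i \<noteq> 0 \<Longrightarrow> f (m - i) \<noteq> 0 \<Longrightarrow> i \<in> I"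
    using laurent_fls_finite[OF assms(1)] by metis
  obtain J where J: "finite J" "\<And>i. fls_nth s i \<noteq> 0 \<Longrightarrow> g (m - i) \<noteq> 0 \<Longrightarrow> i \<in> J"
    using laurent_fls_finite[OF assms(2)] by metis
  have "fls_scale csmult s h m = (\<Sum>i\<in>I \<union> J. csmult (fls_nth s i) (h (m - i)))"
    if "h \<in> {f, g, \<lambda>m. f m + g m}" for h
    using that I J by (intro fls_scale_eq) force+
  then show "fls_scale csmult s (\<lambda>m. f m + g m) m = fls_scale csmult s f m + fls_scale csmult s g m"
    by (simp add: chain.scale_right_distrib sum.distrib)
qed

text \<open>The linear part of the connection, i.e. the witness required by
  \<open>u_connection\<close>.\<close>

definition conn_form :: "('k::field, 'a::ab_group_add) dga \<Rightarrow> (int \<Rightarrow> ('k, 'a) chain) \<Rightarrow> int \<Rightarrow> ('k,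
    'a) chain" where
  "conn_form A f = (\<lambda>m. upow (- 2) (\<lambda>j. U_op A (f j)) m + upow (- 1) (\<lambda>j. V_op A (f j) + Gamma A
      (f j)) m)"

lemma nabla_eq: "nabla A f = (\<lambda>m. ddu csmult f m + conn_form A f m)"
  by (simp add: nabla_def conn_form_def add.assoc)

context dg_algebra
begin

lemma chain_op_ops:
  "chain_op A 1 (\<lambda>w. (\<Sum>i\<le>deg w. delta A i w) + (\<Sum>i\<le>deg w. mu A i w))"
  "chain_op A 1 (\<lambda>w. lin_ext he (\<Sum>i\<le>deg w. tau_pow i (Poly_Mapping.single w 1)))"
  "chain_op A 0 (\<lambda>w. if deg w = 0 then 0 else csmult (1 / 2) (- lin_ext (mu A 0) (delta A 1 w)))"
  "chain_op A 0 (\<lambda>w. csmult (1 / 2) (- lin_ext he (\<Sum>i=1..deg w. \<Sum>j=i+1..deg w+1. tau_pow j (delta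
      A i w))))"
  "chain_op A 0 (\<lambda>w. Poly_Mapping.single w (- (of_nat (deg w) / 2)))"
  "chain_op A 0 (\<lambda>w. if deg w = 0 then 0 else csmult (1 / 2) (lin_ext (mu A (deg w)) (delta A (deg
      w) w)))"
  "chain_op A 0 (\<lambda>w. csmult (1 / 2) (lin_ext he (\<Sum>i=1..deg w. \<Sum>j=1..i. tau_pow j (delta A i w))))"
  using chain_op_deg[OF chain_op_be] chain_op_deg[OF chain_op_Be] chain_op_deg[OF chain_op_U]
      chain_op_deg[OF chain_op_V]
    chain_op_deg[OF chain_op_scale[OF chain_op_single], of "\<lambda>n. - (of_nat n / 2)"] chain_op_deg[OF
        chain_op_U_dual] chain_op_deg[OF chain_op_V_dual]
  by simp_all

text \<open>Every word class in C^+(A) is h^e of one in C(A), so an identity is verified on the two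
  columns of its matrix.\<close>

lemma total_space_induct [consumes 1, case_names zero add scale C he_op]:
  assumes "x \<in> total_space (Ce A)" "P 0" "\<And>x y. P x \<Longrightarrow> P y \<Longrightarrow> P (x + y)" "\<And>c x. P x \<Longrightarrow> P (csmult c x)"
    and C: "\<And>x n. x \<in> word_space A True (Suc n) \<Longrightarrow> P x" and he_op: "\<And>x n. x \<in> word_space A True
        (Suc n) \<Longrightarrow> P (he_op x)"
  shows "P x"
proof -
  have P: "P (nf A y)" if "y \<in> wspan A p" for y p
    using that unfolding wspan_def
  proof (induction rule: chain.span_induct_alt)
    case (step c v z)
    then obtain w where "v = Poly_Mapping.single w 1" "w \<in> words A" by blast
    then obtain s ws where v: "v = Poly_Mapping.single (list_word s ws) 1" "ws \<noteq> []" "valid A ws"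
      unfolding words_eq by blast
    then obtain n where n: "length ws = Suc n" by (cases ws) auto
    have "word_class A True ws \<in> word_space A True (Suc n)" using v n by (simp add:
        word_class_in_word_space)
    then have "P (word_class A s ws)" using C he_op v(2) by (cases s) (auto simp:
        he_op_word_class[symmetric])
    then show ?case using step assms(3,4) v(1) by (simp only: nf.add nf.scale word_class_def)
  qed (simp add: nf.zero assms)
  obtain y z where "x = nf A y + nf A z" "y \<in> wspan A 0" "z \<in> wspan A 1"
    using assms(1) by (auto simp: total_space_def Ce_eq)
  then show ?thesis using P assms(3) by blast
qed

text \<open>The projection onto even words depends only on letter parities, hence descends. It is
  the identity on \<open>Ce A 0\<close> and zero on \<open>Ce A 1\<close>, which separates the two
  in \<open>direct_Ce\<close>.\<close>

lemma chain_op_parity: "chain_op A 0 (\<lambda>w. if wpar w = 0 then Poly_Mapping.single w 1 else 0)"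
proof (rule chain_opI)
  fix s :: bool and k :: nat assume k: "0 < k"
  have "(if wpar (list_word s ws) = 0 then Poly_Mapping.single (list_word s ws) 1 else 0) =
      csmult (if (\<Sum>p\<leftarrow>map fst ws. p + 1) + (if s then 1 else 0) = 0 then 1 else 0)
        (Poly_Mapping.single (list_word s ws) (1 :: 'k))" if "length ws = k" for ws :: "'a letter
            list"
    using that k wpar_list_word[of ws s] by (auto simp: lpar_eq simp del: map_map)
  then show "\<exists>s' l f c. multilinear_op A k l f \<and> (\<forall>ws. valid A ws \<longrightarrow> length ws = k \<longrightarrow>
      (if wpar (list_word s ws) = 0 then Poly_Mapping.single (list_word s ws) 1 else 0) =
        csmult (c (map fst ws)) (Poly_Mapping.single (list_word s' (f ws)) (1 :: 'k)) \<and>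
      (c (map fst ws) \<noteq> 0 \<longrightarrow> 0 < l \<and> wpar (list_word s' (f ws)) = wpar (list_word s ws) + 0))"
    by (intro exI[of _ s] exI[of _ k] exI[of _ "\<lambda>ws. ws"]
        exI[of _ "\<lambda>ps. if (\<Sum>p\<leftarrow>ps. p + 1) + (if s then 1 else 0) = 0 then 1 else 0"])
      (use k multilinear_op_id in simp)
qed

lemma direct_Ce: "Ce A 0 \<inter> Ce A 1 = {0}"
proof -
  let ?t = "\<lambda>w. if wpar w = 0 then Poly_Mapping.single w 1 else 0"
  have 1: "lin_ext ?t x = (if p = 0 then x else 0)" if "x \<in> wspan A p" for x p
    using that unfolding wspan_def
    by (induction rule: chain.span_induct_alt) (auto simp: lin_ext.zero lin_ext.add lin_ext.scale)
  have t: "op_on A ?t x = (if p = 0 then x else 0)" if "x \<in> Ce A p" for x p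
    using that by (auto simp: Ce_eq op_on_nf[OF chain_op_parity] simp del: bit_not_zero_iff) (auto
        simp: op_on_def 1 nf.zero)
  have "x = 0" if "x \<in> Ce A 0 \<inter> Ce A 1" for x
    using that t[of x 0] t[of x 1] by simp
  moreover have "0 \<in> Ce A p" for p by (rule chain.subspace_0[OF subspace_Ce])
  ultimately show ?thesis by blast
qed

text \<open>Instances with the membership premise already reduced to one on \<open>x\<close>, for
  use as rewrite rules.\<close>

lemmas be_closed = be_C[OF cyc.D_closed] be_C[OF tau_inv_op_closed] be_C[OF delta_op_closed]
    be_he_op[OF cyc.D_closed]
  be_he_op[OF cyc.N_closed] be_he_op[OF cyc.w_closed]
lemmas Be_closed = Be_C[OF cyc.D_closed] Be_C[OF tau_inv_op_closed] Be_C[OF delta_op_closed]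
    Be_he_op[OF cyc.D_closed]
  Be_he_op[OF cyc.M'_closed] Be_he_op[OF cyc.N_closed] Be_he_op[OF cyc.w_closed]
lemmas U_closed = U_C[OF cyc.D_closed] U_C[OF tau_inv_op_closed] U_he_op[OF cyc.D_closed]
    U_he_op[OF cyc.N_closed]
lemmas V_closed = V_C[OF cyc.D_closed] V_C[OF tau_inv_op_closed] V_he_op[OF cyc.D_closed]
    V_he_op[OF cyc.N_closed]
lemmas Gamma_closed = Gamma_C[OF cyc.D_closed] Gamma_C[OF tau_inv_op_closed] Gamma_he_op[OF
    cyc.D_closed] Gamma_he_op[OF cyc.N_closed]

text \<open>\<open>be_C\<close> needs at least one letter, while \<open>M n x\<close> has n. For n =
  0 it is zero, and so are both sides.\<close>

lemma be_M: "x \<in> word_space A True (Suc n) \<Longrightarrow> be A (cyc.M n x) = cyc.D (n - 1) (cyc.M n x) + cyc.M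
    (n - 1) (cyc.M n x)"
  by (cases n) (simp_all add: be.zero cyc.D.zero be_C[OF cyc.M_closed])

lemma be_he_op_M':
  "x \<in> word_space A True (Suc n) \<Longrightarrow> be A (he_op (cyc.M' n x)) = cyc.M' n x - tau_inv_op (cyc.M' n x)
    - he_op (cyc.D (n - 1) (cyc.M' n x)) - he_op (cyc.M' (n - 1) (cyc.M' n x))"
  by (cases n) (simp_all add: be.zero cyc.D.zero cyc.t.zero he_op.zero be_he_op[OF cyc.M'_closed])

section \<open>The mixed complex relations\<close>

lemma be_be: "x \<in> total_space (Ce A) \<Longrightarrow> be A (be A x) = 0"
proof (induction rule: total_space_induct)
  case (C x n)
  then show ?case
    by (simp add: be_C be.add be_closed be_M cyc.D_D cyc.D_M cyc.M_M del: One_nat_def)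
next
  case (he_op x n)
  then show ?case
    by (simp add: be_he_op be_linear be_C be_closed be_he_op_M' cyc.D_t cyc.M_t
        cyc.D_D cyc.D_M' cyc.M'_M' he_op.zero he_op.minus del: One_nat_def)
qed (simp_all add: be_linear)

lemma Be_M: "x \<in> word_space A True (Suc n) \<Longrightarrow> Be A (cyc.M n x) = he_op (cyc.N n (cyc.M n x))"
  by (cases n) (simp_all add: Be.zero cyc.N.zero he_op.zero Be_C[OF cyc.M_closed])

lemma Be_be: "x \<in> total_space (Ce A) \<Longrightarrow> be A (Be A x) + Be A (be A x) = 0"
proof (induction rule: total_space_induct)
  case (add x y)
  have "be A (Be A (x + y)) + Be A (be A (x + y)) =
      (be A (Be A x) + Be A (be A x)) + (be A (Be A y) + Be A (be A y))"
    by (simp add: be_linear Be_linear ac_simps)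
  then show ?case using add by simp
next
  case (scale c x)
  then show ?case by (simp add: be_linear Be_linear flip: chain.scale_right_distrib)
next
  case (C x n)
  then show ?case
    by (simp add: be_C Be_linear Be_C be_closed Be_closed Be_M cyc.t_N cyc.D_N cyc.M'_N_eq_N_M)
next
  case (he_op x n)
  then show ?case
    by (simp add: be_he_op be_linear Be_linear Be_C Be_he_op Be_closed cyc.N_t)
qed (simp_all add: be_linear Be_linear)

lemma Be_Be: "x \<in> total_space (Ce A) \<Longrightarrow> Be A (Be A x) = 0"
proof (induction rule: total_space_induct)
  case (C x n)
  then show ?case by (simp add: Be_C Be_closed)
qed (simp_all add: Be_linear Be_he_op)

section \<open>The coefficients of the commutator with b + uB\<close>

lemma U_M: "x \<in> word_space A True (Suc n) \<Longrightarrow>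
    U_op A (cyc.M n x) = (if n \<le> 1 then 0 else csmult (1 / 2) (- mu_op 0 (delta_op 1 (cyc.M n x))))"
  by (cases n) (simp_all add: U_op.zero U_C[OF cyc.M_closed])

lemma U_be: "x \<in> total_space (Ce A) \<Longrightarrow> U_op A (be A x) = be A (U_op A x)"
proof (induction rule: total_space_induct)
  case (C x n)
  show ?case
  proof (cases n)
    case 0
    then show ?thesis using C by (simp add: be_C be_linear U_C U_closed)
  next
    case (Suc k)
    have y: "mu_op 0 (delta_op 1 x) \<in> word_space A True (Suc k)" using C Suc by (intro
        mu_op_closed delta_op_closed) auto
    \<comment> \<open>For k = 0 the product is a single letter, on which only the differential
      acts.\<close>
    have "be A (mu_op 0 (delta_op 1 x)) = mu_op 0 (delta_op 1 (cyc.D n x)) + (if k = 0 then 0 else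
        mu_op 0 (delta_op 1 (cyc.M n x)))"
      using cyc.m0_d1_D[of x k] cyc.m0_d1_M[of x k] C Suc by (simp add: be_C[OF y] del: One_nat_def)
    then show ?thesis using C Suc
      by (simp add: be_C U_linear be_linear U_C U_closed U_M csmult_linear)
  qed
next
  case (he_op x n)
  have 1: "U_op A (be A (he_op x)) = (if n = 0 then 0 else csmult (1 / 2) (- mu_op 0 (delta_op 1
      (x - tau_inv_op x))))
      - csmult (1 / 2) (delta_op 0 (cyc.D n x)) - csmult (1 / 2) (delta_op 0 (cyc.M' n x))"
  proof -
    have "U_op A (he_op (cyc.M' n x)) = csmult (1 / 2) (delta_op 0 (cyc.M' n x))"
      using he_op by (cases n) (simp_all add: he_op.zero U_op.zero cyc.d.zero U_he_op[OF
          cyc.M'_closed])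
    then show ?thesis using he_op
      by (simp add: be_he_op U_linear U_C U_closed cyc.d.diff cyc.m.diff csmult_linear)
  qed
  have 2: "be A (U_op A (he_op x)) = csmult (1 / 2) (- delta_op 0 (cyc.D n x) + cyc.M n (delta_op
      0 x))"
    using he_op by (simp add: U_he_op be_linear be_closed cyc.D_d)
  show ?case
  proof (cases n)
    case (Suc k)
    then have "cyc.M n (delta_op 0 x) = - delta_op 0 (cyc.M' n x) - mu_op 0 (delta_op 1 (x -
        tau_inv_op x))"
      using cyc.d0_M'[OF he_op] by (simp add: algebra_simps eq_neg_iff_add_eq_0)
    then show ?thesis unfolding 1 2 using Suc by (simp add: csmult_linear)
  qed (simp add: 1 2 cyc.d.zero csmult_linear)
qed (simp_all add: U_linear be_linear)

lemma V_M: "x \<in> word_space A True (Suc n) \<Longrightarrow> V_op A (cyc.M n x) = csmult (1 / 2) (- he_op (cyc.w (n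
    - 1) (cyc.M n x)))"
  by (cases n) (simp_all add: V_op.zero cyc.w.zero he_op.zero V_C[OF cyc.M_closed])

text \<open>Multiplication lowers the degree by one: this is where the multiplicative half of b / 2
  comes from.\<close>

lemma Gamma_M: "x \<in> word_space A True (Suc n) \<Longrightarrow>
    Gamma A (cyc.M n x) = - csmult (of_nat n / 2) (cyc.M n x) + csmult (1 / 2) (cyc.M n x)"
  by (cases n)
    (simp_all add: Gamma.zero Gamma_C[OF cyc.M_closed] add_divide_distrib chain.scale_left_distrib)

lemma Gamma_he_op_M': "x \<in> word_space A True (Suc n) \<Longrightarrow>
    Gamma A (he_op (cyc.M' n x)) = - csmult (of_nat n / 2) (he_op (cyc.M' n x))"
  by (cases n) (simp_all add: Gamma.zero he_op.zero Gamma_he_op[OF cyc.M'_closed])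

lemma Be_U_C:
  assumes x: "x \<in> word_space A True (Suc n)"
  shows "Be A (U_op A x) = csmult (1 / 2) (- he_op (cyc.N n (mu_op 0 (delta_op 1 x))))"
proof (cases n)
  case (Suc k)
  have "mu_op 0 (delta_op 1 x) \<in> word_space A True (Suc k)" using x Suc by (intro mu_op_closed
      delta_op_closed) auto
  then show ?thesis using x Suc by (simp add: U_C Be_linear Be_C)
qed (use x in \<open>simp add: U_C Be.zero cyc.N_def he_op.zero\<close>)

text \<open>The coefficient of u^(-1). The terms with \<open>U_op\<close> and \<open>V_op\<close>
  contribute the differentials of b / 2, and \<open>Gamma\<close> contributes its faces.\<close>

lemma commutator_1:
  "x \<in> total_space (Ce A) \<Longrightarrow> U_op A (Be A x) - Be A (U_op A x) + (V_op A (be A x) + Gamma A (be A x))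
    - be A (V_op A x + Gamma A x) = csmult (1 / 2) (be A x)"
proof (induction rule: total_space_induct)
  case (add x y)
  then show ?case by (simp add: chain_linear csmult_linear flip: add.IH)
next
  case (scale c x)
  have "csmult (1 / 2) (be A (csmult c x)) = csmult c (csmult (1 / 2) (be A x))"
    by (simp add: be.scale mult.commute)
  then show ?case by (simp only: scale[symmetric]) (simp add: chain_linear csmult_linear)
next
  case (C x n)
  let ?h = "csmult (1 / 2)"
  have b: "be A x = cyc.D n x + cyc.M n x" using C by (rule be_C)
  have 1: "U_op A (Be A x) = ?h (delta_op 0 (cyc.N (Suc n) x))"
    using C by (simp add: Be_C U_closed)
  have 2: "V_op A (be A x) = ?h (- he_op (cyc.w n (cyc.D n x)) - he_op (cyc.w (n - 1) (cyc.M n x)))"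
    using C by (simp add: b V_op.add V_closed V_M csmult_linear)
  have 3: "be A (V_op A x) = ?h (- cyc.w n x + tau_inv_op (cyc.w n x) + he_op (cyc.D n (cyc.w n
      x)) + he_op (cyc.M' n (cyc.w n x)))"
    using C by (simp add: V_C be_linear be_closed csmult_linear)
  have 4: "Gamma A (be A x) = be A (Gamma A x) + ?h (cyc.M n x)"
    using C by (simp add: b Gamma.add Gamma_C Gamma_M Gamma_closed be_linear csmult_linear)
  \<comment> \<open>With \<open>5\<close> and \<open>6\<close> the component in C^+(A) cancels; in
    the component in C(A) the differentials come from \<open>d0_N\<close>.\<close>
  have 5: "he_op (cyc.D n (cyc.w n x)) = - he_op (cyc.w n (cyc.D n x))"
    using cyc.d_w[OF C] by (simp add: he_op.minus)
  have 6: "he_op (cyc.N n (mu_op 0 (delta_op 1 x))) = he_op (cyc.w (n - 1) (cyc.M n x)) + he_op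
      (cyc.M' n (cyc.w n x))"
    using cyc.w_M[OF C] by (simp flip: he_op.add)
  have "U_op A (Be A x) - Be A (U_op A x) + (V_op A (be A x) + Gamma A (be A x)) - be A (V_op A x
      + Gamma A x)
    = ?h (delta_op 0 (cyc.N (Suc n) x) + (cyc.w n x - tau_inv_op (cyc.w n x)) + cyc.M n x)"
    unfolding be.add 1 2 3 4 5 6 Be_U_C[OF C] by (simp add: csmult_linear)
  also have "\<dots> = ?h (be A x)" unfolding cyc.d0_N[OF C] b ..
  finally show ?case .
next
  case (he_op x n)
  let ?h = "csmult (1 / 2)"
  have b: "be A (he_op x) = x - tau_inv_op x - he_op (cyc.D n x) - he_op (cyc.M' n x)" using he_op
      by (rule be_he_op)
  have V0: "V_op A (he_op (cyc.M' n x)) = 0" using V_he_op[OF cyc.M'_closed[OF he_op]] .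
  have 1: "Be A (U_op A (he_op x)) = ?h (he_op (cyc.N (Suc n) (delta_op 0 x)))"
    using he_op by (simp add: U_he_op Be_linear Be_closed)
  have 2: "V_op A (be A (he_op x)) = ?h (- he_op (cyc.w n (x - tau_inv_op x)))"
    using he_op V0 by (simp add: b V_linear V_C V_closed csmult_linear cyc.w.diff he_op.diff)
  have 3: "Gamma A (be A (he_op x)) = be A (Gamma A (he_op x)) + ?h (x - tau_inv_op x - he_op
      (cyc.M' n x))"
    using he_op by (simp add: b Gamma_linear Gamma_C Gamma_he_op Gamma_he_op_M' Gamma_closed
        be_linear
        add_divide_distrib csmult_linear)
  \<comment> \<open>Here the component in C(A) comes from \<open>Gamma\<close> alone, and
    \<open>w_t\<close> supplies the differentials in C^+(A).\<close>
  have "U_op A (Be A (he_op x)) - Be A (U_op A (he_op x)) + (V_op A (be A (he_op x)) + Gamma A (be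
      A (he_op x)))
      - be A (V_op A (he_op x) + Gamma A (he_op x))
    = ?h (x - tau_inv_op x - he_op (cyc.M' n x) - (he_op (cyc.w n (x - tau_inv_op x)) + he_op
        (cyc.N (Suc n) (delta_op 0 x))))"
    unfolding be.add 1 2 3 using he_op by (simp add: Be_he_op V_he_op U_op.zero be.zero
        csmult_linear)
  also have "he_op (cyc.w n (x - tau_inv_op x)) + he_op (cyc.N (Suc n) (delta_op 0 x)) = he_op
      (cyc.D n x)"
    unfolding cyc.w_t[OF he_op] by (simp add: he_op.diff)
  finally show ?case unfolding b by (simp add: algebra_simps)
qed (simp_all add: chain_linear)

text \<open>The coefficient of u^0; the separate summand \<open>Be A x\<close> comes from d/du
  applied to uB. Since [Gamma, B] = - B / 2, the claim becomes B - B / 2 = B / 2, where 2 has to be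
  invertible.\<close>

lemma commutator_0:
  assumes "(2 :: 'k) \<noteq> 0"
  shows "x \<in> total_space (Ce A) \<Longrightarrow> V_op A (Be A x) + Gamma A (Be A x)
    - Be A (V_op A x + Gamma A x) + Be A x = csmult (1 / 2) (Be A x)"
proof (induction rule: total_space_induct)
  case (add x y)
  then show ?case by (simp add: chain_linear csmult_linear flip: add.IH)
next
  case (scale c x)
  have "csmult (1 / 2) (Be A (csmult c x)) = csmult c (csmult (1 / 2) (Be A x))"
    by (simp add: Be.scale mult.commute)
  then show ?case by (simp only: scale[symmetric]) (simp add: chain_linear csmult_linear)
next
  case (C x n)
  have "y = csmult (1 / 2) y + csmult (1 / 2) y" for y :: "('k, 'a) chain"
    using assms by (simp flip: chain.scale_left_distrib)
  then have "y - csmult (1 / 2) y = csmult (1 / 2) y" for y :: "('k, 'a) chain"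
    by (metis add_diff_cancel_left')
  then show ?case using C
    by (simp add: chain_linear Be_C V_closed V_C Gamma_C Gamma_closed Be_closed
        add_divide_distrib csmult_linear)
next
  case (he_op x n)
  then show ?case by (simp add: chain_linear Be_he_op V_he_op Gamma_he_op)
qed (simp_all add: chain_linear)

lemma Ce_closed:
  "x \<in> Ce A p \<Longrightarrow> be A x \<in> Ce A (p + 1)" "x \<in> Ce A p \<Longrightarrow> Be A x \<in> Ce A (p + 1)"
  "x \<in> Ce A p \<Longrightarrow> U_op A x \<in> Ce A p" "x \<in> Ce A p \<Longrightarrow> V_op A x \<in> Ce A p" "x \<in> Ce A p \<Longrightarrow> Gamma A x \<in> Ce A
      p"
  using op_on_Ce[OF chain_op_ops(1), of x p] op_on_Ce[OF chain_op_ops(2), of x p] op_on_Ce[OF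
      chain_op_ops(3), of x p]
    op_on_Ce[OF chain_op_ops(4), of x p] op_on_Ce[OF chain_op_ops(5), of x p]
  by (simp_all add: be_def Be_def U_op_def V_op_def Gamma_def)

lemma total_closed:
  assumes "x \<in> total_space (Ce A)"
  shows "be A x \<in> total_space (Ce A)" "Be A x \<in> total_space (Ce A)" "U_op A x \<in> total_space (Ce A)"
    "V_op A x \<in> total_space (Ce A)" "Gamma A x \<in> total_space (Ce A)"
    "U_op_dual A x \<in> total_space (Ce A)" "V_op_dual A x \<in> total_space (Ce A)"
  unfolding be_def Be_def U_op_def V_op_def Gamma_def U_op_dual_def V_op_dual_def
  by (rule op_on_total_space[OF _ assms], rule chain_op_ops)+

lemma mixed_complex_Ce: "mixed_complex csmult (Ce A) (be A) (Be A)"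
proof
  show "chain.subspace (Ce A p)" for p by (rule subspace_Ce)
  show "Ce A 0 \<inter> Ce A 1 = {0}" by (rule direct_Ce)
  show "linear_op_on csmult (total_space (Ce A)) (be A)"
    unfolding be_def by (rule linear_op_on_total_space[OF chain_op_ops(1)])
  show "linear_op_on csmult (total_space (Ce A)) (Be A)"
    unfolding Be_def by (rule linear_op_on_total_space[OF chain_op_ops(2)])
qed (fact Ce_closed be_be Be_Be Be_be)+

lemma conn_form_laurent:
  assumes "chain.subspace S" "\<And>x. x \<in> S \<Longrightarrow> U_op A x \<in> S" "\<And>x. x \<in> S \<Longrightarrow> V_op A x \<in> S" "\<And>x. x \<in> S \<Longrightarrow>
      Gamma A x \<in> S"
    and f: "f \<in> laurent S"
  shows "conn_form A f \<in> laurent S"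
  unfolding conn_form_def
  by (intro laurent_add laurent_upow laurent_map[OF f] assms(1-4) chain.subspace_add[OF assms(1)])
    (simp_all add: chain_linear)

lemma laurent_linear_conn_form: "laurent_linear csmult (total_space (Ce A)) (conn_form A)"
  unfolding laurent_linear_def
proof (intro conjI ballI allI)
  fix f :: "int \<Rightarrow> ('k, 'a) chain" assume f: "f \<in> laurent (total_space (Ce A))"
  show "conn_form A f \<in> laurent (total_space (Ce A))"
    by (rule conn_form_laurent[OF subspace_total_space _ _ _ f]) (fact total_closed)+
  show "conn_form A (\<lambda>m. f m + g m) = (\<lambda>m. conn_form A f m + conn_form A g m)" for g
    by (simp add: conn_form_def upow_def chain_linear algebra_simps)
  fix s
  have 1: "(\<lambda>j. U_op A (f j)) \<in> laurent (total_space (Ce A))" "(\<lambda>j. V_op A (f j)) \<in> laurent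
      (total_space (Ce A))"
    "(\<lambda>j. Gamma A (f j)) \<in> laurent (total_space (Ce A))"
    by (rule laurent_map[OF f]; simp add: total_closed chain_linear)+
  have 2: "(\<lambda>j. V_op A (f j) + Gamma A (f j)) \<in> laurent (total_space (Ce A))"
    by (rule laurent_add[OF subspace_total_space 1(2,3)])
  show "conn_form A (fls_scale csmult s f) = fls_scale csmult s (conn_form A f)"
    unfolding conn_form_def fls_scale_add[OF laurent_upow[OF 1(1)] laurent_upow[OF 2]]
        fls_scale_upow
      fls_scale_add[OF 1(2,3)] fls_scale_map[OF f U_op.linear_axioms] fls_scale_map[OF f
          V_op.linear_axioms]
      fls_scale_map[OF f Gamma.linear_axioms] ..
qed

lemma u_connection_nabla:
  assumes "(2 :: 'k) \<noteq> 0"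
  shows "u_connection csmult (Ce A) (be A) (Be A) (nabla A)"
  unfolding u_connection_def
proof (intro conjI allI ballI exI[of _ "conn_form A"])
  show "mixed_complex csmult (Ce A) (be A) (Be A)" by (rule mixed_complex_Ce)
  show "laurent_linear csmult (total_space (Ce A)) (conn_form A)" by (rule laurent_linear_conn_form)
  show "nabla A f \<in> laurent (Ce A p)" if "f \<in> laurent (Ce A p)" for f p
    unfolding nabla_eq
    by (intro laurent_add subspace_Ce laurent_ddu that conn_form_laurent) (fact Ce_closed)+
  show "nabla A f = (\<lambda>m. ddu csmult f m + conn_form A f m)" for f by (rule nabla_eq)
  fix f assume "f \<in> laurent (total_space (Ce A))"
  then have f: "f m \<in> total_space (Ce A)" for m by (simp add: laurent_def)
  show "(\<lambda>m. nabla A (b_plus_uB (be A) (Be A) f) m - b_plus_uB (be A) (Be A) (nabla A f) m) =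
    (\<lambda>m. csmult (1 / 2) (upow (- 1) (b_plus_uB (be A) (Be A) f) m))"
  proof
    fix m
    have 1: "U_op A (be A (f (m + 2))) = be A (U_op A (f (m + 2)))" by (rule U_be[OF f])
    note 2 = commutator_1[OF f, of "m + 1"] and 3 = commutator_0[OF assms f, of m]
    \<comment> \<open>Grouped by the coefficients f_{m+2}, f_{m+1} and f_m. The factors m + 1 and m,
      from differentiating after and before multiplication by u, differ by one and leave a single
      B.\<close>
    have "nabla A (b_plus_uB (be A) (Be A) f) m - b_plus_uB (be A) (Be A) (nabla A f) m =
      (U_op A (be A (f (m + 2))) - be A (U_op A (f (m + 2)))) +
      (U_op A (Be A (f (m + 1))) - Be A (U_op A (f (m + 1))) + (V_op A (be A (f (m + 1))) + Gamma
          A (be A (f (m + 1))))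
        - be A (V_op A (f (m + 1)) + Gamma A (f (m + 1)))) +
      (V_op A (Be A (f m)) + Gamma A (Be A (f m)) - Be A (V_op A (f m) + Gamma A (f m)) + Be A (f
          m))"
      by (simp add: nabla_def b_plus_uB_def upow_def ddu_def chain_linear csmult_linear
          add.commute[of 2] algebra_simps)
    also have "\<dots> = csmult (1 / 2) (upow (- 1) (b_plus_uB (be A) (Be A) f) m)"
      unfolding 2 3 1 by (simp add: b_plus_uB_def upow_def csmult_linear)
    finally show "nabla A (b_plus_uB (be A) (Be A) f) m - b_plus_uB (be A) (Be A) (nabla A f) m =
      csmult (1 / 2) (upow (- 1) (b_plus_uB (be A) (Be A) f) m)" .
  qed
qed

end

section \<open>The dual connection\<close>

lemma tensor_rel_opp: "tensor_rel (opp A) = tensor_rel A"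
proof -
  have "words (opp A) = words A" by (simp add: words_def opp_def)
  then show ?thesis by (simp add: tensor_rel_def) (simp add: opp_def)
qed

text \<open>\<open>opp\<close> alters only the product, so \<open>is_nf\<close> is the same
  predicate for both algebras and the choices coincide. The chains of \<open>A\<close> and
  \<open>opp A\<close> form literally one space, on which \<open>Phi A\<close> can be
  iterated.\<close>

lemma nf_opp: "nf (opp A) = nf A"
proof -
  have "is_nf (opp A) = is_nf A" by (simp add: fun_eq_iff is_nf_def tensor_rel_opp)
  then show ?thesis by (simp add: nf_def)
qed

lemma op_on_opp: "op_on (opp A) = op_on A"
  by (simp add: fun_eq_iff op_on_def nf_opp)

lemma delta_opp: "delta (opp A) = delta A"
proof -
  have ldif: "ldif (opp A) = ldif A" by (simp add: fun_eq_iff ldif_def opp_def)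
  show ?thesis by (intro ext) (simp only: delta_def ldif)
qed

lemma V_op_opp: "V_op (opp A) = V_op A" and Gamma_opp: "Gamma (opp A) = Gamma A"
  by (simp_all add: V_op_def Gamma_def op_on_opp delta_opp)

section \<open>The opposite product\<close>

context dg_algebra
begin

lemma hom_part_eq:
  assumes a: "a \<in> hom A p"
  shows "hom_part A q a = (if q = p then a else 0)"
proof -
  have disj: "x = 0" if "x \<in> hom A r" "x \<in> hom A (r + 1)" for x r
    using direct_hom that by (cases r) auto
  let ?P = "\<lambda>x. x \<in> hom A q \<and> (\<exists>y\<in>hom A (q + 1). a = x + y)"
  have ex: "?P (if q = p then a else 0)"
  proof (cases "q = p")
    case True
    then show ?thesis using a hom_closed(1) by auto
  next
    case False
    then have "p = q + 1" by (cases p; cases q) auto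
    then show ?thesis using a hom_closed(1) False by auto
  qed
  have "x = x'" if P: "?P x" "?P x'" for x x'
  proof -
    obtain y y' where y: "y \<in> hom A (q + 1)" "y' \<in> hom A (q + 1)" "a = x + y" "a = x' + y'"
      using P by blast
    have "x - x' \<in> hom A q" "y' - y \<in> hom A (q + 1)"
      using P y subspace_diff[OF subspace_hom] by blast+
    moreover have "x - x' = y' - y" using y by (simp add: algebra_simps)
    ultimately have "x - x' = 0" using disj by metis
    then show ?thesis by simp
  qed
  with ex show ?thesis unfolding hom_part_def by (intro the_equality) auto
qed

text \<open>On homogeneous letters only one of the four summands in \<open>opp\<close> survives, the
  one with the actual parities.\<close>

lemma lmul_opp:
  assumes "snd x \<in> hom A (fst x)" "snd y \<in> hom A (fst y)"
  shows "lmul (opp A) x y = (fst x + fst y, scl A (sgn_par (fst x * fst y)) (snd (lmul A y x)))"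
proof -
  have 0: "mul A 0 b = 0" "mul A b 0 = 0" for b
    using mul_scl_left[of 0 0 b] mul_scl_right[of b 0 0] by simp_all
  show ?thesis
    by (cases "fst x"; cases "fst y")
      (simp_all add: lmul_def opp_def hom_part_eq[OF assms(1)] hom_part_eq[OF assms(2)] 0)
qed

lemma letter_linear_lmul_opp:
  assumes "y \<in> hom A q"
  shows "letter_linear A p (p + q) (\<lambda>a. snd (lmul (opp A) (p, a) (q, y)))"
    and "letter_linear A p (q + p) (\<lambda>a. snd (lmul (opp A) (q, y) (p, a)))"
proof -
  have 1: "snd (lmul (opp A) (p, a) (q, y)) = scl A (sgn_par (p * q)) (mul A y a)"
    "snd (lmul (opp A) (q, y) (p, a)) = scl A (sgn_par (p * q)) (mul A a y)" if "a \<in> hom A p" for a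
    using lmul_opp[of "(p, a)" "(q, y)"] lmul_opp[of "(q, y)" "(p, a)"] that assms
    by (simp_all add: lmul_def mult.commute)
  have 2: "mul A y a \<in> hom A (p + q)" "mul A a y \<in> hom A (q + p)" if "a \<in> hom A p" for a
    using mul_hom[OF that assms] mul_hom[OF assms that] by (simp_all add: add.commute)
  show "letter_linear A p (p + q) (\<lambda>a. snd (lmul (opp A) (p, a) (q, y)))"
    "letter_linear A p (q + p) (\<lambda>a. snd (lmul (opp A) (q, y) (p, a)))"
    unfolding letter_linear_def
    by (auto simp: 1 2 hom_closed mul_add_left mul_add_right mul_scl_left mul_scl_right
        scale_right_distrib mult.commute)
qed

text \<open>In the connection of \<open>opp A\<close> the product occurs only in U, and there only
  through the first face, so this operator together with those of \<open>A\<close> suffices for the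
  duality.\<close>

lemma chain_op_mu_opp: "chain_op A 1 (mu (opp A) 0)"
proof (rule chain_op_sgI)
  fix s :: bool and k :: nat assume k: "0 < k"
  have fst_lmul: "fst (lmul (opp A) x y) = fst x + fst y" for x y by (simp add: lmul_def)
  show "(\<forall>ws. length ws = k \<longrightarrow> mu (opp A) 0 (list_word s ws) = 0) \<or>
    (\<exists>s' l f e. 0 < l \<and> multilinear_op A k l f \<and> (\<forall>ws. length ws = k \<longrightarrow>
      mu (opp A) 0 (list_word s ws) = sg (e (map fst ws)) (Poly_Mapping.single (list_word s' (f
          ws)) 1) \<and>
      lpar (f ws) + (if s' then 1 else 0) = lpar ws + (if s then 1 else 0) + 1))"
  proof (cases s)
    case s: True
    show ?thesis
    proof (cases "k = 1")
      case True
      then show ?thesis using s by (intro disjI1) (auto simp: deg_list_word intro!: mu_beyond)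
    next
      case False
      then have k1: "Suc 0 < k" using k by simp
      have "multilinear_op A k (k - 1) (lmul_at (lmul (opp A)) 0)"
        by (rule multilinear_op_lmul_at[OF letter_linear_lmul_opp fst_lmul k1])
      then show ?thesis
        by (intro disjI2 exI[of _ True] exI[of _ "k - 1"] exI[of _ "lmul_at (lmul (opp A)) 0"]
            exI[of _ "\<lambda>ps. (\<Sum>p\<leftarrow>take 1 ps. p + 1) + 1"])
          (use s k1 in \<open>simp add: mu_list_word_True lpar_take_eq lpar_lmul_at fst_lmul bit_ac\<close>)
    qed
  next
    case False
    then show ?thesis
      by (intro disjI2 exI[of _ True] exI[of _ k] exI[of _ "\<lambda>ws. ws"] exI[of _ "\<lambda>ps. 0"])
        (use k in \<open>auto simp add: multilinear_op_id mu_list_word_False_first sg_def bit_ac simp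
            del: list_word.simps\<close>)
  qed
qed

definition mu_opp_op :: "('k, 'a) chain \<Rightarrow> ('k, 'a) chain" where "mu_opp_op = op_on A (mu (opp A) 0)"

lemma Phi_eq: "Phi A = op_on A phi_word"
  by (simp add: Phi_def op_on_opp phi_word_def[abs_def])

lemma mu_opp_op_linear: "mu_opp_op (x + y) = mu_opp_op x + mu_opp_op y" "mu_opp_op (csmult c x) =
    csmult c (mu_opp_op x)" "mu_opp_op 0 = 0" "mu_opp_op (sg p x) = sg p (mu_opp_op x)"
  "mu_opp_op (- x) = - mu_opp_op x"
  by (simp_all add: mu_opp_op_def op_on_linear op_on_sg)

lemma Phi_sg: "Phi A (sg p x) = sg p (Phi A x)"
  by (simp add: sg_def Phi.scale)

lemmas Phi_linear = Phi.add Phi.diff Phi.scale Phi.zero Phi.neg Phi_sg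

lemma Phi_cls_True:
  "Phi A (word_class A True (x # xs)) = sg (phi_par (map fst xs)) (word_class A True (x # rev xs))"
  unfolding Phi_eq op_on_word_class[OF chain_op_phi] phi_list_word_True by (simp add: nf_sg
      word_class_def)

lemma Phi_cls_False:
  "Phi A (word_class A False xs) = sg (phi_par (map fst xs)) (word_class A False (rev xs))"
  unfolding Phi_eq op_on_word_class[OF chain_op_phi] phi_list_word_False by (simp add: nf_sg
      word_class_def)

lemma sum_list_lpar: "(\<Sum>x\<leftarrow>ws. fst x + 1) = lpar ws" "(\<Sum>x\<leftarrow>ws. 1 + fst x) = lpar ws"
  by (simp_all add: lpar_def add.commute)

section \<open>What \<open>Phi\<close> does to the elementary operators\<close>

lemma phi_par_simps:
  "phi_par (map fst []) = 0"
  "phi_par (map fst (x # xs)) = 1 + (fst x + 1) * lpar xs + phi_par (map fst xs)"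
  "phi_par (map fst (xs @ ys)) = phi_par (map fst xs) + lpar xs * lpar ys + phi_par (map fst ys)"
  "phi_par (map fst (rev xs)) = phi_par (map fst xs)"
  by (simp_all add: phi_par_def koszul_append comp_def sum_list_lpar ac_simps rev_map[symmetric]
      koszul_rev)

lemma Phi_closed: "x \<in> word_space A True n \<Longrightarrow> Phi A x \<in> word_space A True n"
proof (induction rule: word_space_induct)
  case (word_class ws)
  then obtain x xs where "ws = x # xs" by (cases ws) auto
  with word_class show ?case by (simp only: Phi_cls_True) (simp add: sg_in_word_space
      word_class_in_word_space)
qed (simp_all add: Phi_linear word_space_closed)

lemma Phi_Phi_C: "x \<in> word_space A True n \<Longrightarrow> Phi A (Phi A x) = x"
proof (induction rule: word_space_induct)
  case (word_class ws)
  then obtain x xs where ws: "ws = x # xs" by (cases ws) auto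
  show ?case unfolding ws Phi_cls_True Phi_sg phi_par_simps by simp
qed (simp_all add: Phi_linear)

lemma Phi_delta_op:
  assumes "x \<in> word_space A True (Suc n)" "1 \<le> i" "i \<le> n"
  shows "Phi A (delta_op i x) = delta_op (Suc n - i) (Phi A x)"
  using assms(1)
proof (induction rule: word_space_induct)
  case (word_class ws)
  then obtain x xs where ws: "ws = x # xs" by (cases ws) auto
  then have "i - 1 < length xs" using word_class assms(2,3) by simp
  then obtain ys y zs where *: "xs = ys @ y # zs" "length ys = i - 1" by (rule split_at)
  have **: "i = length (x # ys)" "Suc n - i = length (x # rev zs)" using * ws word_class assms by
      auto
  have "delta_op i (word_class A True (x # ys @ y # zs)) = sg (lpar (x # ys)) (word_class A True
      (x # ys @ ldif A y # zs))"
    using delta_op_word_class[of i "x # ys" y zs] ** by simp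
  moreover have "delta_op (Suc n - i) (word_class A True (x # rev zs @ y # rev ys)) =
      sg (lpar (x # rev zs)) (word_class A True (x # rev zs @ ldif A y # rev ys))"
    using delta_op_word_class[of "Suc n - i" "x # rev zs" y "rev ys"] ** by simp
  ultimately show ?case
    unfolding ws *(1) by (simp add: op_linear Phi_sg Phi_cls_True del: list.map map_append)
      (simp add: phi_par_simps bit_ring del: list.map map_append)
qed (simp_all add: op_linear Phi_linear)

lemma Phi_delta_op_0:
  assumes "x \<in> word_space A True n" shows "Phi A (delta_op 0 x) = delta_op 0 (Phi A x)"
  using assms(1)
proof (induction rule: word_space_induct)
  case (word_class ws)
  then obtain x xs where ws: "ws = x # xs" by (cases ws) auto
  show ?case using delta_op_word_class[of 0 "[]" x xs] delta_op_word_class[of 0 "[]" x "rev xs"]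
    unfolding ws by (simp add: op_linear Phi_cls_True)
qed (simp_all add: op_linear Phi_linear)

lemma Phi_tau_op:
  assumes "x \<in> word_space A True n" shows "Phi A (tau_op x) = tau_inv_op (Phi A x)"
  using assms(1)
proof (induction rule: word_space_induct)
  case (word_class ws)
  then obtain x xs where ws: "ws = x # xs" by (cases ws) auto
  show ?case
  proof (cases xs)
    case Nil
    then show ?thesis using ws tau_op_word_class[of x "[]"] tau_inv_op_word_class[of "[]" x]
        Phi_cls_True[of x "[]"]
      by (simp add: op_linear Phi_sg)
  next
    case (Cons y ys)
    show ?thesis unfolding ws Cons using tau_inv_op_word_class[of "x # rev ys" y]
      by (simp add: op_linear Phi_sg Phi_cls_True tau_op_word_class del: list.map map_append)
        (simp add: phi_par_simps bit_ring del: list.map map_append)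
  qed
qed (simp_all add: op_linear Phi_linear)

lemma Phi_tau_inv_op: "x \<in> word_space A True n \<Longrightarrow> Phi A (tau_inv_op x) = tau_op (Phi A x)"
  by (metis Phi_tau_op tau_op_tau_inv_op tau_inv_op_closed Phi_closed)

text \<open>Behind e the letter a_0 is reversed too and ends up last, which is the effect of tau
  after \<open>Phi\<close>. The minus sign is the factor (-1)^n of \<open>Phi\<close> for one more
  letter.\<close>

lemma Phi_he_op:
  assumes "x \<in> word_space A True n" shows "Phi A (he_op x) = - he_op (tau_op (Phi A x))"
  using assms(1)
proof (induction rule: word_space_induct)
  case (word_class ws)
  then obtain x xs where ws: "ws = x # xs" by (cases ws) auto
  show ?case unfolding ws
    by (simp add: he_op_word_class op_linear Phi_cls_True Phi_cls_False tau_op_word_class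
        sg_uminus del: list.map)
      (simp add: phi_par_simps bit_ring del: list.map)
qed (simp_all add: op_linear Phi_linear)

text \<open>The reversal places a_n next to a_0, and the product a_n a_0 becomes, up to sign, that
  of a_0 and a_n in the opposite algebra. That sign is a scalar inside a letter and is moved out by
  \<open>word_class_scl\<close>.\<close>

lemma Phi_mu_op:
  assumes "x \<in> word_space A True (Suc n)" "0 < n" shows "Phi A (mu_op n x) = mu_opp_op (Phi A x)"
  using assms(1)
proof (induction rule: word_space_induct)
  case (word_class ws)
  then obtain x xs' where ws: "ws = x # xs'" by (cases ws) auto
  then obtain xs y where xs: "xs' = xs @ [y]" using word_class assms by (cases xs' rule:
      rev_cases) auto
  have v: "snd x \<in> hom A (fst x)" "snd y \<in> hom A (fst y)" "valid A xs" using word_class ws xs by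
      auto
  have n: "n = Suc (length xs)" using word_class ws xs by simp
  have 1: "mu_op n (word_class A True (x # xs @ [y])) = sg ((fst y + 1) * lpar (x # xs) + fst y)
      (word_class A True (lmul A y x # xs))"
    unfolding mu_op_def op_on_word_class[OF chain_op_mu] n mu_list_word_True_last nf_sg by (simp
        only: word_class_def)
  have "mu_opp_op (word_class A True (x # y # rev xs)) = sg (fst x) (word_class A True (lmul (opp
      A) x y # rev xs))"
    unfolding mu_opp_op_def op_on_word_class[OF chain_op_mu_opp] list_word.simps mu_first
        option.case single_sgn nf_sg
    by (simp add: word_class_def)
  also have "word_class A True (lmul (opp A) x y # rev xs) = sg (fst x * fst y) (word_class A True
      (lmul A y x # rev xs))"
  proof -
    have "snd (lmul A y x) \<in> hom A (fst x + fst y)" using lmul_valid[OF v(2,1)] by (simp add: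
        add.commute)
    moreover have "(fst x + fst y, snd (lmul A y x)) = lmul A y x" by (simp add: lmul_def
        add.commute)
    ultimately show ?thesis
      using word_class_scl[of "[]" "rev xs" "snd (lmul A y x)" "fst x + fst y" True] v by (simp
          add: lmul_opp sg_def)
  qed
  finally show ?case using 1 unfolding ws xs
    by (simp add: op_linear Phi_sg Phi_cls_True mu_opp_op_linear del: list.map map_append)
      (simp add: phi_par_simps bit_ring del: list.map map_append)
qed (simp_all add: op_linear Phi_linear mu_opp_op_linear)

lemma U_opp_deg:
  "x \<in> word_space A s k \<Longrightarrow> k = (if s then Suc d else d) \<Longrightarrow>
    U_op (opp A) x = (if d = 0 then 0 else csmult (1 / 2) (- mu_opp_op (delta_op 1 x)))"
proof -
  have chain_op: "chain_op A 0 (\<lambda>w. if n = 0 then 0 else csmult (1 / 2) (- lin_ext (mu (opp A) 0)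
      (delta A 1 w)))" for n :: nat
    using chain_op_scale[OF chain_op_uminus[OF chain_op_lin_ext[OF chain_op_mu_opp
        chain_op_delta]], of 0 "1/2" 1]
    by (cases "n = 0") (simp_all add: chain_op_0)
  assume "x \<in> word_space A s k" "k = (if s then Suc d else d)"
  then show ?thesis
    unfolding U_op_def op_on_opp delta_opp
    by (subst op_on_deg[where t = "\<lambda>n w. if n = 0 then 0 else csmult (1 / 2) (- lin_ext (mu (opp
        A) 0) (delta A 1 w))", OF chain_op])
      (cases "d = 0"; simp add: op_on_fun_0 op_on_fun_scale op_on_fun_uminus op_on_lin_ext[OF
          chain_op_mu_opp] mu_opp_op_def delta_op_def)+
qed

lemma mu_opp_op_he_op:
  assumes "x \<in> word_space A True n" shows "mu_opp_op (he_op x) = x"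
  using assms
proof (induction rule: word_space_induct)
  case (word_class ws)
  then show ?case
    by (simp add: he_op_word_class mu_opp_op_def op_on_word_class[OF chain_op_mu_opp]
        mu_list_word_False_first word_class_def[symmetric] del: list_word.simps)
qed (simp_all add: op_linear mu_opp_op_linear)

lemma U_opp_he_op: "x \<in> word_space A True (Suc n) \<Longrightarrow> U_op (opp A) (he_op x) = csmult (1 / 2)
    (delta_op 0 x)"
proof -
  assume x: "x \<in> word_space A True (Suc n)"
  have "mu_opp_op (delta_op 1 (he_op x)) = - delta_op 0 x"
    using delta_op_he_op_Suc[OF x, of 0] mu_opp_op_he_op[OF delta_op_closed[OF x, of 0]] by (simp
        add: mu_opp_op_linear)
  then show ?thesis using U_opp_deg[OF he_op_closed[OF x], of "Suc n"] by simp
qed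

lemma U_dual_he_op: "x \<in> word_space A True (Suc n) \<Longrightarrow> U_op_dual A (he_op x) = csmult (1 / 2)
    (delta_op 0 (tau_inv_op x))"
proof -
  assume x: "x \<in> word_space A True (Suc n)"
  have "mu_op (Suc n) (delta_op (Suc n) (he_op x)) = delta_op 0 (tau_inv_op x)"
    using delta_op_he_op_Suc[OF x, of n] mu_op_he_op_last[OF delta_op_closed[OF x, of n]]
        tau_inv_op_delta_op_last[OF x]
    by (simp add: cyc.m.minus)
  then show ?thesis using U_dual_deg[OF he_op_closed[OF x], of "Suc n"] by simp
qed

lemma V_dual_he_op: "x \<in> word_space A True n \<Longrightarrow> V_op_dual A (he_op x) = 0"
proof -
  assume x: "x \<in> word_space A True n"
  have "(tau_op ^^ j) (delta_op i (he_op x)) = 0" if ij: "i \<in> {1..n}" "j \<in> {1..i}" for i j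
  proof -
    obtain k where k: "i = Suc k" using ij by (cases i) auto
    then have "delta_op i (he_op x) = - he_op (delta_op k x)" using delta_op_he_op_Suc[OF x, of k]
        ij by simp
    then show ?thesis using tau_op_pow_he_op[OF delta_op_closed[OF x, of k], of j] ij k by (simp
        add: taup.minus)
  qed
  then have "(\<Sum>i=1..n. \<Sum>j=1..i. (tau_op ^^ j) (delta_op i (he_op x))) = 0"
    by (intro sum.neutral ballI)
  then show ?thesis using V_dual_deg[OF he_op_closed[OF x], of n] by (simp add: he_op.zero)
qed

text \<open>The sign differs from that in \<open>Phi_V_dual\<close>: the substitution u -> -u fixes
  u^(-2) but reverses u^(-1), and the dual carries a further minus.\<close>

lemma Phi_U_dual: "x \<in> total_space (Ce A) \<Longrightarrow> Phi A (U_op_dual A x) = - U_op (opp A) (Phi A x)"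
proof (induction rule: total_space_induct)
  case (C x n)
  show ?case
  proof (cases "n = 0")
    case True
    then show ?thesis using U_dual_deg[OF C, of n] U_opp_deg[OF Phi_closed[OF C], of n] by (simp
        add: Phi.zero)
  next
    case False
    then have "Phi A (mu_op n (delta_op n x)) = mu_opp_op (delta_op 1 (Phi A x))"
      using Phi_mu_op[OF delta_op_closed[OF C, of n]] Phi_delta_op[OF C, of n] by simp
    then show ?thesis using False U_dual_deg[OF C, of n] U_opp_deg[OF Phi_closed[OF C], of n]
      by (simp add: Phi.scale csmult_linear)
  qed
next
  case (he_op x n)
  then show ?case
    by (simp add: U_dual_he_op Phi_he_op U_op.neg U_opp_he_op[OF tau_op_closed[OF Phi_closed[OF
        he_op]]] Phi.scale
        Phi_delta_op_0[OF tau_inv_op_closed[OF he_op]] Phi_tau_inv_op[OF he_op])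
qed (simp_all add: U_op_dual.add U_op_dual.scale U_op_dual.zero U_linear Phi_linear)

lemma tau_inv_op_Phi_pow: "x \<in> word_space A True n \<Longrightarrow> Phi A ((tau_op ^^ j) x) = (tau_inv_op ^^ j)
    (Phi A x)"
proof (induction j)
  case (Suc j)
  have "(tau_op ^^ j) x \<in> word_space A True n" using Suc.prems by (induction j) (simp_all add:
      tau_op_closed)
  then show ?case using Suc by (simp add: Phi_tau_op)
qed simp

text \<open>\<open>Phi\<close> turns tau^j into t^j and d_i into d_{n+1-i}, and moving it past h^e
  costs one rotation. The sum over j is then the partial norm of length i, and i -> n + 1 - i gives
  w.\<close>

lemma Phi_V_dual: "x \<in> total_space (Ce A) \<Longrightarrow> Phi A (V_op_dual A x) = V_op A (Phi A x)"
proof (induction rule: total_space_induct)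
  case (C x n)
  let ?y = "\<Sum>i=1..n. \<Sum>j=1..i. (tau_op ^^ j) (delta_op i x)"
  have y: "?y \<in> word_space A True (Suc n)"
  proof (intro word_space_closed)
    fix i j assume "i \<in> {1..n}"
    then have "delta_op i x \<in> word_space A True (Suc n)" using C by (simp add: delta_op_closed)
    then show "(tau_op ^^ j) (delta_op i x) \<in> word_space A True (Suc n)" by (induction j)
        (simp_all add: tau_op_closed)
  qed
  have "tau_op (Phi A ?y) = (\<Sum>i=1..n. cyc.N i (delta_op (Suc n - i) (Phi A x)))"
  proof -
    \<comment> \<open>The outer tau, coming from \<open>Phi_he_op\<close>, undoes one of the j
      rotations.\<close>
    have "tau_op (Phi A ((tau_op ^^ j) (delta_op i x))) = (tau_inv_op ^^ (j - 1)) (delta_op (Suc n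
        - i) (Phi A x))"
      if ij: "i \<in> {1..n}" "j \<in> {1..i}" for i j
    proof -
      obtain k where k: "j = Suc k" using ij by (cases j) auto
      have d: "delta_op i x \<in> word_space A True (Suc n)" using C ij by (simp add: delta_op_closed)
      have e: "delta_op (Suc n - i) (Phi A x) \<in> word_space A True (Suc n)" using Phi_closed[OF C]
          ij by (simp add: delta_op_closed)
      show ?thesis
        using tau_inv_op_Phi_pow[OF d, of j] Phi_delta_op[OF C, of i] ij tau_op_tau_inv_op[OF
            cyc.tp_closed[OF e, of k]] by (simp add: k)
    qed
    then have "tau_op (Phi A ?y) = (\<Sum>i=1..n. \<Sum>j=1..i. (tau_inv_op ^^ (j - 1)) (delta_op (Suc n -
        i) (Phi A x)))"
      unfolding Phi.sum tau_op.sum by (intro sum.cong refl)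
    also have "\<dots> = (\<Sum>i=1..n. cyc.N i (delta_op (Suc n - i) (Phi A x)))"
      unfolding cyc.N_def
      by (intro sum.cong refl sum.reindex_bij_witness[where i = Suc and j = "\<lambda>j. j - 1"]) auto
    finally show ?thesis .
  qed
  also have "\<dots> = cyc.w n (Phi A x)"
    unfolding cyc.w_def
    by (rule sum.reindex_bij_witness[where i = "\<lambda>i. Suc n - i" and j = "\<lambda>i. Suc n - i"]) auto
  finally have "Phi A (he_op ?y) = - he_op (cyc.w n (Phi A x))" using Phi_he_op[OF y] by simp
  then show ?case
    using V_dual_deg[OF C, of n] by (simp add: Phi.scale V_C[OF Phi_closed[OF C]])
next
  case (he_op x n)
  then show ?case
    by (simp add: V_dual_he_op Phi_he_op V_linear V_he_op[OF tau_op_closed[OF Phi_closed[OF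
        he_op]]] Phi.zero)
qed (simp_all add: V_op_dual.add V_op_dual.scale V_op_dual.zero V_linear Phi_linear)

lemma Phi_Gamma: "x \<in> total_space (Ce A) \<Longrightarrow> Phi A (Gamma A x) = Gamma A (Phi A x)"
proof (induction rule: total_space_induct)
  case (C x n)
  then show ?case by (simp add: Gamma_C Gamma_C[OF Phi_closed[OF C]] Phi_linear)
next
  case (he_op x n)
  then show ?case
    by (simp add: Gamma_he_op[OF he_op] Phi_linear Phi_he_op[OF he_op] Gamma.neg Gamma_he_op[OF
        tau_op_closed[OF Phi_closed[OF he_op]]])
qed (simp_all add: Gamma_linear Phi_linear)

text \<open>Supplies the injectivity of \<open>Phi A\<close> that determines the inverse taken in
  \<open>dual_connection\<close>.\<close>

lemma Phi_Phi: "x \<in> total_space (Ce A) \<Longrightarrow> Phi A (Phi A x) = x"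
proof (induction rule: total_space_induct)
  case (he_op x n)
  have "Phi A (Phi A (he_op x)) = he_op (tau_op (Phi A (tau_op (Phi A x))))"
    using he_op by (simp add: Phi_linear Phi_he_op[OF he_op] Phi_he_op[OF tau_op_closed[OF
        Phi_closed[OF he_op]]])
  also have "\<dots> = he_op x"
    using he_op by (simp add: Phi_tau_op[OF Phi_closed[OF he_op]] tau_op_tau_inv_op[OF
        Phi_closed[OF Phi_closed[OF he_op]]] tau_op_tau_inv_op[OF he_op] Phi_Phi_C[OF he_op])
  finally show ?case .
qed (simp_all add: Phi_linear Phi_Phi_C)

lemma dual_connection_nabla:
  assumes f: "f \<in> laurent (total_space (Ce A))"
  shows "dual_connection nabla A f = nabla_circ A f"
proof
  fix m
  have T: "f j \<in> total_space (Ce A)" for j using f by (simp add: laurent_def)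
  let ?g = "u_flip (\<lambda>j. Phi A (f j))"
  let ?x = "U_op_dual A (f (m + 2)) + (V_op_dual A (f (m + 1)) + Gamma A (f (m + 1)))"
  have inj: "inj_on (Phi A) (total_space (Ce A))"
    by (rule inj_on_inverseI[of _ "Phi A"]) (rule Phi_Phi)
  \<comment> \<open>Flipping before and after leaves a shift by two unchanged and negates a shift by
    one; with the signs in \<open>Phi_U_dual\<close> and \<open>Phi_V_dual\<close> everything
    acquires the same minus.\<close>
  have "u_flip (\<lambda>j. nabla (opp A) ?g j - ddu csmult ?g j) m = Phi A (- ?x)"
    by (simp add: u_flip_def nabla_def upow_def V_op_opp Gamma_opp Phi_linear Phi_U_dual[OF T]
        Phi_V_dual[OF T] Phi_Gamma[OF T]
        U_linear V_linear Gamma_linear)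
  moreover have "inv_into (total_space (Ce A)) (Phi A) (Phi A (- ?x)) = - ?x"
    by (rule inv_into_f_f[OF inj]) (intro total_space_closed total_closed T)
  ultimately show "dual_connection nabla A f m = nabla_circ A f m"
    by (simp add: dual_connection_def nabla_circ_def upow_def algebra_simps)
qed

end

theorem proposition3p4:
  fixes A :: "('k::field, 'a::ab_group_add) dga"
  assumes "CHAR('k) \<noteq> 2"
    and "dg_algebra A"
  shows "u_connection csmult (Ce A) (be A) (Be A) (nabla A) \<and>
    (\<forall>f\<in>laurent (total_space (Ce A)). dual_connection nabla A f = nabla_circ A f)"
proof -
  interpret dg_algebra A by (rule assms(2))
  have "(2 :: 'k) \<noteq> 0"
  proof
    assume "(2 :: 'k) = 0"
    then have "of_nat 2 = (0 :: 'k)" by simp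
    then have "CHAR('k) dvd 2" by (simp only: of_nat_eq_0_iff_char_dvd)
    then have "CHAR('k) = 1 \<or> CHAR('k) = 2" using two_is_prime_nat unfolding prime_nat_iff by blast
    with assms(1) show False using CHAR_not_1[where 'a = 'k] by simp
  qed
  then show ?thesis using u_connection_nabla dual_connection_nabla by blast
qed

end
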